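(* Let $T>0$, $H\in(\frac12,1)$, $0<\beta,\delta\le1$, $\alpha_0:=\min\{\frac12,\beta,\frac{\delta}{1+\delta}\}$ and let $\alpha$ satisfy $1-H<\alpha<\alpha_0$. Let $W^H$ be an $m$-dimensional fractional Brownian motion with Hurst parameter $H$, $X_0$ a $d$-dimensional random variable, and let $X$ be the unique (pathwise) solution of $$X_t=X_0+\int_0^t b(t,s,X_s)\,ds+\int_0^t\sigma(t,s,X_s)\,dW^H_s,\qquad t\in(0,T].$$ (i) Assume that $\sigma:[0,T]^2\times\mathbb{R}^d\to\mathbb{R}^{d\times m}$ is of class $\mathcal S(\beta,1,\delta)$, $b:[0,T]^2\times\mathbb{R}^d\to\mathbb{R}^d$ is of class $\mathcal B(1,1/\alpha)$, and $\mathbf{E}(|X_0|^p)<\infty$ for all $p\ge2$. Then for all $p\ge2$ $$\mathbf{E}\left(\sup_{0\le t\le T}|X_t|^p\right)<\infty.$$ (ii) Assume that $\sigma$ is bounded and of class $\mathcal S(\beta,1,\delta)$, $b$ is of class $\mathcal B_0(1,1/\alpha)$, and $\mathbf{E}\left(\exp(\lambda|X_0|^\gamma)\right)<\infty$ for any $\lambda>0$ and $0<\gamma<2H$. Then $$\mathbf{E}\left(\exp\left(\lambda\sup_{0\le t\le T}|X_t|^\gamma\right)\right)<\infty$$ for any $\lambda>0$ and $0<\gamma<2H$.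
   Context: An $m$-dimensional fractional Brownian motion $W^H=(W^{H,1},\dots,W^{H,m})$ on $[0,T]$ is a centered continuous Gaussian process with independent components and $\mathbf{E}(W^{H,i}_tW^{H,j}_s)=\frac12(t^{2H}+s^{2H}-|t-s|^{2H})\delta_{ij}$. Its paths are a.s. Hölder continuous of every order $<H$, and the stochastic integral is the pathwise Riemann–Stieltjes (Young) integral. The solution $X$ is the process whose paths are a.s. in $C^{1-\alpha}(0,T;\mathbb{R}^d)$ (the $(1-\alpha)$-Hölder functions) and solve the equation pathwise; its existence and uniqueness under these hypotheses are known. Class $\mathcal S(\beta,\mu,\delta)$, $0<\beta,\mu,\delta\le1$: measurable functions $\sigma(t,s,x)$ on $[0,T]^2\times\mathbb{R}^d$ with values in a finite-dimensional Euclidean space such that $\partial_x\sigma,\partial_t\sigma,\partial^2_{x,t}\sigma$ exist and there are $K>0$ and, for every $N\ge0$, $K_N>0$ such that for all $s,t,s_1,s_2,t_1,t_2\in[0,T]$, $i=1,\dots,d$: (1) $|\sigma(t,s,x)-\sigma(t,s,y)|+|\partial_t\sigma(t,s,x)-\partial_t\sigma(t,s,y)|\le K|x-y|$ for all $x,y\in\mathbb{R}^d$; (2) $|\partial_{x_i}\sigma(t,s,x)-\partial_{x_i}\sigma(t,s,y)|+|\partial^2_{x_i,t}\sigma(t,s,x)-\partial^2_{x_i,t}\sigma(t,s,y)|\le K_N|x-y|^\delta$ for all $|x|,|y|\le N$; (3) $|\sigma(t_1,s,x)-\sigma(t_2,s,x)|+|\partial_{x_i}\sigma(t_1,s,x)-\partial_{x_i}\sigma(t_2,s,x)|\le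 K|t_1-t_2|^\mu$ for all $x$; (4) $|\sigma(t,s_1,x)-\sigma(t,s_2,x)|+|\partial_t\sigma(t,s_1,x)-\partial_t\sigma(t,s_2,x)|\le K|s_1-s_2|^\beta$ for all $x$; (5) $|\partial^2_{x_i,t}\sigma(t,s_1,x)-\partial^2_{x_i,t}\sigma(t,s_2,x)|+|\partial_{x_i}\sigma(t,s_1,x)-\partial_{x_i}\sigma(t,s_2,x)|\le K|s_1-s_2|^\beta$ for all $x$. Class $\mathcal B(\mu,\rho)$, $0<\mu\le1$, $\rho\ge2$: measurable functions $b(t,s,x)$ on $[0,T]^2\times\mathbb{R}^d$ for which there are $b_0\in L^\rho([0,T]^2)$, constants $L,L_0>0$ and, for every $N\ge 0$, $L_N>0$ such that for all $s,t,t_1,t_2\in[0,T]$: (1) $|b(t,s,x)-b(t,s,y)|\le L_N|x-y|$ for $|x|,|y|\le N$; (2) $|b(t_1,s,x)-b(t_2,s,x)|\le L|t_1-t_2|^\mu$ for all $x$; (3) $|b(t,s,x)|\le L_0|x|+b_0(t,s)$ for all $x$; (4) $|b(t_1,s,x_1)-b(t_1,s,x_2)-b(t_2,s,x_1)+b(t_2,s,x_2)|\le L_N|t_1-t_2||x_1-x_2|$ for $|x_1|,|x_2|\le N$. Class $\mathcal B_0(\mu,\rho)$: defined as $\mathcal B(\mu,\rho)$ but with (3) replaced by $|b(t,s,x)|\le L_0+b_0(t,s)$ for all $x\in\mathbb{R}^d$, $s,t\in[0,T]$. *)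

theory Defs
  imports "HOL-Probability.Probability"
begin

section \<open>Fractional Brownian motion\<close>

(* Normal laws of variance zero, i.e. constants, count as Gaussian. *)
definition gaussian_rv :: "'w measure \<Rightarrow> ('w \<Rightarrow> real) \<Rightarrow> bool" where
  "gaussian_rv M Y \<longleftrightarrow> Y \<in> borel_measurable M \<and>
     ((\<exists>\<mu> \<sigma>. \<sigma> > 0 \<and> distributed M lborel Y (\<lambda>x. ennreal (normal_density \<mu> \<sigma> x))) \<or>
      (\<exists>c. AE \<omega> in M. Y \<omega> = c))"

definition gaussian_process ::
  "'w measure \<Rightarrow> real set \<Rightarrow> (real \<Rightarrow> 'w \<Rightarrow> 'a::euclidean_space) \<Rightarrow> bool" where
  "gaussian_process M I W \<longleftrightarrow>
     (\<forall>t\<in>I. W t \<in> borel_measurable M) \<and>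
     (\<forall>(n::nat) \<tau> a. (\<forall>k<n. \<tau> k \<in> I) \<longrightarrow>
        gaussian_rv M (\<lambda>\<omega>. \<Sum>k<n. a k \<bullet> W (\<tau> k) \<omega>))"

(* Independence of the components is that of the processes, seen as random elements of the
   product space over [0,T]. *)
definition fractional_brownian_motion ::
  "'w measure \<Rightarrow> real \<Rightarrow> real \<Rightarrow> (real \<Rightarrow> 'w \<Rightarrow> real ^ 'm::finite) \<Rightarrow> bool" where
  "fractional_brownian_motion M T H W \<longleftrightarrow>
     gaussian_process M {0..T} W \<and>
     (\<forall>t\<in>{0..T}. \<forall>i. (LINT \<omega>|M. W t \<omega> $ i) = 0) \<and>
     prob_space.indep_vars M (\<lambda>i::'m. Pi\<^sub>M {0..T} (\<lambda>t. borel))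
       (\<lambda>i \<omega>. \<lambda>t\<in>{0..T}. W t \<omega> $ i) UNIV \<and>
     (\<forall>t\<in>{0..T}. \<forall>s\<in>{0..T}. \<forall>i j.
        (LINT \<omega>|M. W t \<omega> $ i * W s \<omega> $ j) =
          (if i = j then 1/2 * (t powr (2*H) + s powr (2*H) - \<bar>t - s\<bar> powr (2*H)) else 0)) \<and>
     (AE \<omega> in M. continuous_on {0..T} (\<lambda>t. W t \<omega>))"

section \<open>Coefficient classes\<close>

(* One-sided at the end points of [0,T]. *)
definition partial_t ::
  "real \<Rightarrow> (real \<Rightarrow> real \<Rightarrow> 'a \<Rightarrow> 'e::real_normed_vector) \<Rightarrow> real \<Rightarrow> real \<Rightarrow> 'a \<Rightarrow> 'e" where
  "partial_t T f t s x = vector_derivative (\<lambda>u. f u s x) (at t within {0..T})"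

definition partial_x ::
  "'d::finite \<Rightarrow> (real \<Rightarrow> real \<Rightarrow> real ^ 'd \<Rightarrow> 'e::real_normed_vector)
    \<Rightarrow> real \<Rightarrow> real \<Rightarrow> real ^ 'd \<Rightarrow> 'e" where
  "partial_x i f t s x = vector_derivative (\<lambda>h. f t s (x + h *\<^sub>R axis i 1)) (at 0)"

(* Coefficients are total functions; only their values on [0,T] x [0,T] x R^d matter. *)
definition measurable_coefficient ::
  "real \<Rightarrow> (real \<Rightarrow> real \<Rightarrow> real ^ 'd::finite \<Rightarrow> 'e::euclidean_space) \<Rightarrow> bool" where
  "measurable_coefficient T f \<longleftrightarrow>
     (\<lambda>(t, s, x). f t s x)
       \<in> borel_measurable (restrict_space borel ({0..T} \<times> {0..T} \<times> UNIV))"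

(* The mixed derivative is read as the derivative in x_i of the derivative in t. *)
definition class_S ::
  "real \<Rightarrow> real \<Rightarrow> real \<Rightarrow> real \<Rightarrow>
    (real \<Rightarrow> real \<Rightarrow> real ^ 'd::finite \<Rightarrow> 'e::euclidean_space) \<Rightarrow> bool" where
  "class_S T \<beta> \<mu> \<delta> \<sigma> \<longleftrightarrow>
     measurable_coefficient T \<sigma> \<and>
     (\<forall>t\<in>{0..T}. \<forall>s\<in>{0..T}. \<forall>x i.
        (\<lambda>u. \<sigma> u s x) differentiable (at t within {0..T}) \<and>
        (\<lambda>h. \<sigma> t s (x + h *\<^sub>R axis i 1)) differentiable (at 0) \<and>
        (\<lambda>h. partial_t T \<sigma> t s (x + h *\<^sub>R axis i 1)) differentiable (at 0)) \<and>
     (\<exists>K>0.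
        (\<forall>t\<in>{0..T}. \<forall>s\<in>{0..T}. \<forall>x y.
           norm (\<sigma> t s x - \<sigma> t s y) + norm (partial_t T \<sigma> t s x - partial_t T \<sigma> t s y)
             \<le> K * norm (x - y)) \<and>
        (\<forall>N\<ge>0. \<exists>KN>0. \<forall>t\<in>{0..T}. \<forall>s\<in>{0..T}. \<forall>i x y. norm x \<le> N \<longrightarrow> norm y \<le> N \<longrightarrow>
           norm (partial_x i \<sigma> t s x - partial_x i \<sigma> t s y)
             + norm (partial_x i (partial_t T \<sigma>) t s x - partial_x i (partial_t T \<sigma>) t s y)
             \<le> KN * norm (x - y) powr \<delta>) \<and>
        (\<forall>t1\<in>{0..T}. \<forall>t2\<in>{0..T}. \<forall>s\<in>{0..T}. \<forall>i x.
           norm (\<sigma> t1 s x - \<sigma> t2 s x) + norm (partial_x i \<sigma> t1 s x - partial_x i \<sigma> t2 s x)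
             \<le> K * \<bar>t1 - t2\<bar> powr \<mu>) \<and>
        (\<forall>t\<in>{0..T}. \<forall>s1\<in>{0..T}. \<forall>s2\<in>{0..T}. \<forall>x.
           norm (\<sigma> t s1 x - \<sigma> t s2 x) + norm (partial_t T \<sigma> t s1 x - partial_t T \<sigma> t s2 x)
             \<le> K * \<bar>s1 - s2\<bar> powr \<beta>) \<and>
        (\<forall>t\<in>{0..T}. \<forall>s1\<in>{0..T}. \<forall>s2\<in>{0..T}. \<forall>i x.
           norm (partial_x i (partial_t T \<sigma>) t s1 x - partial_x i (partial_t T \<sigma>) t s2 x)
             + norm (partial_x i \<sigma> t s1 x - partial_x i \<sigma> t s2 x)
             \<le> K * \<bar>s1 - s2\<bar> powr \<beta>))"

definition L_space_square :: "real \<Rightarrow> real \<Rightarrow> (real \<times> real \<Rightarrow> real) \<Rightarrow> bool" where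
  "L_space_square T \<rho> f \<longleftrightarrow>
     f \<in> borel_measurable (lebesgue_on ({0..T} \<times> {0..T})) \<and>
     integrable (lebesgue_on ({0..T} \<times> {0..T})) (\<lambda>z. \<bar>f z\<bar> powr \<rho>)"

(* The requirements shared by the two drift classes: everything but the growth condition. *)
definition drift_regular ::
  "real \<Rightarrow> real \<Rightarrow> (real \<Rightarrow> real \<Rightarrow> real ^ 'd::finite \<Rightarrow> 'e::euclidean_space) \<Rightarrow> bool" where
  "drift_regular T \<mu> b \<longleftrightarrow>
     measurable_coefficient T b \<and>
     (\<exists>L>0. \<forall>t1\<in>{0..T}. \<forall>t2\<in>{0..T}. \<forall>s\<in>{0..T}. \<forall>x.
        norm (b t1 s x - b t2 s x) \<le> L * \<bar>t1 - t2\<bar> powr \<mu>) \<and>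
     (\<forall>N\<ge>0. \<exists>LN>0.
        (\<forall>t\<in>{0..T}. \<forall>s\<in>{0..T}. \<forall>x y. norm x \<le> N \<longrightarrow> norm y \<le> N \<longrightarrow>
           norm (b t s x - b t s y) \<le> LN * norm (x - y)) \<and>
        (\<forall>t1\<in>{0..T}. \<forall>t2\<in>{0..T}. \<forall>s\<in>{0..T}. \<forall>x1 x2. norm x1 \<le> N \<longrightarrow> norm x2 \<le> N \<longrightarrow>
           norm (b t1 s x1 - b t1 s x2 - b t2 s x1 + b t2 s x2)
             \<le> LN * \<bar>t1 - t2\<bar> * norm (x1 - x2)))"

definition class_B ::
  "real \<Rightarrow> real \<Rightarrow> real \<Rightarrow>
    (real \<Rightarrow> real \<Rightarrow> real ^ 'd::finite \<Rightarrow> 'e::euclidean_space) \<Rightarrow> bool" where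
  "class_B T \<mu> \<rho> b \<longleftrightarrow> drift_regular T \<mu> b \<and>
     (\<exists>b0. L_space_square T \<rho> b0 \<and>
        (\<exists>L0>0. \<forall>t\<in>{0..T}. \<forall>s\<in>{0..T}. \<forall>x. norm (b t s x) \<le> L0 * norm x + b0 (t, s)))"

definition class_B0 ::
  "real \<Rightarrow> real \<Rightarrow> real \<Rightarrow>
    (real \<Rightarrow> real \<Rightarrow> real ^ 'd::finite \<Rightarrow> 'e::euclidean_space) \<Rightarrow> bool" where
  "class_B0 T \<mu> \<rho> b \<longleftrightarrow> drift_regular T \<mu> b \<and>
     (\<exists>b0. L_space_square T \<rho> b0 \<and>
        (\<exists>L0>0. \<forall>t\<in>{0..T}. \<forall>s\<in>{0..T}. \<forall>x. norm (b t s x) \<le> L0 + b0 (t, s)))"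

section \<open>Pathwise solutions\<close>

definition holder_on ::
  "real set \<Rightarrow> real \<Rightarrow> (real \<Rightarrow> 'a::real_normed_vector) \<Rightarrow> bool" where
  "holder_on I \<kappa> x \<longleftrightarrow>
     (\<exists>C. \<forall>s\<in>I. \<forall>t\<in>I. norm (x t - x s) \<le> C * \<bar>t - s\<bar> powr \<kappa>)"

(* Riemann-Stieltjes integral of a matrix-valued F against a vector-valued g: limit of the
   Riemann-Stieltjes sums, for arbitrary tags, as the mesh of the partition tends to 0.
   Degenerate intervals contribute 0. *)
definition has_RS_integral ::
  "(real \<Rightarrow> real ^ 'm::finite ^ 'd::finite) \<Rightarrow> (real \<Rightarrow> real ^ 'm) \<Rightarrow> real \<Rightarrow> real
    \<Rightarrow> real ^ 'd \<Rightarrow> bool" where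
  "has_RS_integral F g a b J \<longleftrightarrow>
     (\<forall>\<epsilon>>0. \<exists>\<eta>>0. \<forall>p. p tagged_division_of {a..b} \<and> (\<forall>(\<xi>, K)\<in>p. Sup K - Inf K < \<eta>) \<longrightarrow>
        norm ((\<Sum>(\<xi>, K)\<in>p. F \<xi> *v (g (Sup K) - g (Inf K))) - J) < \<epsilon>)"

definition pathwise_solution ::
  "'w measure \<Rightarrow> real \<Rightarrow> real \<Rightarrow>
    (real \<Rightarrow> real \<Rightarrow> real ^ 'd::finite \<Rightarrow> real ^ 'd) \<Rightarrow>
    (real \<Rightarrow> real \<Rightarrow> real ^ 'd \<Rightarrow> real ^ 'm::finite ^ 'd) \<Rightarrow>
    (real \<Rightarrow> 'w \<Rightarrow> real ^ 'm) \<Rightarrow> ('w \<Rightarrow> real ^ 'd) \<Rightarrow> (real \<Rightarrow> 'w \<Rightarrow> real ^ 'd) \<Rightarrow> bool" where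
  "pathwise_solution M T \<kappa> b \<sigma> W X0 X \<longleftrightarrow>
     (\<forall>t\<in>{0..T}. X t \<in> borel_measurable M) \<and>
     (AE \<omega> in M.
        holder_on {0..T} \<kappa> (\<lambda>t. X t \<omega>) \<and>
        X 0 \<omega> = X0 \<omega> \<and>
        (\<forall>t\<in>{0<..T}.
           set_integrable lborel {0..t} (\<lambda>s. b t s (X s \<omega>)) \<and>
           (\<exists>J. has_RS_integral (\<lambda>s. \<sigma> t s (X s \<omega>)) (\<lambda>s. W s \<omega>) 0 t J \<and>
                X t \<omega> = X0 \<omega> + (LINT s:{0..t}|lborel. b t s (X s \<omega>)) + J)))"

(* Almost surely a path of a solution is continuous, hence bounded, so that the real-valued
   supremum is meaningful; off that event its value does not affect expectations. *)
definition sup_path :: "real \<Rightarrow> (real \<Rightarrow> 'w \<Rightarrow> 'a::real_normed_vector) \<Rightarrow> 'w \<Rightarrow> real" where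
  "sup_path T X \<omega> = (SUP t\<in>{0..T}. norm (X t \<omega>))"

(* Expectation of a nonnegative variable, with values in [0,\<infinity>]. It is a nonnegative integral since
   M need not be complete: the supremum of the path is only almost everywhere equal to a measurable
   function (the supremum over a countable dense set of times), and the nonnegative integral
   respects almost everywhere equality without measurability. *)
definition expect_nn :: "'w measure \<Rightarrow> ('w \<Rightarrow> real) \<Rightarrow> ennreal" where
  "expect_nn M Y = (\<integral>\<^sup>+ \<omega>. ennreal (Y \<omega>) \<partial>M)"

end

theory Submission
  imports Defs "HOL-Real_Asymp.Real_Asymp"
begin

text \<open>
  Fix a path and an exponent \<open>\<theta>\<close> with \<open>1 - \<alpha> < \<theta> < H\<close>, and let \<open>G\<close> be the \<open>\<theta>\<close>-Hoelder constant of the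
  driving path. On windows of length \<open>h \<approx> (1 + G) powr (- 1 / \<theta>)\<close> the noise is small, so Young's
  estimate lets one absorb the Hoelder seminorm of \<open>X\<close>; it is then bounded in a window by a constant
  (bounded coefficients) or by a small multiple of \<open>1 + sup |X|\<close> (linear growth). The memory term
  \<open>\<integral>\<^sub>0\<^sup>s (\<sigma>(t,u,X\<^sub>u) - \<sigma>(s,u,X\<^sub>u)) dW\<^sub>u\<close> fits into this scheme because it carries a factor \<open>t - s\<close>, which
  compensates for the number of windows in \<open>[0,s]\<close>. Adding up the windows yields
  \<open>sup |X| \<le> |X\<^sub>0| + C (1 + G) powr (1 / \<theta>)\<close>, respectively
  \<open>2 + sup |X| \<le> exp (C (1 + G) powr (1 / \<theta>)) (2 + |X\<^sub>0|)\<close>. Chaining over dyadic points gives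
  \<open>E exp (c G powr \<kappa>) < \<infinity>\<close> for all \<open>\<kappa> < 2\<close>, and this suffices: \<open>1 / \<theta> < 2\<close> since \<open>\<theta> > 1 / 2\<close>, and
  \<open>\<gamma> / \<theta> < 2\<close> for \<open>\<theta>\<close> close to \<open>H\<close>.
\<close>

section \<open>Riemann-Stieltjes sums and Young's estimate\<close>

text \<open>The equation supplies only the integral of \<open>\<sigma> t u (X u)\<close> over [0,t]
  for each single t. Splitting the difference of two such integrals into a recent part over [s,t]
  and a memory part over [0,s] would presuppose integrals that are not given. The splitting is
  therefore made on finite Riemann-Stieltjes sums, with bounds uniform in the refinement, and the
  integrals enter only as limits of these sums. On a window the memory part is linear in r = (t - s)
  / h, which lies in [0,1], so r is at most r to the power 1 - \<alpha> and the memory has the same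
  shape as the recent part. The Hoelder regularity built into the notion of solution is used only
  qualitatively: it makes the seminorm and the supremum finite, so that they can be absorbed, and
  leaves no trace in the constants. The constants depend on T, the exponents and the coefficients
  alone; all randomness sits in |X0| and G. Since these two may be dependent, they are separated by
  x y \<le> x^2 + y^2 before expectations are taken.\<close>

definition RS_sum ::
  "(real \<Rightarrow> real ^ 'm::finite ^ 'd::finite) \<Rightarrow> (real \<Rightarrow> real ^ 'm) \<Rightarrow> real \<Rightarrow> real \<Rightarrow> real
    \<Rightarrow> real ^ 'd \<Rightarrow> bool" where
  "RS_sum F g \<eta> a b S \<longleftrightarrow>
     (\<exists>p. p tagged_division_of {a..b} \<and> (\<forall>(\<xi>, K)\<in>p. Sup K - Inf K < \<eta>) \<and>
        (\<Sum>(\<xi>, K)\<in>p. F \<xi> *v (g (Sup K) - g (Inf K))) = S)"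

lemma RS_sum_single:
  assumes "a \<le> b" "b - a < \<eta>"
  shows "RS_sum F g \<eta> a b (F a *v (g b - g a))"
  unfolding RS_sum_def
  using assms by (intro exI[of _ "{(a, {a..b})}"]) (auto intro: tagged_division_of_self_real)

lemma RS_sum_append:
  assumes "a \<le> c" "c \<le> b" "RS_sum F g \<eta> a c S" "RS_sum F g \<eta> c b S'"
  shows "RS_sum F g \<eta> a b (S + S')"
proof -
  obtain p where p: "p tagged_division_of {a..c}" "\<forall>(\<xi>, K)\<in>p. Sup K - Inf K < \<eta>"
    "(\<Sum>(\<xi>, K)\<in>p. F \<xi> *v (g (Sup K) - g (Inf K))) = S"
    using assms by (auto simp: RS_sum_def)
  obtain q where q: "q tagged_division_of {c..b}" "\<forall>(\<xi>, K)\<in>q. Sup K - Inf K < \<eta>"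
    "(\<Sum>(\<xi>, K)\<in>q. F \<xi> *v (g (Sup K) - g (Inf K))) = S'"
    using assms by (auto simp: RS_sum_def)
  have "p \<union> q tagged_division_of ({a..c} \<union> {c..b})"
    by (rule tagged_division_Un[OF p(1) q(1)]) auto
  moreover have "{a..c} \<union> {c..b} = {a..b}" using assms by auto
  moreover have "(\<Sum>(\<xi>, K)\<in>p \<union> q. F \<xi> *v (g (Sup K) - g (Inf K))) = S + S'"
  proof -
    \<comment> \<open>The two divisions may share tagged intervals, which the union would count once
      instead of twice. A shared interval lies in both halves, so it is {c} and contributes
      0.\<close>
    have "F \<xi> *v (g (Sup K) - g (Inf K)) = 0" if "(\<xi>, K) \<in> p \<inter> q" for \<xi> K
    proof -
      have "\<xi> \<in> K" "K \<subseteq> {a..c}" "K \<subseteq> {c..b}"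
        using that tagged_division_ofD(2,3)[OF p(1)] tagged_division_ofD(3)[OF q(1)] by blast+
      moreover from this have "K \<subseteq> {c}" by fastforce
      ultimately have "K = {c}" by blast
      then show ?thesis by simp
    qed
    then have "(\<Sum>(\<xi>, K)\<in>p \<union> q. F \<xi> *v (g (Sup K) - g (Inf K))) =
       (\<Sum>(\<xi>, K)\<in>p. F \<xi> *v (g (Sup K) - g (Inf K))) + (\<Sum>(\<xi>, K)\<in>q. F \<xi> *v (g (Sup K) - g (Inf K)))"
      using p(1) q(1) by (intro sum.union_inter_neutral) auto
    then show ?thesis using p(3) q(3) by simp
  qed
  ultimately show ?thesis
    unfolding RS_sum_def using p(2) q(2) by (intro exI[of _ "p \<union> q"]) auto
qed

lemma RS_sum_mono:
  assumes "RS_sum F g \<eta> a b S" "\<eta> \<le> \<eta>'"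
  shows "RS_sum F g \<eta>' a b S"
proof -
  obtain p where p: "p tagged_division_of {a..b}" "\<forall>(\<xi>, K)\<in>p. Sup K - Inf K < \<eta>"
    "(\<Sum>(\<xi>, K)\<in>p. F \<xi> *v (g (Sup K) - g (Inf K))) = S"
    using assms(1) unfolding RS_sum_def by blast
  have "\<forall>(\<xi>, K)\<in>p. Sup K - Inf K < \<eta>'"
    using p(2) assms(2) by (auto intro: less_le_trans)
  then show ?thesis unfolding RS_sum_def using p(1,3) by blast
qed

lemma has_RS_integralD:
  assumes "has_RS_integral F g a b J" "\<epsilon> > 0"
  obtains \<eta> where "\<eta> > 0" "\<And>S. RS_sum F g \<eta> a b S \<Longrightarrow> norm (S - J) < \<epsilon>"
proof -
  from assms obtain \<eta> where \<eta>: "\<eta> > 0" and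
    *: "\<And>p. p tagged_division_of {a..b} \<and> (\<forall>(\<xi>, K)\<in>p. Sup K - Inf K < \<eta>) \<Longrightarrow>
        norm ((\<Sum>(\<xi>, K)\<in>p. F \<xi> *v (g (Sup K) - g (Inf K))) - J) < \<epsilon>"
    unfolding has_RS_integral_def by blast
  show ?thesis
  proof (rule that[OF \<eta>])
    fix S assume "RS_sum F g \<eta> a b S"
    then show "norm (S - J) < \<epsilon>" unfolding RS_sum_def using * by blast
  qed
qed

text \<open>\<open>pathwise_solution\<close> speaks of positive times only; this covers time 0, so
  that increments starting at 0 need no separate treatment.\<close>

lemma has_RS_integral_trivial: "has_RS_integral F g a a 0"
  unfolding has_RS_integral_def
proof (intro allI impI exI[of _ 1] conjI)
  fix \<epsilon> :: real and p assume \<epsilon>: "\<epsilon> > 0" and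
    "p tagged_division_of {a..a} \<and> (\<forall>(\<xi>, K)\<in>p. Sup K - Inf K < 1)"
  then have p: "p tagged_division_of {a..a}" by blast
  have "F \<xi> *v (g (Sup K) - g (Inf K)) = 0" if "(\<xi>, K) \<in> p" for \<xi> K
  proof -
    have "\<xi> \<in> K" "K \<subseteq> {a}" using that tagged_division_ofD(2,3)[OF p] by auto
    then have "K = {a}" by blast
    then show ?thesis by simp
  qed
  then have "(\<Sum>(\<xi>, K)\<in>p. F \<xi> *v (g (Sup K) - g (Inf K))) = 0"
    by (intro sum.neutral) auto
  then show "norm ((\<Sum>(\<xi>, K)\<in>p. F \<xi> *v (g (Sup K) - g (Inf K))) - 0) < \<epsilon>"
    using \<epsilon> by simp
qed simp

text \<open>Sums with left tags over 2^k equal cells of [p, p + l]. The recursion by halving, rather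
  than a sum over an index, turns Young's estimate into an induction on the depth.\<close>

fun dyadic_sum ::
  "(real \<Rightarrow> real ^ 'm::finite ^ 'd::finite) \<Rightarrow> (real \<Rightarrow> real ^ 'm) \<Rightarrow> nat \<Rightarrow> real \<Rightarrow> real
    \<Rightarrow> real ^ 'd" where
  "dyadic_sum F g 0 p l = F p *v (g (p + l) - g p)"
| "dyadic_sum F g (Suc k) p l = dyadic_sum F g k p (l / 2) + dyadic_sum F g k (p + l / 2) (l / 2)"

lemma RS_sum_dyadic:
  assumes "0 \<le> l" "l / 2 ^ k < \<eta>"
  shows "RS_sum F g \<eta> p (p + l) (dyadic_sum F g k p l)"
  using assms
proof (induction k arbitrary: p l)
  case 0
  then show ?case using RS_sum_single[of p "p + l" \<eta> F g] by simp
next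
  case (Suc k)
  have 1: "RS_sum F g \<eta> p (p + l / 2) (dyadic_sum F g k p (l / 2))"
    using Suc by (intro Suc.IH) auto
  have "RS_sum F g \<eta> (p + l / 2) (p + l / 2 + l / 2) (dyadic_sum F g k (p + l / 2) (l / 2))"
    using Suc by (intro Suc.IH) auto
  then have 2: "RS_sum F g \<eta> (p + l / 2) (p + l) (dyadic_sum F g k (p + l / 2) (l / 2))"
    by (simp add: add.assoc)
  show ?case using RS_sum_append[OF _ _ 1 2] Suc.prems by simp
qed

text \<open>For the memory over [0,s]: the path is controlled only on windows of length at most h,
  so [0,s] is cut into equal windows and each is refined dyadically.\<close>

lemma RS_sum_dyadic_windows:
  assumes "0 \<le> l" "l / 2 ^ k < \<eta>" "\<eta> > 0"
  shows "RS_sum F g \<eta> 0 (real N * l) (\<Sum>i<N. dyadic_sum F g k (real i * l) l)"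
proof (induction N)
  case 0
  then show ?case using RS_sum_single[of 0 0 \<eta> F g] assms by simp
next
  case (Suc N)
  have "RS_sum F g \<eta> (real N * l) (real N * l + l) (dyadic_sum F g k (real N * l) l)"
    by (rule RS_sum_dyadic[OF assms(1,2)])
  then have "RS_sum F g \<eta> 0 (real N * l + l)
      ((\<Sum>i<N. dyadic_sum F g k (real i * l) l) + dyadic_sum F g k (real N * l) l)"
    using assms by (intro RS_sum_append[OF _ _ Suc]) auto
  then show ?case by (simp add: algebra_simps)
qed

lemma dyadic_sum_diff:
  "dyadic_sum (\<lambda>u. F u - F' u) g k p l = dyadic_sum F g k p l - dyadic_sum F' g k p l"
  by (induction k arbitrary: p l) (auto simp: matrix_vector_mult_diff_rdistrib)

text \<open>The norm on \<open>real ^ 'm ^ 'd\<close> is the Frobenius norm, so Cauchy-Schwarz on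
  each row suffices.\<close>

lemma norm_matrix_vector_mult_le:
  fixes A :: "real ^ 'm::finite ^ 'd::finite"
  shows "norm (A *v x) \<le> norm A * norm x"
proof -
  have "norm (A *v x) \<le> L2_set (\<lambda>i. norm (A $ i) * norm x) UNIV"
    unfolding norm_vec_def[of "A *v x"]
    by (intro L2_set_mono) (auto simp: matrix_vector_mul_component Cauchy_Schwarz_ineq2)
  also have "\<dots> = norm A * norm x"
    by (simp add: L2_set_right_distrib[symmetric] L2_set_left_distrib norm_vec_def[of A])
  finally show ?thesis .
qed

text \<open>Young's estimate by self-similarity: refining an interval costs one mixed increment and halves
  the scale, and the constant solves \<open>2 * C * (l/2) powr \<rho> + c * (l/2) powr \<rho> = C * l powr \<rho>\<close>.\<close>

lemma dyadic_sum_Young: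
  assumes \<rho>: "\<kappa> + \<theta> > 1" and l: "0 \<le> l" and c: "0 \<le> cF" "0 \<le> cg"
    and F: "\<And>u v. p \<le> u \<Longrightarrow> u \<le> v \<Longrightarrow> v \<le> p + l \<Longrightarrow> norm (F v - F u) \<le> cF * (v - u) powr \<kappa>"
    and g: "\<And>u v. p \<le> u \<Longrightarrow> u \<le> v \<Longrightarrow> v \<le> p + l \<Longrightarrow> norm (g v - g u) \<le> cg * (v - u) powr \<theta>"
  shows "norm (dyadic_sum F g k p l - F p *v (g (p + l) - g p))
           \<le> cF * cg / (2 powr (\<kappa> + \<theta>) - 2) * l powr (\<kappa> + \<theta>)"
  using l F g
proof (induction k arbitrary: p l)
  case 0
  have "2 powr 1 < (2::real) powr (\<kappa> + \<theta>)" using \<rho> by (intro powr_less_mono) auto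
  then show ?case using c by simp
next
  case (Suc k)
  let ?\<rho> = "\<kappa> + \<theta>"
  define C where "C = cF * cg / (2 powr ?\<rho> - 2)"
  have 2: "(2::real) powr ?\<rho> > 2" using \<rho> powr_less_mono[of 1 ?\<rho> "2::real"] by simp
  let ?m = "p + l / 2"
  have half: "?m + l / 2 = p + l" by simp
  have A: "norm (dyadic_sum F g k p (l/2) - F p *v (g ?m - g p)) \<le> C * (l/2) powr ?\<rho>"
    unfolding C_def using Suc.prems by (intro Suc.IH) auto
  have "norm (dyadic_sum F g k ?m (l/2) - F ?m *v (g (?m + l/2) - g ?m)) \<le> C * (l/2) powr ?\<rho>"
    unfolding C_def
  proof (rule Suc.IH)
    show "0 \<le> l / 2" using Suc.prems by simp
    fix u v assume uv: "p + l / 2 \<le> u" "u \<le> v" "v \<le> p + l / 2 + l / 2"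
    then have "p \<le> u" "v \<le> p + l" using Suc.prems by auto
    then show "norm (F v - F u) \<le> cF * (v - u) powr \<kappa>" "norm (g v - g u) \<le> cg * (v - u) powr \<theta>"
      using uv Suc.prems by blast+
  qed
  then have B: "norm (dyadic_sum F g k ?m (l/2) - F ?m *v (g (p + l) - g ?m)) \<le> C * (l/2) powr ?\<rho>"
    using half by simp
  have "norm ((F ?m - F p) *v (g (p + l) - g ?m)) \<le> norm (F ?m - F p) * norm (g (p + l) - g ?m)"
    by (rule norm_matrix_vector_mult_le)
  also have "\<dots> \<le> (cF * (l/2) powr \<kappa>) * (cg * (l/2) powr \<theta>)"
    using Suc.prems(1) Suc.prems(2)[of p ?m] Suc.prems(3)[of ?m "p + l"] c
    by (intro mult_mono) (auto simp: field_simps)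
  also have "\<dots> = cF * cg * (l/2) powr ?\<rho>" by (simp add: powr_add)
  finally have M: "norm ((F ?m - F p) *v (g (p + l) - g ?m)) \<le> cF * cg * (l/2) powr ?\<rho>" .
  have eq: "dyadic_sum F g (Suc k) p l - F p *v (g (p + l) - g p) =
     (dyadic_sum F g k p (l/2) - F p *v (g ?m - g p)) +
     (dyadic_sum F g k ?m (l/2) - F ?m *v (g (p + l) - g ?m)) + (F ?m - F p) *v (g (p + l) - g ?m)"
    by (simp add: matrix_vector_mult_diff_distrib matrix_vector_mult_diff_rdistrib)
  have "norm (dyadic_sum F g (Suc k) p l - F p *v (g (p + l) - g p)) \<le>
     C * (l/2) powr ?\<rho> + C * (l/2) powr ?\<rho> + cF * cg * (l/2) powr ?\<rho>"
    unfolding eq by (intro norm_triangle_le add_mono A B M order_trans[OF norm_triangle_ineq])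
  also have "\<dots> = (2 * C + cF * cg) * (l/2) powr ?\<rho>" by (simp add: algebra_simps)
  also have "2 * C + cF * cg = C * 2 powr ?\<rho>" using 2 by (simp add: C_def field_simps)
  also have "C * 2 powr ?\<rho> * (l/2) powr ?\<rho> = C * l powr ?\<rho>"
    using Suc.prems(1) by (simp add: powr_divide)
  finally show ?case unfolding C_def .
qed

text \<open>Written with the size of the noise increment, \<open>cg * l powr \<theta>\<close>, as a
  common factor: this is the quantity made small by the choice of the window.\<close>

lemma norm_dyadic_sum_le:
  assumes \<rho>: "\<kappa> + \<theta> > 1" and l: "0 \<le> l" and c: "0 \<le> cF" "0 \<le> cg"
    and F: "\<And>u v. p \<le> u \<Longrightarrow> u \<le> v \<Longrightarrow> v \<le> p + l \<Longrightarrow> norm (F v - F u) \<le> cF * (v - u) powr \<kappa>"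
    and g: "\<And>u v. p \<le> u \<Longrightarrow> u \<le> v \<Longrightarrow> v \<le> p + l \<Longrightarrow> norm (g v - g u) \<le> cg * (v - u) powr \<theta>"
    and B: "norm (F p) \<le> B"
  shows "norm (dyadic_sum F g k p l)
           \<le> cg * l powr \<theta> * (B + cF * l powr \<kappa> / (2 powr (\<kappa> + \<theta>) - 2))"
proof -
  have "norm (F p *v (g (p + l) - g p)) \<le> norm (F p) * norm (g (p + l) - g p)"
    by (rule norm_matrix_vector_mult_le)
  also have "\<dots> \<le> B * (cg * l powr \<theta>)"
    using B g[of p "p + l"] l order_trans[OF norm_ge_zero B] by (intro mult_mono) auto
  finally have "norm (F p *v (g (p + l) - g p)) \<le> B * (cg * l powr \<theta>)" .
  moreover have "norm (dyadic_sum F g k p l) \<le>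
     norm (dyadic_sum F g k p l - F p *v (g (p + l) - g p)) + norm (F p *v (g (p + l) - g p))"
    using norm_triangle_ineq[of "dyadic_sum F g k p l - F p *v (g (p + l) - g p)"
        "F p *v (g (p + l) - g p)"] by simp
  moreover note dyadic_sum_Young[OF \<rho> l c F g]
  ultimately have "norm (dyadic_sum F g k p l) \<le>
      cF * cg / (2 powr (\<kappa> + \<theta>) - 2) * l powr (\<kappa> + \<theta>) + B * (cg * l powr \<theta>)"
    by (smt (verit))
  then show ?thesis by (simp add: powr_add algebra_simps)
qed

section \<open>Increments of Volterra integrals\<close>

text \<open>Derivative-free consequences of \<open>class_S\<close>. The last clause bounds a
  rectangular increment in t and in (s, x); it makes
  \<open>\<sigma> t u (X u) - \<sigma> s u (X u)\<close> Hoelder in u with a constant proportional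
  to |t - s|.\<close>

definition volterra_kernel ::
  "real \<Rightarrow> real \<Rightarrow> real \<Rightarrow> (real \<Rightarrow> real \<Rightarrow> 'a::real_normed_vector \<Rightarrow> 'e::real_normed_vector) \<Rightarrow> bool" where
  "volterra_kernel T \<beta> K \<sigma> \<longleftrightarrow> K > 0 \<and>
     (\<forall>t\<in>{0..T}. \<forall>s\<in>{0..T}. \<forall>x y. norm (\<sigma> t s x - \<sigma> t s y) \<le> K * norm (x - y)) \<and>
     (\<forall>t1\<in>{0..T}. \<forall>t2\<in>{0..T}. \<forall>s\<in>{0..T}. \<forall>x. norm (\<sigma> t1 s x - \<sigma> t2 s x) \<le> K * \<bar>t1 - t2\<bar>) \<and>
     (\<forall>t\<in>{0..T}. \<forall>s1\<in>{0..T}. \<forall>s2\<in>{0..T}. \<forall>x.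
        norm (\<sigma> t s1 x - \<sigma> t s2 x) \<le> K * \<bar>s1 - s2\<bar> powr \<beta>) \<and>
     (\<forall>t1\<in>{0..T}. \<forall>t2\<in>{0..T}. \<forall>s1\<in>{0..T}. \<forall>s2\<in>{0..T}. \<forall>x y.
        norm ((\<sigma> t1 s1 x - \<sigma> t2 s1 x) - (\<sigma> t1 s2 y - \<sigma> t2 s2 y))
          \<le> K * (\<bar>s1 - s2\<bar> powr \<beta> + norm (x - y)) * \<bar>t1 - t2\<bar>)"

text \<open>The rectangular clause is the mean value inequality in time for
  \<open>\<sigma> \<tau> s1 x - \<sigma> \<tau> s2 y\<close>, whose time derivative is small because
  \<open>partial_t\<close> is Lipschitz in x and \<beta>-Hoelder in s.\<close>

lemma class_S_imp_volterra_kernel: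
  fixes \<sigma> :: "real \<Rightarrow> real \<Rightarrow> real ^ 'd::finite \<Rightarrow> 'e::euclidean_space"
  assumes "class_S T \<beta> 1 \<delta> \<sigma>"
  obtains K where "volterra_kernel T \<beta> K \<sigma>"
proof -
  from assms have "\<forall>t\<in>{0..T}. \<forall>s\<in>{0..T}. \<forall>x i.
      (\<lambda>u. \<sigma> u s x) differentiable (at t within {0..T}) \<and>
      (\<lambda>h. \<sigma> t s (x + h *\<^sub>R axis i 1)) differentiable (at 0) \<and>
      (\<lambda>h. partial_t T \<sigma> t s (x + h *\<^sub>R axis i 1)) differentiable (at 0)"
    unfolding class_S_def by (elim conjE)
  note diff = this[rule_format, THEN conjunct1]
  from assms[unfolded class_S_def] obtain K where K: "K > 0" and
    bounds: "\<forall>t\<in>{0..T}. \<forall>s\<in>{0..T}. \<forall>x y.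
           norm (\<sigma> t s x - \<sigma> t s y) + norm (partial_t T \<sigma> t s x - partial_t T \<sigma> t s y)
             \<le> K * norm (x - y)"
        "\<forall>t1\<in>{0..T}. \<forall>t2\<in>{0..T}. \<forall>s\<in>{0..T}. \<forall>i x.
           norm (\<sigma> t1 s x - \<sigma> t2 s x) + norm (partial_x i \<sigma> t1 s x - partial_x i \<sigma> t2 s x)
             \<le> K * \<bar>t1 - t2\<bar> powr 1"
        "\<forall>t\<in>{0..T}. \<forall>s1\<in>{0..T}. \<forall>s2\<in>{0..T}. \<forall>x.
           norm (\<sigma> t s1 x - \<sigma> t s2 x) + norm (partial_t T \<sigma> t s1 x - partial_t T \<sigma> t s2 x)
             \<le> K * \<bar>s1 - s2\<bar> powr \<beta>"
    by (elim conjE exE) (rule that)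
  note 1 = bounds(1)[rule_format] and 3 = bounds(2)[rule_format] and 4 = bounds(3)[rule_format]
  have nn: "a + norm y \<le> c \<Longrightarrow> a \<le> c" "norm y + a \<le> c \<Longrightarrow> a \<le> c" for a c and y :: 'e
    using norm_ge_zero[of y] by linarith+
  have mixed: "norm ((\<sigma> t1 s1 x - \<sigma> t2 s1 x) - (\<sigma> t1 s2 y - \<sigma> t2 s2 y))
          \<le> K * (\<bar>s1 - s2\<bar> powr \<beta> + norm (x - y)) * \<bar>t1 - t2\<bar>"
    if t: "t1\<in>{0..T}" "t2\<in>{0..T}" and s: "s1\<in>{0..T}" "s2\<in>{0..T}" for t1 t2 s1 s2 x y
  proof -
    let ?f = "\<lambda>\<tau>. \<sigma> \<tau> s1 x - \<sigma> \<tau> s2 y"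
    let ?f' = "\<lambda>\<tau>. partial_t T \<sigma> \<tau> s1 x - partial_t T \<sigma> \<tau> s2 y"
    have d: "((\<lambda>u. \<sigma> u s' z) has_vector_derivative partial_t T \<sigma> \<tau> s' z) (at \<tau> within {0..T})"
      if "\<tau> \<in> {0..T}" "s' \<in> {0..T}" for \<tau> s' z
      unfolding partial_t_def using diff[OF that] by (simp add: vector_derivative_works)
    have "norm (?f t1 - ?f t2) \<le> K * (\<bar>s1 - s2\<bar> powr \<beta> + norm (x - y)) * norm (t1 - t2)"
    proof (rule differentiable_bound[where f = ?f and S = "{0..T}" and f' = "\<lambda>\<tau> h. h *\<^sub>R ?f' \<tau>"])
      fix \<tau> assume \<tau>: "\<tau> \<in> {0..T}"
      have "(?f has_vector_derivative ?f' \<tau>) (at \<tau> within {0..T})"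
        by (intro has_vector_derivative_diff d \<tau> s)
      then show "(?f has_derivative (\<lambda>h. h *\<^sub>R ?f' \<tau>)) (at \<tau> within {0..T})"
        by (simp add: has_vector_derivative_def)
      have "norm (partial_t T \<sigma> \<tau> s1 x - partial_t T \<sigma> \<tau> s1 y) \<le> K * norm (x - y)"
        using 1[OF \<tau> s(1)] nn by blast
      moreover have "norm (partial_t T \<sigma> \<tau> s1 y - partial_t T \<sigma> \<tau> s2 y) \<le> K * \<bar>s1 - s2\<bar> powr \<beta>"
        using 4[OF \<tau> s] nn by blast
      ultimately have "norm (?f' \<tau>) \<le> K * (\<bar>s1 - s2\<bar> powr \<beta> + norm (x - y))"
        using norm_triangle_ineq[of "partial_t T \<sigma> \<tau> s1 x - partial_t T \<sigma> \<tau> s1 y"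
          "partial_t T \<sigma> \<tau> s1 y - partial_t T \<sigma> \<tau> s2 y"] by (simp add: algebra_simps)
      then show "onorm (\<lambda>h. h *\<^sub>R ?f' \<tau>) \<le> K * (\<bar>s1 - s2\<bar> powr \<beta> + norm (x - y))"
        by (simp add: onorm_scaleR_left bounded_linear_ident onorm_id)
    qed (use t in auto)
    then show ?thesis by (simp add: algebra_simps)
  qed
  show ?thesis
  proof (rule that[of K])
    have "norm (\<sigma> t s x - \<sigma> t s y) \<le> K * norm (x - y)" if "t\<in>{0..T}" "s\<in>{0..T}" for t s x y
      using 1[OF that] nn by blast
    moreover have "norm (\<sigma> t1 s x - \<sigma> t2 s x) \<le> K * \<bar>t1 - t2\<bar>"
      if "t1\<in>{0..T}" "t2\<in>{0..T}" "s\<in>{0..T}" for t1 t2 s x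
    proof -
      have "norm (\<sigma> t1 s x - \<sigma> t2 s x) \<le> K * \<bar>t1 - t2\<bar> powr 1"
        \<comment> \<open>The bound is stated for every coordinate i; any value of i will do, since
          only the summand without spatial derivative is kept.\<close>
        using 3[OF that, of x undefined] nn(1) by blast
      then show ?thesis by simp
    qed
    moreover have "norm (\<sigma> t s1 x - \<sigma> t s2 x) \<le> K * \<bar>s1 - s2\<bar> powr \<beta>"
      if "t\<in>{0..T}" "s1\<in>{0..T}" "s2\<in>{0..T}" for t s1 s2 x
      using 4[OF that] nn by blast
    ultimately show "volterra_kernel T \<beta> K \<sigma>"
      unfolding volterra_kernel_def using K mixed by (intro conjI ballI allI) simp_all
  qed
qed

text \<open>Supplies the growth bound of part (i): the arguments are moved to the origin one at a
  time, first x, then t, then s.\<close>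

lemma volterra_kernel_linear_growth:
  assumes "volterra_kernel T \<beta> K \<sigma>" "0 \<le> T" "0 \<le> \<beta>"
  obtains B where "B > 0" "\<And>t s x. t \<in> {0..T} \<Longrightarrow> s \<in> {0..T} \<Longrightarrow> norm (\<sigma> t s x) \<le> B * (1 + norm x)"
proof (rule that)
  define B where "B = norm (\<sigma> 0 0 0) + K * T + K * T powr \<beta> + K"
  have K: "K > 0" using assms by (simp add: volterra_kernel_def)
  show "B > 0" unfolding B_def using K assms by (intro add_nonneg_pos add_nonneg_nonneg) auto
  fix t s :: real and x :: 'a assume ts: "t \<in> {0..T}" "s \<in> {0..T}"
  have 0: "0 \<in> {0..T}" using assms by simp
  have "norm (\<sigma> t s x - \<sigma> t s 0) \<le> K * norm (x - 0)"
    using assms ts unfolding volterra_kernel_def by blast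
  moreover have "norm (\<sigma> t s 0 - \<sigma> 0 s 0) \<le> K * \<bar>t - 0\<bar>"
    using assms ts 0 unfolding volterra_kernel_def by blast
  moreover have "K * \<bar>t - 0\<bar> \<le> K * T" using K ts by simp
  moreover have "norm (\<sigma> 0 s 0 - \<sigma> 0 0 0) \<le> K * \<bar>s - 0\<bar> powr \<beta>"
    using assms ts 0 unfolding volterra_kernel_def by blast
  moreover have "K * \<bar>s - 0\<bar> powr \<beta> \<le> K * T powr \<beta>"
    using K ts assms by (auto intro!: powr_mono2)
  ultimately have "norm (\<sigma> t s x) \<le> norm (\<sigma> 0 0 0) + K * T + K * T powr \<beta> + K * norm x"
    using norm_triangle_ineq2[of "\<sigma> t s x" "\<sigma> t s 0"] norm_triangle_ineq2[of "\<sigma> t s 0" "\<sigma> 0 s 0"]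
      norm_triangle_ineq2[of "\<sigma> 0 s 0" "\<sigma> 0 0 0"] by simp
  also have "\<dots> \<le> B + B * norm x"
  proof (rule add_mono)
    have "K \<le> B" unfolding B_def using K assms by simp
    then show "K * norm x \<le> B * norm x" by (intro mult_right_mono) auto
    show "norm (\<sigma> 0 0 0) + K * T + K * T powr \<beta> \<le> B" unfolding B_def using K by simp
  qed
  finally show "norm (\<sigma> t s x) \<le> B * (1 + norm x)" by (simp add: algebra_simps)
qed

text \<open>The first summand of the bound is the recent part, an integral of
  \<open>\<sigma> t\<close> over [s,t], which fits into one window. The second is the memory, an
  integral of \<open>\<sigma> t - \<sigma> s\<close> over [0,s]: at most (T + 1) / h windows, each
  costing t - s times the noise of a window. The exponent \<kappa> below both \<beta> and
  \<open>\<kappa>0\<close> lets the explicit dependence on u and the one through the path be treated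
  together.\<close>

lemma RS_volterra_increment:
  fixes \<sigma> :: "real \<Rightarrow> real \<Rightarrow> 'a::real_normed_vector \<Rightarrow> real ^ 'm::finite ^ 'd::finite"
  assumes \<sigma>: "volterra_kernel T \<beta> K \<sigma>"
    and exps: "\<kappa> \<le> \<beta>" "\<kappa> \<le> \<kappa>0" "0 < \<kappa>" "0 < \<theta>" "\<kappa> + \<theta> > 1"
    and st: "0 \<le> s" "s \<le> t" "t \<le> T" "t - s \<le> h" and h: "0 < h" "h \<le> 1"
    and Jt: "has_RS_integral (\<lambda>u. \<sigma> t u (X u)) W 0 t Jt"
    and Js: "has_RS_integral (\<lambda>u. \<sigma> s u (X u)) W 0 s Js"
    and X: "\<And>u v. 0 \<le> u \<Longrightarrow> u \<le> v \<Longrightarrow> v \<le> t \<Longrightarrow> v - u \<le> h \<Longrightarrow>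
              norm (X v - X u) \<le> A * ((v - u) / h) powr \<kappa>0"
    and W: "\<And>u v. 0 \<le> u \<Longrightarrow> u \<le> v \<Longrightarrow> v \<le> T \<Longrightarrow> norm (W v - W u) \<le> G * (v - u) powr \<theta>"
    and nonneg: "A \<ge> 0" "G \<ge> 0"
    and B: "\<And>u. 0 \<le> u \<Longrightarrow> u \<le> t \<Longrightarrow> norm (\<sigma> t u (X u)) \<le> B"
  defines "c \<equiv> 1 / (2 powr (\<kappa> + \<theta>) - 2)"
  shows "norm (Jt - Js) \<le> G * (t - s) powr \<theta> * (B + K * (1 + A) * c)
           + (T + 1) / h * (t - s) * (G * h powr \<theta>) * (K * (1 + (1 + A) * c))" (is "_ \<le> ?R1 + ?R2")
proof (rule field_le_epsilon)
  fix e :: real assume e: "e > 0"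
  note kernel = \<sigma>[unfolded volterra_kernel_def]
  have K: "K > 0" using kernel by blast
  have c: "c > 0"
    unfolding c_def using exps powr_less_mono[of 1 "\<kappa> + \<theta>" "2::real"] by simp
  define Ft where "Ft = (\<lambda>u. \<sigma> t u (X u))"
  define Fs where "Fs = (\<lambda>u. \<sigma> s u (X u))"
  \<comment> \<open>Rounding up gives \<open>l \<le> h\<close>. For s = 0 one gets
    \<open>N = 0\<close> and, by division by zero, \<open>l = 0\<close>, and the memory sum is
    empty.\<close>
  define N where "N = nat \<lceil>s / h\<rceil>"
  define l where "l = s / real N"
  have Nl: "real N * l = s"
  proof (cases "s = 0")
    case False
    then have "s / h > 0" using st h by simp
    then have "N > 0" unfolding N_def by linarith
    then show ?thesis by (simp add: l_def)
  qed (simp add: l_def)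
  have l0: "0 \<le> l" unfolding l_def using st by simp
  have lh: "l \<le> h"
  proof (cases "s = 0")
    case False
    then have "s / h > 0" using st h by simp
    then have "N > 0" unfolding N_def by linarith
    moreover have "s / h \<le> real N" unfolding N_def by linarith
    ultimately show ?thesis using h by (simp add: l_def field_simps)
  qed (use h in \<open>simp add: l_def\<close>)
  have Nle: "real N \<le> (T + 1) / h"
  proof -
    have "0 \<le> s / h" using st h by simp
    then have "real N \<le> s / h + 1" unfolding N_def by linarith
    also have "\<dots> = (s + h) / h" using h by (simp add: field_simps)
    also have "\<dots> \<le> (T + 1) / h" using st h by (intro divide_right_mono) auto
    finally show ?thesis .
  qed
  \<comment> \<open>Both terms are expressed through the ratio (v - u) / h, which is at most 1, so
    that lowering the exponent to \<kappa> only increases them; for the first term this uses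
    \<open>h \<le> 1\<close>.\<close>
  have inc: "\<bar>v - u\<bar> powr \<beta> + norm (X v - X u) \<le> (1 + A) / h powr \<kappa> * (v - u) powr \<kappa>"
    if uv: "0 \<le> u" "u \<le> v" "v \<le> t" "v - u \<le> h" for u v
  proof -
    have r: "0 \<le> (v - u) / h" "(v - u) / h \<le> 1" using uv h by auto
    have le: "((v - u) / h) powr \<beta> \<le> ((v - u) / h) powr \<kappa>" "((v - u) / h) powr \<kappa>0 \<le> ((v - u) / h) powr \<kappa>"
      using r exps by (auto intro!: powr_mono')
    have "(v - u) * h \<le> (v - u) * 1" using uv h by (intro mult_left_mono) auto
    then have "v - u \<le> (v - u) / h" using h by (simp add: pos_le_divide_eq)
    then have "\<bar>v - u\<bar> powr \<beta> \<le> ((v - u) / h) powr \<beta>" using uv exps by (auto intro!: powr_mono2)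
    moreover have "norm (X v - X u) \<le> A * ((v - u) / h) powr \<kappa>"
      using X[OF uv] mult_left_mono[OF le(2) nonneg(1)] by linarith
    ultimately have "\<bar>v - u\<bar> powr \<beta> + norm (X v - X u) \<le> (1 + A) * ((v - u) / h) powr \<kappa>"
      using le by (simp add: algebra_simps)
    then show ?thesis using uv h by (simp add: powr_divide)
  qed
  have Wl: "norm (W v - W u) \<le> G * (v - u) powr \<theta>" if "0 \<le> u" "u \<le> v" "v \<le> t" for u v
    using W that st by simp
  have hk: "x powr \<kappa> / h powr \<kappa> \<le> 1" if "0 \<le> x" "x \<le> h" for x
    using that h exps powr_mono2[of \<kappa> x h] by simp
  have D1: "norm (dyadic_sum Ft W k s (t - s)) \<le> ?R1" for k
  proof -
    have "norm (dyadic_sum Ft W k s (t - s)) \<le>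
       G * (t - s) powr \<theta> * (B + (K * ((1 + A) / h powr \<kappa>)) * (t - s) powr \<kappa> / (2 powr (\<kappa> + \<theta>) - 2))"
    proof (rule norm_dyadic_sum_le)
      fix u v assume uv: "s \<le> u" "u \<le> v" "v \<le> s + (t - s)"
      then have uv': "0 \<le> u" "u \<le> v" "v \<le> t" "v - u \<le> h" using st by auto
      then show "norm (W v - W u) \<le> G * (v - u) powr \<theta>" by (intro Wl)
      have T: "t \<in> {0..T}" "u \<in> {0..T}" "v \<in> {0..T}" using uv' st by auto
      have "norm (Ft v - Ft u) \<le> norm (\<sigma> t v (X v) - \<sigma> t v (X u)) + norm (\<sigma> t v (X u) - \<sigma> t u (X u))"
        unfolding Ft_def using norm_triangle_ineq[of "\<sigma> t v (X v) - \<sigma> t v (X u)"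
            "\<sigma> t v (X u) - \<sigma> t u (X u)"] by simp
      also have "\<dots> \<le> K * norm (X v - X u) + K * \<bar>v - u\<bar> powr \<beta>"
        using kernel T by (intro add_mono) blast+
      also have "\<dots> \<le> K * ((1 + A) / h powr \<kappa> * (v - u) powr \<kappa>)"
        using mult_left_mono[OF inc[OF uv'], of K] K by (simp add: algebra_simps)
      finally show "norm (Ft v - Ft u) \<le> K * ((1 + A) / h powr \<kappa>) * (v - u) powr \<kappa>"
        by (simp add: mult.assoc)
    next
      show "norm (Ft s) \<le> B" unfolding Ft_def using B st by simp
    qed (use exps st nonneg K in auto)
    also have "\<dots> = G * (t - s) powr \<theta> * (B + K * (1 + A) * c * ((t - s) powr \<kappa> / h powr \<kappa>))"
      by (simp add: c_def)
    also have "\<dots> \<le> G * (t - s) powr \<theta> * (B + K * (1 + A) * c * 1)"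
      using hk[of "t - s"] st nonneg K c by (intro mult_left_mono add_left_mono) auto
    finally show ?thesis by simp
  qed
  \<comment> \<open>On each old window the integrand is a difference in the first argument of
    \<sigma>: the time Lipschitz clause bounds its value at the left end, the rectangular clause its
    Hoelder constant, and both carry the factor t - s.\<close>
  have D2: "norm (dyadic_sum (\<lambda>u. Ft u - Fs u) W k (real i * l) l)
      \<le> (t - s) * (G * h powr \<theta>) * (K * (1 + (1 + A) * c))" if "i < N" for k i
  proof -
    have il: "real i * l + l \<le> s"
    proof -
      have "real i * l + l = real (Suc i) * l" by (simp add: algebra_simps)
      also have "\<dots> \<le> real N * l" using that l0 by (intro mult_right_mono) auto
      finally show ?thesis using Nl by simp
    qed
    have p0: "0 \<le> real i * l" using l0 by simp
    have "norm (dyadic_sum (\<lambda>u. Ft u - Fs u) W k (real i * l) l) \<le>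
       G * l powr \<theta> * (K * (t - s) + (K * ((1 + A) / h powr \<kappa>) * (t - s)) * l powr \<kappa> / (2 powr (\<kappa> + \<theta>) - 2))"
    proof (rule norm_dyadic_sum_le)
      fix u v assume uv: "real i * l \<le> u" "u \<le> v" "v \<le> real i * l + l"
      then have uv': "0 \<le> u" "u \<le> v" "v \<le> t" "v - u \<le> h" using p0 il lh st by linarith+
      then show "norm (W v - W u) \<le> G * (v - u) powr \<theta>" by (intro Wl)
      have T: "t \<in> {0..T}" "s \<in> {0..T}" "u \<in> {0..T}" "v \<in> {0..T}" using uv' st by auto
      have "norm ((Ft v - Fs v) - (Ft u - Fs u)) \<le> K * (\<bar>v - u\<bar> powr \<beta> + norm (X v - X u)) * \<bar>t - s\<bar>"
        unfolding Ft_def Fs_def using kernel T by blast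
      also have "\<dots> \<le> K * ((1 + A) / h powr \<kappa> * (v - u) powr \<kappa>) * \<bar>t - s\<bar>"
        using inc[OF uv'] K by (intro mult_right_mono mult_left_mono) auto
      finally show "norm (Ft v - Fs v - (Ft u - Fs u)) \<le> K * ((1 + A) / h powr \<kappa>) * (t - s) * (v - u) powr \<kappa>"
        using st by (simp add: algebra_simps)
    next
      have "real i * l \<in> {0..T}" "t \<in> {0..T}" "s \<in> {0..T}" using p0 il l0 st by auto
      then have "norm (Ft (real i * l) - Fs (real i * l)) \<le> K * \<bar>t - s\<bar>"
        unfolding Ft_def Fs_def using kernel by blast
      then show "norm (Ft (real i * l) - Fs (real i * l)) \<le> K * (t - s)" using st by simp
    qed (use exps st nonneg K l0 in auto)
    also have "\<dots> = G * l powr \<theta> * ((t - s) * (K * (1 + (1 + A) * c * (l powr \<kappa> / h powr \<kappa>))))"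
      by (simp add: c_def algebra_simps)
    also have "\<dots> \<le> G * h powr \<theta> * ((t - s) * (K * (1 + (1 + A) * c * 1)))"
      using hk[of l] l0 lh st nonneg K c exps
      by (intro mult_mono mult_left_mono add_left_mono powr_mono2 mult_nonneg_nonneg add_nonneg_nonneg) auto
    finally show ?thesis by (simp add: algebra_simps)
  qed
  obtain \<eta>1 where \<eta>1: "\<eta>1 > 0" "\<And>S. RS_sum Ft W \<eta>1 0 t S \<Longrightarrow> norm (S - Jt) < e / 2"
    using has_RS_integralD[OF Jt, of "e/2"] e unfolding Ft_def by auto
  obtain \<eta>2 where \<eta>2: "\<eta>2 > 0" "\<And>S. RS_sum Fs W \<eta>2 0 s S \<Longrightarrow> norm (S - Js) < e / 2"
    using has_RS_integralD[OF Js, of "e/2"] e unfolding Fs_def by auto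
  \<comment> \<open>One mesh and one depth \<open>k\<close> serve both integrals, so that on [0,s]
    their sums have the same cells and tags and can be subtracted term by term.\<close>
  define \<eta> where "\<eta> = min \<eta>1 \<eta>2"
  have \<eta>: "\<eta> > 0" using \<eta>1 \<eta>2 by (simp add: \<eta>_def)
  obtain k where k: "h / \<eta> < 2 ^ k" using real_arch_pow[of 2 "h / \<eta>"] by auto
  then have k1: "h / 2 ^ k < \<eta>" using \<eta> by (simp add: field_simps)
  have small: "x / 2 ^ k < \<eta>" if "x \<le> h" for x
    using k1 divide_right_mono[OF that, of "2 ^ k"] by simp
  let ?S1 = "\<lambda>F. \<Sum>i<N. dyadic_sum F W k (real i * l) l"
  have win: "RS_sum F W \<eta> 0 s (?S1 F)" for F
    using RS_sum_dyadic_windows[OF l0 small[OF lh] \<eta>, of F W N] Nl by simp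
  have "RS_sum Ft W \<eta> s (s + (t - s)) (dyadic_sum Ft W k s (t - s))"
    using st small[of "t - s"] by (intro RS_sum_dyadic) auto
  then have "RS_sum Ft W \<eta> 0 t (?S1 Ft + dyadic_sum Ft W k s (t - s))"
    using st by (intro RS_sum_append[OF _ _ win]) auto
  then have "RS_sum Ft W \<eta>1 0 t (?S1 Ft + dyadic_sum Ft W k s (t - s))"
    by (rule RS_sum_mono) (simp add: \<eta>_def)
  then have E1: "norm (?S1 Ft + dyadic_sum Ft W k s (t - s) - Jt) < e / 2" by (rule \<eta>1(2))
  have "RS_sum Fs W \<eta>2 0 s (?S1 Fs)" by (rule RS_sum_mono[OF win]) (simp add: \<eta>_def)
  then have E2: "norm (?S1 Fs - Js) < e / 2" by (rule \<eta>2(2))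
  have "?S1 Ft - ?S1 Fs = ?S1 (\<lambda>u. Ft u - Fs u)"
    by (simp add: dyadic_sum_diff sum_subtractf)
  moreover have "norm (?S1 (\<lambda>u. Ft u - Fs u)) \<le> (\<Sum>i<N. (t - s) * (G * h powr \<theta>) * (K * (1 + (1 + A) * c)))"
    by (intro sum_norm_le) (use D2 in auto)
  moreover have "\<dots> = real N * ((t - s) * (G * h powr \<theta>) * (K * (1 + (1 + A) * c)))" by simp
  moreover have "\<dots> \<le> (T + 1) / h * ((t - s) * (G * h powr \<theta>) * (K * (1 + (1 + A) * c)))"
    using Nle st nonneg K c h by (intro mult_right_mono) auto
  ultimately have S: "norm (?S1 Ft - ?S1 Fs) \<le> ?R2" by (simp add: mult.assoc)
  have "norm (Jt - Js) = norm ((?S1 Ft - ?S1 Fs) + dyadic_sum Ft W k s (t - s)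
      - (?S1 Ft + dyadic_sum Ft W k s (t - s) - Jt) + (?S1 Fs - Js))" by simp
  also have "\<dots> \<le> norm (?S1 Ft - ?S1 Fs) + norm (dyadic_sum Ft W k s (t - s))
      + norm (?S1 Ft + dyadic_sum Ft W k s (t - s) - Jt) + norm (?S1 Fs - Js)"
    by (intro norm_triangle_le norm_triangle_le_diff add_mono order_refl)
  finally show "norm (Jt - Js) \<le> ?R1 + ?R2 + e" using S D1[of k] E1 E2 by linarith
qed

section \<open>Absorption on short windows\<close>

text \<open>Local Hoelder bounds, normalised so that the constant bounds the oscillation over a window of
  length \<open>h\<close>.\<close>

definition window_holder :: "real \<Rightarrow> real \<Rightarrow> (real \<Rightarrow> 'a::real_normed_vector) \<Rightarrow> real \<Rightarrow> real \<Rightarrow> bool" where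
  "window_holder h \<kappa> X \<tau> A \<longleftrightarrow>
     (\<forall>u v. 0 \<le> u \<longrightarrow> u \<le> v \<longrightarrow> v \<le> \<tau> \<longrightarrow> v - u \<le> h \<longrightarrow> norm (X v - X u) \<le> A * ((v - u) / h) powr \<kappa>)"

lemma window_holder_mono: "window_holder h \<kappa> X \<tau> A \<Longrightarrow> A \<le> A' \<Longrightarrow> window_holder h \<kappa> X \<tau> A'"
  unfolding window_holder_def by (meson mult_right_mono order_trans powr_ge_zero)

text \<open>The map A -> (Q + A) / 4 contracts to its fixed point Q / 3. Iteration needs a finite
  start \<open>A0\<close>; the self-referential inequality alone would not exclude an infinite
  seminorm.\<close>

lemma window_holder_absorb:
  assumes fin: "window_holder h \<kappa> X \<tau> A0" and \<zeta>: "\<zeta> \<le> 1/4" and Q: "Q \<ge> 0" "A0 \<ge> 0"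
    and step: "\<And>A. A \<ge> 0 \<Longrightarrow> window_holder h \<kappa> X \<tau> A \<Longrightarrow> window_holder h \<kappa> X \<tau> (\<zeta> * (Q + A))"
  shows "window_holder h \<kappa> X \<tau> (Q / 3)"
proof -
  have good: "window_holder h \<kappa> X \<tau> (Q / 3 + A0 / 4 ^ n)" for n
  proof (induction n)
    case 0
    show ?case by (rule window_holder_mono[OF fin]) (use Q in simp)
  next
    case (Suc n)
    have "\<zeta> * (Q + (Q / 3 + A0 / 4 ^ n)) \<le> 1/4 * (Q + (Q / 3 + A0 / 4 ^ n))"
      using \<zeta> Q by (intro mult_right_mono) auto
    also have "\<dots> = Q / 3 + A0 / 4 ^ Suc n" by (simp add: field_simps)
    finally show ?case using Q by (intro window_holder_mono[OF step[OF _ Suc]]) auto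
  qed
  have lim: "(\<lambda>n. (Q / 3 + A0 / 4 ^ n) * r) \<longlonglongrightarrow> (Q / 3 + 0) * r" for r :: real
    by (intro tendsto_intros) real_asymp
  show ?thesis
    unfolding window_holder_def
  proof (intro allI impI)
    fix u v assume "0 \<le> u" "u \<le> v" "v \<le> \<tau>" "v - u \<le> h"
    then have "norm (X v - X u) \<le> (Q / 3 + A0 / 4 ^ n) * ((v - u) / h) powr \<kappa>" for n
      using good[of n] unfolding window_holder_def by blast
    then show "norm (X v - X u) \<le> Q / 3 * ((v - u) / h) powr \<kappa>"
      using LIMSEQ_le_const[OF lim[of "((v - u) / h) powr \<kappa>"]] by auto
  qed
qed

section \<open>Propagating bounds from window to window\<close>

lemma window_holder_step:
  fixes X :: "real \<Rightarrow> 'a::real_normed_vector"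
  assumes "window_holder h \<kappa> X T A" "A \<ge> 0" "h > 0" "0 \<le> u" "u \<le> v" "v \<le> T" "v - u \<le> h" "\<kappa> \<ge> 0"
  shows "norm (X v) \<le> norm (X u) + A"
proof -
  have "norm (X v - X u) \<le> A * ((v - u) / h) powr \<kappa>"
    using assms unfolding window_holder_def by blast
  also have "\<dots> \<le> A * 1" using assms by (intro mult_left_mono powr_le1) auto
  finally show ?thesis using norm_triangle_ineq2[of "X v" "X u"] by simp
qed

text \<open>A discrete Gronwall argument: \<open>f\<close> prolongs a bound by one window,
  \<open>min\<close> truncates the last window, and the ceiling of T / h many windows reach
  T.\<close>

lemma window_chain:
  fixes X :: "real \<Rightarrow> 'a::real_normed_vector"
  assumes "h > 0" "T \<ge> 0"
    and step: "\<And>\<tau> m. 0 \<le> \<tau> \<Longrightarrow> \<tau> \<le> T \<Longrightarrow> (\<forall>u\<in>{0..\<tau>}. norm (X u) \<le> m) \<Longrightarrow>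
               \<forall>u\<in>{0..min (\<tau> + h) T}. norm (X u) \<le> f m"
    and t: "t \<in> {0..T}"
  shows "norm (X t) \<le> (f ^^ nat \<lceil>T / h\<rceil>) (norm (X 0))"
proof -
  have "\<forall>u\<in>{0..min (real n * h) T}. norm (X u) \<le> (f ^^ n) (norm (X 0))" for n
  proof (induction n)
    case 0
    have "min (real 0 * h) T = 0" using assms by simp
    then show ?case by simp
  next
    case (Suc n)
    have eq: "min (min (real n * h) T + h) T = min (real (Suc n) * h) T"
      using assms by (auto simp: min_def algebra_simps)
    show ?case using step[OF _ _ Suc] assms eq by simp
  qed
  then have "\<forall>u\<in>{0..min (real (nat \<lceil>T / h\<rceil>) * h) T}. norm (X u) \<le> (f ^^ nat \<lceil>T / h\<rceil>) (norm (X 0))" .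
  moreover have "T \<le> real (nat \<lceil>T / h\<rceil>) * h"
  proof -
    have "T / h \<le> real (nat \<lceil>T / h\<rceil>)" by linarith
    then show ?thesis using pos_divide_le_eq[OF assms(1)] by blast
  qed
  then have "t \<in> {0..min (real (nat \<lceil>T / h\<rceil>) * h) T}" using t by simp
  ultimately show ?thesis by blast
qed

text \<open>The parameter \<open>a\<close> is 1 for coefficients of linear growth and 0 for bounded ones; \<open>dr\<close> is the
  drift integral.\<close>

definition volterra_path ::
  "real \<Rightarrow> real \<Rightarrow> real \<Rightarrow> real \<Rightarrow> real \<Rightarrow> (real \<Rightarrow> real \<Rightarrow> real ^ 'd::finite \<Rightarrow> real ^ 'm::finite ^ 'd)
    \<Rightarrow> real \<Rightarrow> (real \<Rightarrow> real ^ 'm) \<Rightarrow> (real \<Rightarrow> real ^ 'd) \<Rightarrow> bool" where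
  "volterra_path T \<theta> \<kappa> D a \<sigma> G W X \<longleftrightarrow>
     G \<ge> 0 \<and> holder_on {0..T} \<kappa> X \<and>
     (\<forall>u v. 0 \<le> u \<longrightarrow> u \<le> v \<longrightarrow> v \<le> T \<longrightarrow> norm (W v - W u) \<le> G * (v - u) powr \<theta>) \<and>
     (\<exists>x0 dr. (\<forall>t\<in>{0..T}. \<exists>J. has_RS_integral (\<lambda>u. \<sigma> t u (X u)) W 0 t J \<and> X t = x0 + dr t + J) \<and>
        (\<forall>s t M. 0 \<le> s \<longrightarrow> s \<le> t \<longrightarrow> t \<le> T \<longrightarrow> (\<forall>u\<in>{0..t}. norm (X u) \<le> M) \<longrightarrow>
          norm (dr t - dr s) \<le> D * (1 + a * M) * (t - s) powr \<kappa>))"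

text \<open>The point is that \<eta> is chosen before G, W, X and M. Both
  \<open>h powr \<kappa>0\<close> and \<open>G * h powr \<theta>\<close> are at most
  \<open>\<eta> powr \<kappa>0\<close>, so every contribution to an increment of X carries this
  factor, and a small \<eta> starts the absorption with Q = 2 + a M.\<close>

lemma volterra_path_bound:
  fixes \<sigma> :: "real \<Rightarrow> real \<Rightarrow> real ^ 'd::finite \<Rightarrow> real ^ 'm::finite ^ 'd"
  assumes \<sigma>: "volterra_kernel T \<beta> K \<sigma>"
    and T: "T > 0"
    and exps: "0 < \<beta>" "0 < \<kappa>0" "\<kappa>0 \<le> 1" "\<kappa>0 \<le> \<theta>" "\<beta> + \<theta> > 1" "\<kappa>0 + \<theta> > 1"
    and a: "a \<ge> 0" and B: "B \<ge> 0" and D: "D \<ge> 0"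
    and growth: "\<And>t s x. t \<in> {0..T} \<Longrightarrow> s \<in> {0..T} \<Longrightarrow> norm (\<sigma> t s x) \<le> B * (1 + a * norm x)"
  obtains \<eta> where "0 < \<eta>" "\<eta> \<le> 1"
    "\<And>G W X \<tau> M. \<lbrakk>volterra_path T \<theta> \<kappa>0 D a \<sigma> G W X; \<tau> \<in> {0..T}; \<forall>u\<in>{0..\<tau>}. norm (X u) \<le> M\<rbrakk>
     \<Longrightarrow> window_holder (\<eta> * (1 + G) powr (- 1 / \<theta>)) \<kappa>0 X \<tau> ((2 + a * M) / 3)"
proof -
  \<comment> \<open>The Hoelder exponent of the integrand \<open>\<sigma> t u (X u)\<close> in u:
    \<beta> from the explicit argument, \<open>\<kappa>0\<close> from the path.\<close>
  define \<kappa> where "\<kappa> = min \<beta> \<kappa>0"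
  have \<kappa>: "\<kappa> \<le> \<beta>" "\<kappa> \<le> \<kappa>0" "0 < \<kappa>" "0 < \<theta>" "\<kappa> + \<theta> > 1"
    using exps by (auto simp: \<kappa>_def min_def)
  define c where "c = 1 / (2 powr (\<kappa> + \<theta>) - 2)"
  have c: "c > 0"
    unfolding c_def using \<kappa> powr_less_mono[of 1 "\<kappa> + \<theta>" "2::real"] by simp
  have K: "K > 0" using \<sigma> by (simp add: volterra_kernel_def)
  \<comment> \<open>The summands are the costs of the drift, of the integrand at the left end of
    [s,t], of the Young remainder there, and of the memory.\<close>
  define C1 where "C1 = D + B + K * c + (T + 1) * K * (1 + c)"
  have C1: "C1 > 0" unfolding C1_def using K c T B D by (intro add_nonneg_pos add_nonneg_nonneg) auto
  \<comment> \<open>The value of \<open>\<eta> powr \<kappa>0\<close>: small enough for the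
    absorption factor 1/4, and capped by 1 to keep \<open>\<eta> \<le> 1\<close>.\<close>
  define q where "q = min 1 (1 / (4 * C1))"
  have q: "q > 0" "q \<le> 1" "q \<le> 1 / (4 * C1)" using C1 by (simp_all add: q_def)
  define \<eta> where "\<eta> = q powr (1 / \<kappa>0)"
  have \<eta>: "0 < \<eta>" "\<eta> \<le> 1" unfolding \<eta>_def using q exps by (auto intro!: powr_le1)
  have "\<eta> powr \<kappa>0 = q" unfolding \<eta>_def using q exps by (simp add: powr_powr)
  then have \<eta>C: "\<eta> powr \<kappa>0 * C1 \<le> 1 / 4"
    using mult_right_mono[OF q(3) less_imp_le[OF C1]] C1 by simp
  show ?thesis
  proof (rule that[OF \<eta>])
    fix G W X \<tau> M
    assume path: "volterra_path T \<theta> \<kappa>0 D a \<sigma> G W X" and \<tau>: "\<tau> \<in> {0..T}"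
      and M': "\<forall>u\<in>{0..\<tau>}. norm (X u) \<le> M"
    note M = M'[rule_format]
    from path have G: "G \<ge> 0" and hol: "holder_on {0..T} \<kappa>0 X"
      and W: "\<And>u v. 0 \<le> u \<Longrightarrow> u \<le> v \<Longrightarrow> v \<le> T \<Longrightarrow> norm (W v - W u) \<le> G * (v - u) powr \<theta>"
      unfolding volterra_path_def by auto
    from path obtain x0 dr where
      eq': "\<forall>t\<in>{0..T}. \<exists>J. has_RS_integral (\<lambda>u. \<sigma> t u (X u)) W 0 t J \<and> X t = x0 + dr t + J"
      and dr': "\<forall>s t M. 0 \<le> s \<longrightarrow> s \<le> t \<longrightarrow> t \<le> T \<longrightarrow> (\<forall>u\<in>{0..t}. norm (X u) \<le> M) \<longrightarrow>
          norm (dr t - dr s) \<le> D * (1 + a * M) * (t - s) powr \<kappa>0"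
      unfolding volterra_path_def by blast
    note eq = eq'[rule_format] and dr = dr'[rule_format]
    define h where "h = \<eta> * (1 + G) powr (- 1 / \<theta>)"
    have "(1 + G) powr (- 1 / \<theta>) \<le> 1" using powr_mono[of "- 1 / \<theta>" 0 "1 + G"] G \<kappa> by simp
    then have h\<eta>: "h \<le> \<eta>" unfolding h_def using \<eta> by (simp add: mult_left_le)
    have "0 < h" using \<eta> G by (simp add: h_def)
    with h\<eta> \<eta> have h: "0 < h" "h \<le> 1" by linarith+
    have e1: "h powr \<kappa>0 \<le> \<eta> powr \<kappa>0" using h h\<eta> exps by (intro powr_mono2) auto
    \<comment> \<open>This is the reason for the exponent -1/\<theta> in the window length:
      \<open>h powr \<theta>\<close> becomes a multiple of 1 / (1 + G), which cancels G. Using 1 + G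
      instead of G covers G = 0 and gives \<open>h \<le> \<eta>\<close>.\<close>
    have "h powr \<theta> = \<eta> powr \<theta> * (1 + G) powr (- 1)"
      unfolding h_def using \<eta> G \<kappa> by (simp add: powr_mult powr_powr)
    then have "G * h powr \<theta> = \<eta> powr \<theta> * (G / (1 + G))"
      using G by (simp add: powr_minus field_simps)
    also have "\<dots> \<le> \<eta> powr \<theta> * 1" using G by (intro mult_left_mono) (auto simp: field_simps)
    also have "\<dots> \<le> \<eta> powr \<kappa>0" using \<eta> exps by (simp add: powr_mono')
    finally have e2: "G * h powr \<theta> \<le> \<eta> powr \<kappa>0" .
    have M0: "M \<ge> 0" using M[of 0] \<tau> order_trans[OF norm_ge_zero, of "X 0" M] by auto
    have aM: "a * M \<ge> 0" using a M0 by simp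
    obtain C where C: "\<And>s t. s \<in> {0..T} \<Longrightarrow> t \<in> {0..T} \<Longrightarrow> norm (X t - X s) \<le> C * \<bar>t - s\<bar> powr \<kappa>0"
      using hol unfolding holder_on_def by blast
    \<comment> \<open>The finite starting value for the absorption. It depends on the path, but
      disappears in the limit.\<close>
    have fin: "window_holder h \<kappa>0 X \<tau> (\<bar>C\<bar> * h powr \<kappa>0)"
      unfolding window_holder_def
    proof (intro allI impI)
      fix u v assume uv: "0 \<le> u" "u \<le> v" "v \<le> \<tau>" "v - u \<le> h"
      have "norm (X v - X u) \<le> C * \<bar>v - u\<bar> powr \<kappa>0" using C[of u v] uv \<tau> by auto
      also have "\<dots> \<le> \<bar>C\<bar> * (v - u) powr \<kappa>0" using uv by (auto intro: mult_right_mono)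
      also have "\<dots> = \<bar>C\<bar> * h powr \<kappa>0 * ((v - u) / h) powr \<kappa>0" using uv h by (simp add: powr_divide)
      finally show "norm (X v - X u) \<le> \<bar>C\<bar> * h powr \<kappa>0 * ((v - u) / h) powr \<kappa>0" .
    qed
    show "window_holder (\<eta> * (1 + G) powr (- 1 / \<theta>)) \<kappa>0 X \<tau> ((2 + a * M) / 3)"
      unfolding h_def[symmetric]
    proof (rule window_holder_absorb[OF fin \<eta>C])
      fix A assume A: "A \<ge> 0" and wA: "window_holder h \<kappa>0 X \<tau> A"
      show "window_holder h \<kappa>0 X \<tau> (\<eta> powr \<kappa>0 * C1 * (2 + a * M + A))"
        unfolding window_holder_def
      proof (intro allI impI)
        fix s t assume st: "0 \<le> s" "s \<le> t" "t \<le> \<tau>" "t - s \<le> h"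
        have tT: "t \<le> T" using st \<tau> by auto
        obtain Jt where Jt: "has_RS_integral (\<lambda>u. \<sigma> t u (X u)) W 0 t Jt" "X t = x0 + dr t + Jt"
          using eq[of t] st tT by auto
        obtain Js where Js: "has_RS_integral (\<lambda>u. \<sigma> s u (X u)) W 0 s Js" "X s = x0 + dr s + Js"
          using eq[of s] st tT by auto
        define r where "r = (t - s) / h"
        have r: "0 \<le> r" "r \<le> 1" unfolding r_def using st h by auto
        have ts: "t - s = r * h" unfolding r_def using h by simp
        have "norm (Jt - Js) \<le> G * (t - s) powr \<theta> * (B * (1 + a * M) + K * (1 + A) * c)
           + (T + 1) / h * (t - s) * (G * h powr \<theta>) * (K * (1 + (1 + A) * c))"
          unfolding c_def
        proof (rule RS_volterra_increment[OF \<sigma> \<kappa> st(1,2) tT st(4) h Jt(1) Js(1) _ W A G])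
          fix u v assume "0 \<le> u" "u \<le> v" "v \<le> t" "v - u \<le> h"
          then show "norm (X v - X u) \<le> A * ((v - u) / h) powr \<kappa>0"
            using wA st unfolding window_holder_def by simp
        next
          fix u assume u: "0 \<le> u" "u \<le> t"
          have "norm (\<sigma> t u (X u)) \<le> B * (1 + a * norm (X u))" using u st tT by (intro growth) auto
          also have "\<dots> \<le> B * (1 + a * M)"
            using M[of u] u st a B by (intro mult_left_mono add_left_mono) auto
          finally show "norm (\<sigma> t u (X u)) \<le> B * (1 + a * M)" .
        qed
        also have "\<dots> \<le> r powr \<kappa>0 * (\<eta> powr \<kappa>0 * (B * (1 + a * M) + K * (1 + A) * c))
           + r powr \<kappa>0 * (\<eta> powr \<kappa>0 * ((T + 1) * (K * (1 + (1 + A) * c))))"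
        proof (rule add_mono)
          have "G * (t - s) powr \<theta> = r powr \<theta> * (G * h powr \<theta>)"
            unfolding ts using r h by (simp add: powr_mult)
          also have "\<dots> \<le> r powr \<kappa>0 * \<eta> powr \<kappa>0"
            using r e2 G exps by (intro mult_mono powr_mono') auto
          finally have "G * (t - s) powr \<theta> * (B * (1 + a * M) + K * (1 + A) * c)
              \<le> (r powr \<kappa>0 * \<eta> powr \<kappa>0) * (B * (1 + a * M) + K * (1 + A) * c)"
            using B aM K A c by (intro mult_right_mono) auto
          then show "G * (t - s) powr \<theta> * (B * (1 + a * M) + K * (1 + A) * c)
              \<le> r powr \<kappa>0 * (\<eta> powr \<kappa>0 * (B * (1 + a * M) + K * (1 + A) * c))"
            by (simp add: mult.assoc)
        next
          \<comment> \<open>The factor 1 / h from the number of windows combines with t - s to r;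
            since r is at most 1, linear order in r is better than the order
            \<open>\<kappa>0\<close> required.\<close>
          have "r \<le> r powr \<kappa>0" using r exps powr_mono'[of \<kappa>0 1 r] by simp
          then have "r * (G * h powr \<theta>) \<le> r powr \<kappa>0 * \<eta> powr \<kappa>0"
            using e2 r G by (intro mult_mono) auto
          then have "r * (G * h powr \<theta>) * ((T + 1) * (K * (1 + (1 + A) * c)))
              \<le> r powr \<kappa>0 * \<eta> powr \<kappa>0 * ((T + 1) * (K * (1 + (1 + A) * c)))"
            using K A c T by (intro mult_right_mono) auto
          then show "(T + 1) / h * (t - s) * (G * h powr \<theta>) * (K * (1 + (1 + A) * c))
              \<le> r powr \<kappa>0 * (\<eta> powr \<kappa>0 * ((T + 1) * (K * (1 + (1 + A) * c))))"
            unfolding r_def by (simp add: mult_ac)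
        qed
        finally have J: "norm (Jt - Js) \<le> r powr \<kappa>0 * (\<eta> powr \<kappa>0 * (B * (1 + a * M) + K * (1 + A) * c))
           + r powr \<kappa>0 * (\<eta> powr \<kappa>0 * ((T + 1) * (K * (1 + (1 + A) * c))))" .
        have "norm (dr t - dr s) \<le> D * (1 + a * M) * (t - s) powr \<kappa>0"
          using dr[OF st(1,2) tT, of M] M st by auto
        also have "\<dots> = D * (1 + a * M) * (r powr \<kappa>0 * h powr \<kappa>0)"
          unfolding ts using r h by (simp add: powr_mult)
        also have "\<dots> \<le> D * (1 + a * M) * (r powr \<kappa>0 * \<eta> powr \<kappa>0)"
          using D aM e1 by (intro mult_left_mono) auto
        finally have d: "norm (dr t - dr s) \<le> r powr \<kappa>0 * (\<eta> powr \<kappa>0 * (D * (1 + a * M)))"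
          by (simp add: mult_ac)
        have "norm (X t - X s) \<le> norm (dr t - dr s) + norm (Jt - Js)"
          using norm_triangle_ineq[of "dr t - dr s" "Jt - Js"] Jt(2) Js(2) by (simp add: algebra_simps)
        also have "\<dots> \<le> (r powr \<kappa>0 * \<eta> powr \<kappa>0) * (D * (1 + a * M) + (B * (1 + a * M) + K * (1 + A) * c)
           + (T + 1) * (K * (1 + (1 + A) * c)))"
          using J d by (simp add: distrib_left mult.assoc)
        also have "\<dots> \<le> (r powr \<kappa>0 * \<eta> powr \<kappa>0) * (C1 * (2 + a * M + A))"
        proof (rule mult_left_mono)
          \<comment> \<open>One common majorant for 1 + a M, from the growth of the coefficients,
            and 1 + A, from the regularity of the integrand; hence the 2.\<close>
          let ?q = "2 + a * M + A"
          have "D * (1 + a * M) \<le> D * ?q" "B * (1 + a * M) \<le> B * ?q" "K * c * (1 + A) \<le> K * c * ?q"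
            "(T + 1) * K * (1 + (1 + A) * c) \<le> (T + 1) * K * ((1 + c) * ?q)"
          proof -
            have "1 + (1 + A) * c \<le> ?q + ?q * c"
              using A aM c by (intro add_mono mult_right_mono) auto
            then show "(T + 1) * K * (1 + (1 + A) * c) \<le> (T + 1) * K * ((1 + c) * ?q)"
              using T K by (intro mult_left_mono) (auto simp: algebra_simps)
          qed (use A aM D B K c in \<open>intro mult_left_mono; simp\<close>)+
          moreover have "C1 * ?q = D * ?q + B * ?q + K * c * ?q + (T + 1) * K * ((1 + c) * ?q)"
            unfolding C1_def by (simp only: distrib_right mult.assoc)
          ultimately show "D * (1 + a * M) + (B * (1 + a * M) + K * (1 + A) * c)
             + (T + 1) * (K * (1 + (1 + A) * c)) \<le> C1 * ?q" by (simp add: mult_ac)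
        qed simp
        finally show "norm (X t - X s) \<le> \<eta> powr \<kappa>0 * C1 * (2 + a * M + A) * ((t - s) / h) powr \<kappa>0"
          unfolding r_def by (simp add: mult_ac)
      qed
    qed (use aM h in auto)
  qed
qed


text \<open>For a = 0 a window adds at most 2/3, rounded up to 1. For a = 1 the bound on the
  increment involves the supremum over the enlarged window itself, with factor 1/3, and is absorbed;
  2 + sup |X| then at most doubles per window.\<close>

lemma window_holder_iterate:
  fixes X :: "real \<Rightarrow> 'a::real_normed_vector"
  assumes h: "h > 0" and T: "T \<ge> 0" and hol: "holder_on {0..T} \<kappa> X" and \<kappa>: "\<kappa> > 0"
    and win: "\<And>\<tau> M. \<tau> \<in> {0..T} \<Longrightarrow> \<forall>u\<in>{0..\<tau>}. norm (X u) \<le> M \<Longrightarrow>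
                window_holder h \<kappa> X \<tau> ((2 + a * M) / 3)"
    and t: "t \<in> {0..T}"
  shows "a = 0 \<Longrightarrow> norm (X t) \<le> norm (X 0) + (T / h + 1)"
    and "a = 1 \<Longrightarrow> 2 + norm (X t) \<le> exp (T / h + 1) * (2 + norm (X 0))"
proof -
  define n where "n = nat \<lceil>T / h\<rceil>"
  have "0 \<le> T / h" using h T by simp
  then have n: "real n \<le> T / h + 1" unfolding n_def by linarith
  obtain C where C: "\<And>s t. s \<in> {0..T} \<Longrightarrow> t \<in> {0..T} \<Longrightarrow> norm (X t - X s) \<le> C * \<bar>t - s\<bar> powr \<kappa>"
    using hol unfolding holder_on_def by blast
  \<comment> \<open>A crude bound, used only to know that suprema of the path are finite.\<close>
  have bdd: "norm (X u) \<le> norm (X 0) + \<bar>C\<bar> * T powr \<kappa>" if "u \<in> {0..T}" for u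
  proof -
    have "norm (X u - X 0) \<le> C * \<bar>u - 0\<bar> powr \<kappa>" using C[of 0 u] that T by auto
    also have "\<dots> \<le> \<bar>C\<bar> * T powr \<kappa>" using that \<kappa> by (intro mult_mono powr_mono2) auto
    finally show ?thesis using norm_triangle_ineq2[of "X u" "X 0"] by simp
  qed
  have step: "\<forall>u\<in>{0..min (\<tau> + h) T}. norm (X u) \<le> m + (2 + a * M) / 3"
    if \<tau>: "0 \<le> \<tau>" "\<tau> \<le> T" and m: "\<forall>u\<in>{0..\<tau>}. norm (X u) \<le> m" and a: "a \<ge> 0"
      and M: "\<forall>u\<in>{0..min (\<tau> + h) T}. norm (X u) \<le> M" for \<tau> m M
  proof
    fix u assume u: "u \<in> {0..min (\<tau> + h) T}"
    have "norm (X 0) \<le> M" using \<tau> h M by auto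
    then have M0: "0 \<le> M" using norm_ge_zero[of "X 0"] by linarith
    show "norm (X u) \<le> m + (2 + a * M) / 3"
    proof (cases "u \<le> \<tau>")
      case True
      then have "norm (X u) \<le> m" using m u by auto
      then show ?thesis using a M0 by (simp add: add_increasing2)
    next
      case False
      have "norm (X u) \<le> norm (X \<tau>) + (2 + a * M) / 3"
        using False u \<tau> a M0 \<kappa> h
        by (intro window_holder_step[OF win[OF _ M]]) auto
      moreover have "norm (X \<tau>) \<le> m" using m \<tau> by simp
      ultimately show ?thesis by linarith
    qed
  qed
  show "norm (X t) \<le> norm (X 0) + (T / h + 1)" if a: "a = 0"
  proof -
    have "norm (X t) \<le> ((\<lambda>m. m + 1) ^^ nat \<lceil>T / h\<rceil>) (norm (X 0))"
    proof (rule window_chain[OF h T _ t])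
      fix \<tau> m assume \<tau>: "0 \<le> \<tau>" "\<tau> \<le> T" and m: "\<forall>u\<in>{0..\<tau>}. norm (X u) \<le> m"
      have "\<forall>u\<in>{0..min (\<tau> + h) T}. norm (X u) \<le> m + (2 + a * (norm (X 0) + \<bar>C\<bar> * T powr \<kappa>)) / 3"
        using a \<tau> by (intro step[OF \<tau> m] ballI bdd) auto
      then show "\<forall>u\<in>{0..min (\<tau> + h) T}. norm (X u) \<le> m + 1" using a by fastforce
    qed
    also have "((\<lambda>m. m + 1) ^^ k) x = x + real k" for k and x :: real
      by (induction k) auto
    finally show ?thesis using n unfolding n_def by linarith
  qed
  show "2 + norm (X t) \<le> exp (T / h + 1) * (2 + norm (X 0))" if a: "a = 1"
  proof -
    have "norm (X t) \<le> ((\<lambda>m. 2 * m + 2) ^^ nat \<lceil>T / h\<rceil>) (norm (X 0))"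
    proof (rule window_chain[OF h T _ t])
      fix \<tau> m assume \<tau>: "0 \<le> \<tau>" "\<tau> \<le> T" and m: "\<forall>u\<in>{0..\<tau>}. norm (X u) \<le> m"
      \<comment> \<open>The actual supremum, not merely an upper bound: it must reappear on the left
        of the inequality for the absorption.\<close>
      define M where "M = (SUP u\<in>{0..min (\<tau> + h) T}. norm (X u))"
      have bd: "bdd_above ((\<lambda>u. norm (X u)) ` {0..min (\<tau> + h) T})"
        using bdd by (intro bdd_aboveI2[where M = "norm (X 0) + \<bar>C\<bar> * T powr \<kappa>"]) auto
      have M: "norm (X u) \<le> M" if "u \<in> {0..min (\<tau> + h) T}" for u
        unfolding M_def by (rule cSUP_upper[OF that bd])
      have "\<forall>u\<in>{0..min (\<tau> + h) T}. norm (X u) \<le> m + (2 + 1 * M) / 3"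
        using step[OF \<tau> m, of M] M a by simp
      moreover have "{0..min (\<tau> + h) T} \<noteq> {}" using \<tau> h by auto
      ultimately have "M \<le> m + (2 + 1 * M) / 3"
        using cSUP_least[of "{0..min (\<tau> + h) T}" "\<lambda>u. norm (X u)" "m + (2 + 1 * M) / 3"]
        unfolding M_def[symmetric] by blast
      moreover have "m \<ge> 0" using m \<tau> order_trans[OF norm_ge_zero, of "X 0" m] by auto
      \<comment> \<open>Solving for M gives 3 m / 2 + 1; the weaker 2 m + 2 is chosen because it
        maps 2 + m to twice its value, which makes the iteration explicit.\<close>
      ultimately have "M \<le> 2 * m + 2" by (simp add: field_simps)
      then show "\<forall>u\<in>{0..min (\<tau> + h) T}. norm (X u) \<le> 2 * m + 2" using order_trans[OF M] by blast
    qed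
    also have "((\<lambda>m. 2 * m + 2) ^^ k) x = 2 ^ k * (x + 2) - 2" for k and x :: real
      by (induction k) auto
    finally have "2 + norm (X t) \<le> 2 ^ n * (2 + norm (X 0))" unfolding n_def by (simp add: add.commute)
    moreover have "(2::real) ^ n \<le> exp (T / h + 1)"
    proof -
      have "(2::real) ^ n \<le> exp 1 ^ n" using exp_ge_add_one_self[of 1] by (intro power_mono) auto
      also have "\<dots> = exp (real n)" by (simp add: exp_of_nat_mult[symmetric])
      also have "\<dots> \<le> exp (T / h + 1)" using n by simp
      finally show ?thesis .
    qed
    ultimately show ?thesis
      using mult_right_mono[of "2 ^ n" "exp (T / h + 1)" "2 + norm (X 0)"] by simp
  qed
qed

text \<open>The number of windows is proportional to 1 / h, hence to
  \<open>(1 + G) powr (1 / \<theta>)\<close>; the additional window is absorbed because this power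
  is at least 1. The constant is uniform over all paths, as is needed for taking
  expectations.\<close>

lemma volterra_path_growth:
  fixes \<sigma> :: "real \<Rightarrow> real \<Rightarrow> real ^ 'd::finite \<Rightarrow> real ^ 'm::finite ^ 'd"
  assumes \<sigma>: "volterra_kernel T \<beta> K \<sigma>"
    and T: "T > 0"
    and exps: "0 < \<beta>" "0 < \<kappa>0" "\<kappa>0 \<le> 1" "\<kappa>0 \<le> \<theta>" "\<beta> + \<theta> > 1" "\<kappa>0 + \<theta> > 1"
    and a: "a \<in> {0, 1}" and B: "B \<ge> 0" and D: "D \<ge> 0"
    and growth: "\<And>t s x. t \<in> {0..T} \<Longrightarrow> s \<in> {0..T} \<Longrightarrow> norm (\<sigma> t s x) \<le> B * (1 + a * norm x)"
  obtains C where "C > 0"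
    "\<And>G W X t. \<lbrakk>volterra_path T \<theta> \<kappa>0 D a \<sigma> G W X; t \<in> {0..T}\<rbrakk>
     \<Longrightarrow> (a = 0 \<longrightarrow> norm (X t) \<le> norm (X 0) + C * (1 + G) powr (1 / \<theta>)) \<and>
         (a = 1 \<longrightarrow> 2 + norm (X t) \<le> exp (C * (1 + G) powr (1 / \<theta>)) * (2 + norm (X 0)))"
proof -
  have a0: "a \<ge> 0" using a by auto
  obtain \<eta> where \<eta>: "0 < \<eta>" "\<eta> \<le> 1" and win:
    "\<And>G W X \<tau> M. \<lbrakk>volterra_path T \<theta> \<kappa>0 D a \<sigma> G W X; \<tau> \<in> {0..T}; \<forall>u\<in>{0..\<tau>}. norm (X u) \<le> M\<rbrakk>
     \<Longrightarrow> window_holder (\<eta> * (1 + G) powr (- 1 / \<theta>)) \<kappa>0 X \<tau> ((2 + a * M) / 3)"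
    by (rule volterra_path_bound[OF \<sigma> T exps a0 B D growth]) (assumption | rule that)+
  show ?thesis
  proof (rule that[of "T / \<eta> + 1"])
    show "T / \<eta> + 1 > 0" using T \<eta> by (simp add: add_pos_pos)
    fix G W X t
    assume path: "volterra_path T \<theta> \<kappa>0 D a \<sigma> G W X" and t: "t \<in> {0..T}"
    from path have G: "G \<ge> 0" and hol: "holder_on {0..T} \<kappa>0 X"
      unfolding volterra_path_def by auto
    define h where "h = \<eta> * (1 + G) powr (- 1 / \<theta>)"
    have h: "h > 0" unfolding h_def using \<eta> G by simp
    have w: "window_holder h \<kappa>0 X \<tau> ((2 + a * M) / 3)"
      if "\<tau> \<in> {0..T}" "\<forall>u\<in>{0..\<tau>}. norm (X u) \<le> M" for \<tau> M
      unfolding h_def by (rule win[OF path that])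
    have "T / h = T / \<eta> * (1 + G) powr (1 / \<theta>)"
      unfolding h_def using \<eta> G by (simp add: powr_minus field_simps)
    moreover have "1 \<le> (1 + G) powr (1 / \<theta>)" using G exps by (intro ge_one_powr_ge_zero) auto
    ultimately have Th: "T / h + 1 \<le> (T / \<eta> + 1) * (1 + G) powr (1 / \<theta>)"
      by (simp add: algebra_simps)
    note it = window_holder_iterate[OF h less_imp_le[OF T] hol exps(2) _ t, of a]
    show "(a = 0 \<longrightarrow> norm (X t) \<le> norm (X 0) + (T / \<eta> + 1) * (1 + G) powr (1 / \<theta>)) \<and>
         (a = 1 \<longrightarrow> 2 + norm (X t) \<le> exp ((T / \<eta> + 1) * (1 + G) powr (1 / \<theta>)) * (2 + norm (X 0)))"
    proof (intro conjI impI)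
      assume a: "a = 0"
      have "norm (X t) \<le> norm (X 0) + (T / h + 1)" by (rule it(1)[OF w a])
      then show "norm (X t) \<le> norm (X 0) + (T / \<eta> + 1) * (1 + G) powr (1 / \<theta>)"
        using Th by linarith
    next
      assume a: "a = 1"
      have "2 + norm (X t) \<le> exp (T / h + 1) * (2 + norm (X 0))" by (rule it(2)[OF w a])
      also have "\<dots> \<le> exp ((T / \<eta> + 1) * (1 + G) powr (1 / \<theta>)) * (2 + norm (X 0))"
        using Th by (intro mult_right_mono) auto
      finally show "2 + norm (X t) \<le> exp ((T / \<eta> + 1) * (1 + G) powr (1 / \<theta>)) * (2 + norm (X 0))" .
    qed
  qed
qed

section \<open>The drift\<close>

text \<open>By Fubini almost every section of the integrable power is integrable. One good time
  \<open>t0\<close> is enough, since the drift is Lipschitz in its first argument and can be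
  compared with its value at \<open>t0\<close>.\<close>

lemma L_space_square_section:
  assumes "L_space_square T \<rho> f" "T > 0"
  obtains t0 \<psi> where "t0 \<in> {0..T}" "integrable lborel \<psi>"
    "AE u in lborel. u \<in> {0..T} \<longrightarrow> \<bar>f (t0, u)\<bar> powr \<rho> = \<psi> u"
proof -
  let ?S = "{0..T} \<times> {0..T}"
  define g where "g = (\<lambda>z. indicator ?S z *\<^sub>R \<bar>f z\<bar> powr \<rho>)"
  have "closed ?S" by (intro closed_Times) auto
  then have "?S \<in> sets lborel" by (simp add: borel_closed)
  then have S: "?S \<in> sets lebesgue" by (rule sets_completionI_sets)
  have g: "integrable lebesgue g"
    unfolding g_def using assms(1) S by (simp add: L_space_square_def integrable_restrict_space)
  then have "g \<in> borel_measurable lebesgue" by auto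
  \<comment> \<open>The function is only Lebesgue measurable in the plane, while Fubini is applied
    to the product of the Borel measures; hence a Borel version, and a final equality that holds
    only almost everywhere.\<close>
  then obtain g' where g': "g' \<in> borel_measurable lborel" and eq: "AE z in lborel. g z = g' z"
    using completion_ex_borel_measurable_real by blast
  have "integrable lebesgue g'"
    using g eq g' by (subst integrable_cong_AE[of g' lebesgue g])
      (auto intro: measurable_completion AE_completion)
  then have "integrable lborel g'" using g' integrable_completion by blast
  then have "integrable (lborel \<Otimes>\<^sub>M lborel) g'" by (simp add: lborel_prod)
  then have 1: "AE x in lborel. integrable lborel (\<lambda>y. g' (x, y))"
    by (intro lborel_pair.AE_integrable_fst'[of g', unfolded split_beta]) simp
  have "AE z in (lborel :: real measure) \<Otimes>\<^sub>M (lborel :: real measure). g z = g' z"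
    unfolding lborel_prod by (rule eq)
  then have 2: "AE x in lborel. AE y in lborel. g (x, y) = g' (x, y)"
    by (rule lborel_pair.AE_pair)
  have "\<exists>x\<in>{0..T}. integrable lborel (\<lambda>y. g' (x, y)) \<and> (AE y in lborel. g (x, y) = g' (x, y))"
  proof (rule ccontr)
    assume "\<not> ?thesis"
    then have "AE x in lborel. x \<notin> {0..T}" using 1 2 by (auto elim: AE_mp)
    then have "{0..T} \<in> null_sets lborel" by (subst (asm) AE_iff_null_sets[symmetric]) auto
    then show False using assms(2) by (simp add: null_sets_def)
  qed
  then obtain x where x: "x \<in> {0..T}" "integrable lborel (\<lambda>y. g' (x, y))"
    "AE y in lborel. g (x, y) = g' (x, y)" by blast
  have "AE u in lborel. u \<in> {0..T} \<longrightarrow> \<bar>f (x, u)\<bar> powr \<rho> = g' (x, u)"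
    using x(3) by eventually_elim (use x(1) in \<open>auto simp: g_def\<close>)
  then show ?thesis using x by (intro that) auto
qed

text \<open>A pointwise substitute for Hoelder's inequality: above the level
  \<open>l powr (- \<alpha>)\<close> the factor y^(1 - 1/\<alpha>) is at most l^(1 - \<alpha>).
  Integrated over an interval of length l, both terms are of order
  \<open>l powr (1 - \<alpha>)\<close>.\<close>

lemma powr_split_le:
  fixes y l \<alpha> :: real
  assumes "l > 0" "0 < \<alpha>" "\<alpha> < 1"
  shows "y \<le> l powr (- \<alpha>) + \<bar>y\<bar> powr (1 / \<alpha>) * l powr (1 - \<alpha>)"
proof (cases "y \<le> l powr (- \<alpha>)")
  case True
  then show ?thesis by (simp add: add_increasing2)
next
  case False
  have "y > l powr (- \<alpha>)" "l powr (- \<alpha>) > 0" using False assms by auto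
  then have y: "y > l powr (- \<alpha>)" "y > 0" by linarith+
  have "(l powr (- \<alpha>)) powr (1 / \<alpha> - 1) \<le> y powr (1 / \<alpha> - 1)"
    using y assms by (intro powr_mono2) auto
  moreover have "(l powr (- \<alpha>)) powr (1 / \<alpha> - 1) = l powr (- (1 - \<alpha>))"
    using assms unfolding powr_powr by (intro arg_cong[where f = "\<lambda>x. l powr x"]) (simp add: field_simps)
  ultimately have "l powr (- (1 - \<alpha>)) * l powr (1 - \<alpha>) \<le> y powr (1 / \<alpha> - 1) * l powr (1 - \<alpha>)"
    by (intro mult_right_mono) auto
  then have "1 \<le> y powr (1 / \<alpha> - 1) * l powr (1 - \<alpha>)" using assms by (simp add: powr_add[symmetric])
  then have "y * 1 \<le> y * (y powr (1 / \<alpha> - 1) * l powr (1 - \<alpha>))" using y by (intro mult_left_mono) auto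
  also have "\<dots> = y powr (1 / \<alpha>) * l powr (1 - \<alpha>)" using y by (simp add: powr_diff[of y])
  finally show ?thesis using y by (simp add: add_increasing)
qed

text \<open>On a singleton f agrees with a constant, whatever its measurability. This serves time 0,
  where a solution comes without an integrability statement.\<close>

lemma set_integrable_singleton:
  fixes f :: "real \<Rightarrow> 'a::euclidean_space"
  shows "set_integrable lborel {a..a} f"
proof -
  have "(\<lambda>x. indicator {a..a} x *\<^sub>R f x) = (\<lambda>x. indicator {a..a} x *\<^sub>R f a)"
    by (auto simp: indicator_def)
  moreover have "integrable lborel (\<lambda>x. indicator {a..a} x *\<^sub>R f a)"
    by (intro integrable_scaleR_left integrable_real_indicator) auto
  ultimately show ?thesis unfolding set_integrable_def by simp
qed

text \<open>Over [0,s] the change of the kernel is Lipschitz in time; over [s,t] the growth bound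
  applies, where \<open>b0\<close> in L^(1/\<alpha>) yields exactly the order 1 - \<alpha> in which
  solutions are measured.\<close>

lemma drift_increment:
  fixes b :: "real \<Rightarrow> real \<Rightarrow> real ^ 'd::finite \<Rightarrow> real ^ 'd"
  assumes reg: "drift_regular T 1 b" and b0: "L_space_square T (1 / \<alpha>) b0" and T: "T > 0"
    and \<alpha>: "0 < \<alpha>" "\<alpha> < 1" and a: "a \<ge> 0" and L0: "L0 \<ge> 0"
    and growth: "\<And>t s x. t \<in> {0..T} \<Longrightarrow> s \<in> {0..T} \<Longrightarrow> norm (b t s x) \<le> L0 * (1 + a * norm x) + b0 (t, s)"
  obtains D where "D \<ge> 0"
    "\<And>X s t M. \<lbrakk>0 \<le> s; s \<le> t; t \<le> T; \<forall>u\<in>{0..t}. norm (X u) \<le> M;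
        set_integrable lborel {0..t} (\<lambda>u. b t u (X u)); set_integrable lborel {0..s} (\<lambda>u. b s u (X u))\<rbrakk>
      \<Longrightarrow> norm ((LINT u:{0..t}|lborel. b t u (X u)) - (LINT u:{0..s}|lborel. b s u (X u)))
            \<le> D * (1 + a * M) * (t - s) powr (1 - \<alpha>)"
proof -
  obtain L where L: "L > 0" "\<And>t1 t2 s x. t1\<in>{0..T} \<Longrightarrow> t2\<in>{0..T} \<Longrightarrow> s\<in>{0..T} \<Longrightarrow>
        norm (b t1 s x - b t2 s x) \<le> L * \<bar>t1 - t2\<bar>"
    using reg unfolding drift_regular_def by fastforce
  obtain t0 \<psi> where t0: "t0 \<in> {0..T}" and \<psi>: "integrable lborel \<psi>"
    and ae: "AE u in lborel. u \<in> {0..T} \<longrightarrow> \<bar>b0 (t0, u)\<bar> powr (1 / \<alpha>) = \<psi> u"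
    using L_space_square_section[OF b0 T] by blast
  define \<Psi> where "\<Psi> = (LINT u|lborel. \<bar>\<psi> u\<bar>)"
  have \<Psi>: "\<Psi> \<ge> 0" unfolding \<Psi>_def by simp
  define D where "D = T powr \<alpha> * (L0 + 2 * L * T) + 1 + \<Psi>"
  have D: "D \<ge> 0" unfolding D_def using \<Psi> L(1) L0 T by simp
  show ?thesis
  proof (rule that[OF D])
    fix X :: "real \<Rightarrow> real ^ 'd" and s t M
    assume s: "0 \<le> s" "s \<le> t" "t \<le> T" and M': "\<forall>u\<in>{0..t}. norm (X u) \<le> M"
      and it: "set_integrable lborel {0..t} (\<lambda>u. b t u (X u))"
      and js: "set_integrable lborel {0..s} (\<lambda>u. b s u (X u))"
    show "norm ((LINT u:{0..t}|lborel. b t u (X u)) - (LINT u:{0..s}|lborel. b s u (X u)))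
            \<le> D * (1 + a * M) * (t - s) powr (1 - \<alpha>)"
    proof (cases "s = t")
      case True
      then show ?thesis by simp
    next
      case False
      note M = M'[rule_format]
      define l where "l = t - s"
      have l: "l > 0" "l \<le> T" using False s by (auto simp: l_def)
      have M0: "0 \<le> M" using M[of 0] s order_trans[OF norm_ge_zero, of "X 0" M] by auto
      have aM: "0 \<le> a * M" using a M0 by simp
      have i1: "set_integrable lborel {0..s} (\<lambda>u. b t u (X u))"
        using s by (intro set_integrable_subset[OF it]) auto
      have i2: "set_integrable lborel {s<..t} (\<lambda>u. b t u (X u))"
        using s by (intro set_integrable_subset[OF it]) auto
      have un: "{0..t} = {0..s} \<union> {s<..t}" using s by auto
      have "(LINT u:{0..t}|lborel. b t u (X u)) =
          (LINT u:{0..s}|lborel. b t u (X u)) + (LINT u:{s<..t}|lborel. b t u (X u))"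
        unfolding un by (rule set_integral_Un[OF _ i1 i2]) auto
      then have eq: "(LINT u:{0..t}|lborel. b t u (X u)) - (LINT u:{0..s}|lborel. b s u (X u)) =
          (LINT u:{0..s}|lborel. b t u (X u) - b s u (X u)) + (LINT u:{s<..t}|lborel. b t u (X u))"
        using set_integral_diff(2)[OF i1 js] by simp
      have "norm (LINT u:{0..s}|lborel. b t u (X u) - b s u (X u))
          \<le> (LINT u:{0..s}|lborel. norm (b t u (X u) - b s u (X u)))"
        by (intro set_integral_norm_bound set_integral_diff(1) i1 js)
      also have "\<dots> \<le> (LINT u:{0..s}|lborel. L * l)"
      proof (rule set_integral_mono)
        show "set_integrable lborel {0..s} (\<lambda>u. norm (b t u (X u) - b s u (X u)))"
          by (intro set_integrable_norm set_integral_diff(1) i1 js)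
        show "set_integrable lborel {0..s} (\<lambda>u. L * l)"
          unfolding set_integrable_def using s
          by (intro integrable_scaleR_left integrable_real_indicator) auto
        show "norm (b t u (X u) - b s u (X u)) \<le> L * l" if "u \<in> {0..s}" for u
          using L(2)[of t s u "X u"] that s by (auto simp: l_def)
      qed
      also have "\<dots> = s * (L * l)"
        using s by (simp add: set_lebesgue_integral_def)
      also have "\<dots> \<le> T * (L * l)" using s l L by (intro mult_right_mono) auto
      finally have I1: "norm (LINT u:{0..s}|lborel. b t u (X u) - b s u (X u)) \<le> L * T * l"
        by (simp add: mult_ac)
      define k where "k = L0 * (1 + a * M) + L * T + l powr (- \<alpha>)"
      have ci: "set_integrable lborel {s<..t} (\<lambda>u. k)"
        unfolding set_integrable_def using s by (intro integrable_scaleR_left integrable_real_indicator) auto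
      have pi: "set_integrable lborel {s<..t} (\<lambda>u. \<bar>\<psi> u\<bar> * l powr (1 - \<alpha>))"
        unfolding set_integrable_def using \<psi>
        by (intro integrable_mult_indicator integrable_mult_left integrable_abs) auto
      have "norm (LINT u:{s<..t}|lborel. b t u (X u)) \<le> (LINT u:{s<..t}|lborel. norm (b t u (X u)))"
        by (intro set_integral_norm_bound i2)
      also have "\<dots> \<le> (LINT u:{s<..t}|lborel. k + \<bar>\<psi> u\<bar> * l powr (1 - \<alpha>))"
      proof (rule set_integral_mono_AE)
        show "set_integrable lborel {s<..t} (\<lambda>u. norm (b t u (X u)))" by (intro set_integrable_norm i2)
        show "set_integrable lborel {s<..t} (\<lambda>u. k + \<bar>\<psi> u\<bar> * l powr (1 - \<alpha>))"
          by (intro set_integral_add(1) ci pi)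
        show "AE u\<in>{s<..t} in lborel. norm (b t u (X u)) \<le> k + \<bar>\<psi> u\<bar> * l powr (1 - \<alpha>)"
          using ae
        proof eventually_elim
          case (elim u)
          show ?case
          proof
            assume u: "u \<in> {s<..t}"
            then have uT: "u \<in> {0..T}" "t \<in> {0..T}" using s by auto
            \<comment> \<open>The growth bound is used at the good time \<open>t0\<close>, not at t,
              where the section of \<open>b0\<close> need not be integrable.\<close>
            have "norm (b t u (X u)) \<le> norm (b t0 u (X u)) + norm (b t u (X u) - b t0 u (X u))"
              using norm_triangle_ineq[of "b t0 u (X u)" "b t u (X u) - b t0 u (X u)"] by simp
            also have "\<dots> \<le> (L0 * (1 + a * norm (X u)) + b0 (t0, u)) + L * \<bar>t - t0\<bar>"
              by (intro add_mono growth L(2) t0 uT)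
            also have "\<dots> \<le> (L0 * (1 + a * M) + b0 (t0, u)) + L * T"
              using L0 a L(1) M[of u] u s t0
              by (intro add_mono mult_left_mono) auto
            also have "b0 (t0, u) \<le> l powr (- \<alpha>) + \<bar>b0 (t0, u)\<bar> powr (1 / \<alpha>) * l powr (1 - \<alpha>)"
              using l \<alpha> by (intro powr_split_le) auto
            also have "\<bar>b0 (t0, u)\<bar> powr (1 / \<alpha>) = \<bar>\<psi> u\<bar>" using elim uT(1) by (metis abs_of_nonneg powr_ge_zero)
            finally show "norm (b t u (X u)) \<le> k + \<bar>\<psi> u\<bar> * l powr (1 - \<alpha>)"
              unfolding k_def by simp
          qed
        qed
      qed
      also have "\<dots> = (LINT u:{s<..t}|lborel. k) + (LINT u:{s<..t}|lborel. \<bar>\<psi> u\<bar> * l powr (1 - \<alpha>))"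
        by (rule set_integral_add(2)[OF ci pi])
      also have "(LINT u:{s<..t}|lborel. k) = l * k"
        using s by (simp add: set_lebesgue_integral_def l_def)
      also have "(LINT u:{s<..t}|lborel. \<bar>\<psi> u\<bar> * l powr (1 - \<alpha>)) \<le> (LINT u|lborel. \<bar>\<psi> u\<bar> * l powr (1 - \<alpha>))"
        unfolding set_lebesgue_integral_def
        using pi \<psi> by (intro integral_mono) (auto simp: set_integrable_def indicator_def)
      also have "\<dots> = \<Psi> * l powr (1 - \<alpha>)" unfolding \<Psi>_def by simp
      finally have I2: "norm (LINT u:{s<..t}|lborel. b t u (X u)) \<le> l * k + \<Psi> * l powr (1 - \<alpha>)" by simp
      have l1: "l \<le> T powr \<alpha> * l powr (1 - \<alpha>)"
      proof -
        have "l = l powr \<alpha> * l powr (1 - \<alpha>)" using l by (simp add: powr_add[symmetric])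
        also have "\<dots> \<le> T powr \<alpha> * l powr (1 - \<alpha>)" using l \<alpha> by (intro mult_right_mono powr_mono2) auto
        finally show ?thesis .
      qed
      have l2: "l * l powr (- \<alpha>) = l powr (1 - \<alpha>)" using l by (simp add: powr_diff powr_minus divide_inverse)
      have "L * T * l + l * k + \<Psi> * l powr (1 - \<alpha>)
          = l * (L0 * (1 + a * M) + 2 * L * T) + (1 + \<Psi>) * l powr (1 - \<alpha>)"
        unfolding k_def using l2 by (simp add: algebra_simps)
      also have "\<dots> \<le> (T powr \<alpha> * l powr (1 - \<alpha>)) * ((L0 + 2 * L * T) * (1 + a * M)) + (1 + \<Psi>) * (1 + a * M) * l powr (1 - \<alpha>)"
      proof (intro add_mono mult_mono)
        show "L0 * (1 + a * M) + 2 * L * T \<le> (L0 + 2 * L * T) * (1 + a * M)"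
          using mult_nonneg_nonneg[OF _ aM, of "2 * L * T"] L(1) T by (simp add: algebra_simps)
        show "1 + \<Psi> \<le> (1 + \<Psi>) * (1 + a * M)"
          using mult_nonneg_nonneg[OF _ aM, of "1 + \<Psi>"] \<Psi> by (simp add: algebra_simps)
      qed (use l1 l aM L(1) T L0 \<Psi> in auto)
      also have "\<dots> = D * (1 + a * M) * l powr (1 - \<alpha>)"
        unfolding D_def by (simp add: algebra_simps)
      finally have "L * T * l + l * k + \<Psi> * l powr (1 - \<alpha>) \<le> D * (1 + a * M) * l powr (1 - \<alpha>)" .
      then show ?thesis
        unfolding eq l_def[symmetric] using I1 I2
        by (intro order_trans[OF norm_triangle_ineq]) linarith
    qed
  qed
qed

text \<open>The quantifier over G stands inside the almost everywhere statement: one null set serves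
  all G, so that G may later depend on the sample point.\<close>

lemma volterra_solution_growth:
  fixes \<sigma> :: "real \<Rightarrow> real \<Rightarrow> real ^ 'd::finite \<Rightarrow> real ^ 'm::finite ^ 'd"
    and b :: "real \<Rightarrow> real \<Rightarrow> real ^ 'd \<Rightarrow> real ^ 'd"
  assumes sol: "pathwise_solution M T (1 - \<alpha>) b \<sigma> W X0 X"
    and \<sigma>: "volterra_kernel T \<beta> K \<sigma>" and T: "T > 0"
    and exps: "0 < \<alpha>" "\<alpha> < 1" "0 < \<beta>" "1 - \<alpha> \<le> \<theta>" "\<beta> + \<theta> > 1" "1 - \<alpha> + \<theta> > 1"
    and a: "a \<in> {0, 1}" and B: "B \<ge> 0" and L0: "L0 \<ge> 0"
    and \<sigma>_growth: "\<And>t s x. t \<in> {0..T} \<Longrightarrow> s \<in> {0..T} \<Longrightarrow> norm (\<sigma> t s x) \<le> B * (1 + a * norm x)"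
    and reg: "drift_regular T 1 b" and b0: "L_space_square T (1 / \<alpha>) b0"
    and b_growth: "\<And>t s x. t \<in> {0..T} \<Longrightarrow> s \<in> {0..T} \<Longrightarrow> norm (b t s x) \<le> L0 * (1 + a * norm x) + b0 (t, s)"
  obtains C where "C > 0"
    "AE \<omega> in M. \<forall>G\<ge>0.
       (\<forall>u v. 0 \<le> u \<longrightarrow> u \<le> v \<longrightarrow> v \<le> T \<longrightarrow> norm (W v \<omega> - W u \<omega>) \<le> G * (v - u) powr \<theta>) \<longrightarrow>
       (\<forall>t\<in>{0..T}.
         (a = 0 \<longrightarrow> norm (X t \<omega>) \<le> norm (X0 \<omega>) + C * (1 + G) powr (1 / \<theta>)) \<and>
         (a = 1 \<longrightarrow> 2 + norm (X t \<omega>) \<le> exp (C * (1 + G) powr (1 / \<theta>)) * (2 + norm (X0 \<omega>))))"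
proof -
  have a0: "a \<ge> 0" using a by auto
  obtain D where D: "D \<ge> 0" and incr:
    "\<And>X s t M. \<lbrakk>0 \<le> s; s \<le> t; t \<le> T; \<forall>u\<in>{0..t}. norm (X u) \<le> M;
        set_integrable lborel {0..t} (\<lambda>u. b t u (X u)); set_integrable lborel {0..s} (\<lambda>u. b s u (X u))\<rbrakk>
      \<Longrightarrow> norm ((LINT u:{0..t}|lborel. b t u (X u)) - (LINT u:{0..s}|lborel. b s u (X u)))
            \<le> D * (1 + a * M) * (t - s) powr (1 - \<alpha>)"
    by (rule drift_increment[OF reg b0 T exps(1,2) a0 L0 b_growth]) (assumption | rule that)+
  have \<kappa>: "0 < 1 - \<alpha>" "1 - \<alpha> \<le> 1" using exps by auto
  obtain C where C: "C > 0" and growth: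
    "\<And>G W X t. \<lbrakk>volterra_path T \<theta> (1 - \<alpha>) D a \<sigma> G W X; t \<in> {0..T}\<rbrakk>
     \<Longrightarrow> (a = 0 \<longrightarrow> norm (X t) \<le> norm (X 0) + C * (1 + G) powr (1 / \<theta>)) \<and>
         (a = 1 \<longrightarrow> 2 + norm (X t) \<le> exp (C * (1 + G) powr (1 / \<theta>)) * (2 + norm (X 0)))"
    by (rule volterra_path_growth[OF \<sigma> T exps(3) \<kappa> exps(4,5,6) a B D \<sigma>_growth]) (assumption | rule that)+
  have "AE \<omega> in M. holder_on {0..T} (1 - \<alpha>) (\<lambda>t. X t \<omega>) \<and> X 0 \<omega> = X0 \<omega> \<and>
        (\<forall>t\<in>{0<..T}. set_integrable lborel {0..t} (\<lambda>s. b t s (X s \<omega>)) \<and>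
           (\<exists>J. has_RS_integral (\<lambda>s. \<sigma> t s (X s \<omega>)) (\<lambda>s. W s \<omega>) 0 t J \<and>
                X t \<omega> = X0 \<omega> + (LINT s:{0..t}|lborel. b t s (X s \<omega>)) + J))"
    using sol unfolding pathwise_solution_def by (rule conjunct2)
  then have "AE \<omega> in M. \<forall>G\<ge>0.
       (\<forall>u v. 0 \<le> u \<longrightarrow> u \<le> v \<longrightarrow> v \<le> T \<longrightarrow> norm (W v \<omega> - W u \<omega>) \<le> G * (v - u) powr \<theta>) \<longrightarrow>
       (\<forall>t\<in>{0..T}.
         (a = 0 \<longrightarrow> norm (X t \<omega>) \<le> norm (X0 \<omega>) + C * (1 + G) powr (1 / \<theta>)) \<and>
         (a = 1 \<longrightarrow> 2 + norm (X t \<omega>) \<le> exp (C * (1 + G) powr (1 / \<theta>)) * (2 + norm (X0 \<omega>))))"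
  proof (eventually_elim, intro allI impI ballI)
    fix \<omega> G t
    assume sol: "holder_on {0..T} (1 - \<alpha>) (\<lambda>t. X t \<omega>) \<and> X 0 \<omega> = X0 \<omega> \<and>
        (\<forall>t\<in>{0<..T}. set_integrable lborel {0..t} (\<lambda>s. b t s (X s \<omega>)) \<and>
           (\<exists>J. has_RS_integral (\<lambda>s. \<sigma> t s (X s \<omega>)) (\<lambda>s. W s \<omega>) 0 t J \<and>
                X t \<omega> = X0 \<omega> + (LINT s:{0..t}|lborel. b t s (X s \<omega>)) + J))"
      and G: "G \<ge> 0" and t: "t \<in> {0..T}"
      and W: "\<forall>u v. 0 \<le> u \<longrightarrow> u \<le> v \<longrightarrow> v \<le> T \<longrightarrow> norm (W v \<omega> - W u \<omega>) \<le> G * (v - u) powr \<theta>"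
    define dr where "dr = (\<lambda>t. LINT s:{0..t}|lborel. b t s (X s \<omega>))"
    have int: "set_integrable lborel {0..t} (\<lambda>s. b t s (X s \<omega>))" if "t \<in> {0..T}" for t
    proof (cases "t = 0")
      case True
      then show ?thesis using set_integrable_singleton[of 0] by simp
    qed (use sol that in auto)
    have "volterra_path T \<theta> (1 - \<alpha>) D a \<sigma> G (\<lambda>t. W t \<omega>) (\<lambda>t. X t \<omega>)"
      unfolding volterra_path_def
    proof (intro conjI exI[of _ "X0 \<omega>"] exI[of _ dr])
      show "\<forall>t\<in>{0..T}. \<exists>J. has_RS_integral (\<lambda>u. \<sigma> t u (X u \<omega>)) (\<lambda>t. W t \<omega>) 0 t J \<and> X t \<omega> = X0 \<omega> + dr t + J"
      proof
        fix t assume t: "t \<in> {0..T}"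
        show "\<exists>J. has_RS_integral (\<lambda>u. \<sigma> t u (X u \<omega>)) (\<lambda>t. W t \<omega>) 0 t J \<and> X t \<omega> = X0 \<omega> + dr t + J"
        proof (cases "t = 0")
          case True
          \<comment> \<open>The equation is not imposed at time 0, so it is checked here: the drift
            integral vanishes since a point is a null set.\<close>
          have "AE x in lborel. indicator {0..0} x *\<^sub>R b 0 x (X x \<omega>) = 0"
            using AE_lborel_singleton[of "0 :: real"] by eventually_elim (simp add: indicator_def)
          then have "dr 0 = 0"
            unfolding dr_def set_lebesgue_integral_def by (rule integral_eq_zero_AE)
          then show ?thesis using True sol has_RS_integral_trivial[of _ _ 0] by (intro exI[of _ 0]) simp
        next
          case False
          then have "t \<in> {0<..T}" using t by auto
          then show ?thesis using sol unfolding dr_def by blast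
        qed
      qed
      show "\<forall>s t M. 0 \<le> s \<longrightarrow> s \<le> t \<longrightarrow> t \<le> T \<longrightarrow> (\<forall>u\<in>{0..t}. norm (X u \<omega>) \<le> M) \<longrightarrow>
          norm (dr t - dr s) \<le> D * (1 + a * M) * (t - s) powr (1 - \<alpha>)"
      proof (intro allI impI)
        fix s t M assume s: "0 \<le> s" "s \<le> t" "t \<le> T" and M: "\<forall>u\<in>{0..t}. norm (X u \<omega>) \<le> M"
        show "norm (dr t - dr s) \<le> D * (1 + a * M) * (t - s) powr (1 - \<alpha>)"
          unfolding dr_def
        proof (rule incr[OF s M])
          show "set_integrable lborel {0..t} (\<lambda>u. b t u (X u \<omega>))" using s by (intro int) auto
          show "set_integrable lborel {0..s} (\<lambda>u. b s u (X u \<omega>))" using s by (intro int) auto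
        qed
      qed
    qed (use G sol W in auto)
    from growth[OF this t] show
      "(a = 0 \<longrightarrow> norm (X t \<omega>) \<le> norm (X0 \<omega>) + C * (1 + G) powr (1 / \<theta>)) \<and>
       (a = 1 \<longrightarrow> 2 + norm (X t \<omega>) \<le> exp (C * (1 + G) powr (1 / \<theta>)) * (2 + norm (X0 \<omega>)))"
      using sol by simp
  qed
  with C show ?thesis by (rule that)
qed

section \<open>Hoelder constants of fractional Brownian motion\<close>

lemma dyadic_approx:
  fixes t :: real
  assumes "0 \<le> t" "t \<le> 1"
  shows "real (nat \<lfloor>t * 2 ^ n\<rfloor>) / 2 ^ n \<in> {0..1}" "nat \<lfloor>t * 2 ^ n\<rfloor> \<le> 2 ^ n"
    and "\<bar>real (nat \<lfloor>t * 2 ^ n\<rfloor>) / 2 ^ n - t\<bar> \<le> (1 / 2) ^ n"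
    and "nat \<lfloor>t * 2 ^ Suc n\<rfloor> \<in> {2 * nat \<lfloor>t * 2 ^ n\<rfloor>, 2 * nat \<lfloor>t * 2 ^ n\<rfloor> + 1}"
proof -
  let ?x = "t * 2 ^ n"
  have x: "0 \<le> ?x" "?x \<le> 2 ^ n" using assms by (auto intro: mult_left_le_one_le)
  have r: "real (nat \<lfloor>?x\<rfloor>) \<le> ?x" "?x < real (nat \<lfloor>?x\<rfloor>) + 1" using x by linarith+
  have le: "real (nat \<lfloor>?x\<rfloor>) \<le> 2 ^ n" by (rule order_trans[OF r(1) x(2)])
  then show "nat \<lfloor>?x\<rfloor> \<le> 2 ^ n" by (metis of_nat_le_iff of_nat_numeral of_nat_power)
  have "real (nat \<lfloor>?x\<rfloor>) / 2 ^ n \<le> 2 ^ n / 2 ^ n" by (rule divide_right_mono[OF le]) simp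
  then show "real (nat \<lfloor>?x\<rfloor>) / 2 ^ n \<in> {0..1}" by simp
  have "\<bar>real (nat \<lfloor>?x\<rfloor>) - ?x\<bar> \<le> 1" using r by linarith
  then have "\<bar>real (nat \<lfloor>?x\<rfloor>) - ?x\<bar> / 2 ^ n \<le> 1 / 2 ^ n" by (rule divide_right_mono) simp
  moreover have "\<bar>real (nat \<lfloor>?x\<rfloor>) / 2 ^ n - t\<bar> = \<bar>real (nat \<lfloor>?x\<rfloor>) - ?x\<bar> / 2 ^ n"
  proof -
    have "real (nat \<lfloor>?x\<rfloor>) / 2 ^ n - t = (real (nat \<lfloor>?x\<rfloor>) - ?x) / 2 ^ n"
      by (simp add: diff_divide_distrib)
    then show ?thesis by (simp only: abs_divide) simp
  qed
  ultimately show "\<bar>real (nat \<lfloor>?x\<rfloor>) / 2 ^ n - t\<bar> \<le> (1 / 2) ^ n" by (simp add: power_one_over)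
  have "t * 2 ^ Suc n = 2 * ?x" by simp
  then have "nat \<lfloor>t * 2 ^ Suc n\<rfloor> = 2 * nat \<lfloor>?x\<rfloor> \<or> nat \<lfloor>t * 2 ^ Suc n\<rfloor> = 2 * nat \<lfloor>?x\<rfloor> + 1"
    using r x by linarith
  then show "nat \<lfloor>t * 2 ^ Suc n\<rfloor> \<in> {2 * nat \<lfloor>?x\<rfloor>, 2 * nat \<lfloor>?x\<rfloor> + 1}" by simp
qed

text \<open>The deterministic half of the Kolmogorov-Chentsov argument. The constant consists of two
  geometric tails, from s and t to their dyadic approximations, one step between neighbouring dyadic
  points, and \<open>2 powr \<theta>\<close> for comparing t - s with the dyadic scale.\<close>

lemma dyadic_chaining:
  fixes w :: "real \<Rightarrow> 'a::real_normed_vector"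
  assumes cont: "continuous_on {0..1} w" and \<theta>: "\<theta> > 0" and y: "y \<ge> 0"
    and inc: "\<And>n i. i < 2 ^ n \<Longrightarrow>
      norm (w (real (Suc i) / 2 ^ n) - w (real i / 2 ^ n)) \<le> y * (2 powr - \<theta>) ^ n"
    and st: "0 \<le> s" "s \<le> t" "t \<le> 1"
  shows "norm (w t - w s) \<le> 2 powr \<theta> * (2 * 2 powr - \<theta> / (1 - 2 powr - \<theta>) + 1) * y * (t - s) powr \<theta>"
proof (cases "s = t")
  case False
  define q where "q = (2::real) powr - \<theta>"
  have q: "0 < q" "q < 1" unfolding q_def using \<theta> powr_less_mono[of "- \<theta>" 0 "2::real"] by auto
  \<comment> \<open>\<open>A * q ^ n\<close> is the tail of the geometric series with terms
    \<open>y * q ^ m\<close> over m > n.\<close>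
  define A where "A = y * q / (1 - q)"
  define d where "d = (\<lambda>n (t::real). real (nat \<lfloor>t * 2 ^ n\<rfloor>) / 2 ^ n)"
  have near: "norm (w t - w (d n t)) \<le> A * q ^ n" if t: "0 \<le> t" "t \<le> 1" for n t
  proof -
    have step: "norm (w (d (Suc m) t) - w (d m t)) \<le> y * q ^ Suc m" for m
    proof -
      let ?i = "nat \<lfloor>t * 2 ^ m\<rfloor>"
      have dm: "d m t = real (2 * ?i) / 2 ^ Suc m" unfolding d_def by simp
      consider "nat \<lfloor>t * 2 ^ Suc m\<rfloor> = 2 * ?i" | "nat \<lfloor>t * 2 ^ Suc m\<rfloor> = Suc (2 * ?i)"
        using dyadic_approx(4)[OF t, of m] by auto
      then show ?thesis
      proof cases
        case 1
        then have "d (Suc m) t = d m t" unfolding dm by (simp add: d_def)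
        then show ?thesis using y q by simp
      next
        case 2
        then have "2 * ?i < 2 ^ Suc m" using dyadic_approx(2)[OF t, of "Suc m"] by linarith
        from inc[OF this] show ?thesis unfolding dm using 2 by (simp add: d_def q_def)
      qed
    qed
    have tele: "norm (w (d (n + k) t) - w (d n t)) \<le> A * (q ^ n - q ^ (n + k))" for k
    proof (induction k)
      case (Suc k)
      have "norm (w (d (n + Suc k) t) - w (d n t)) \<le>
          norm (w (d (Suc (n + k)) t) - w (d (n + k) t)) + norm (w (d (n + k) t) - w (d n t))"
        using norm_triangle_ineq[of "w (d (Suc (n + k)) t) - w (d (n + k) t)" "w (d (n + k) t) - w (d n t)"]
        by simp
      also have "\<dots> \<le> y * q ^ Suc (n + k) + A * (q ^ n - q ^ (n + k))" by (intro add_mono step Suc)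
      also have "y * q ^ Suc (n + k) = A * (q ^ (n + k) - q ^ Suc (n + k))"
        using q by (simp add: A_def field_simps)
      finally show ?case by (simp add: algebra_simps)
    qed simp
    have "(\<lambda>k. d (n + k) t) \<longlonglongrightarrow> t"
    proof (rule LIM_zero_cancel, rule Lim_null_comparison)
      have "\<bar>d (n + k) t - t\<bar> \<le> (1 / 2) ^ k" for k
      proof -
        have "\<bar>d (n + k) t - t\<bar> \<le> (1 / 2) ^ (n + k)" unfolding d_def by (rule dyadic_approx(3)[OF t])
        also have "\<dots> \<le> (1 / 2) ^ k" by (rule power_decreasing) auto
        finally show ?thesis .
      qed
      then show "\<forall>\<^sub>F k in sequentially. norm (d (n + k) t - t) \<le> (1 / 2) ^ k" by simp
      show "(\<lambda>k. (1 / 2 :: real) ^ k) \<longlonglongrightarrow> 0" by (intro LIMSEQ_realpow_zero) auto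
    qed
    then have "(\<lambda>k. w (d (n + k) t)) \<longlonglongrightarrow> w t"
      using cont dyadic_approx(1)[OF t] t
      by (intro continuous_on_tendsto_compose[OF cont]) (auto simp: d_def intro!: always_eventually)
    then have "(\<lambda>k. norm (w (d (n + k) t) - w (d n t))) \<longlonglongrightarrow> norm (w t - w (d n t))"
      by (intro tendsto_intros)
    moreover have "norm (w (d (n + k) t) - w (d n t)) \<le> A * q ^ n" for k
    proof -
      have "A * (q ^ n - q ^ (n + k)) \<le> A * q ^ n"
        using q y by (intro mult_left_mono) (auto simp: A_def)
      then show ?thesis using tele[of k] by linarith
    qed
    ultimately show ?thesis by (intro LIMSEQ_le_const2) auto
  qed
  obtain n0 where n0: "(1/2::real) ^ n0 < t - s"
    using st False real_arch_pow_inv[of "t - s" "1/2"] by auto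
  have "(1/2::real) ^ Suc n0 \<le> (1/2) ^ n0" by simp
  with n0 have "\<exists>n. (1/2::real) ^ Suc n < t - s" by (meson le_less_trans)
  \<comment> \<open>The scale at which t - s lies between 2^-(n+1) and 2^-n: coarse enough for the
    approximations of s and t to be equal or adjacent, fine enough for q^n to be of order
    \<open>(t - s) powr \<theta>\<close>.\<close>
  define n where "n = (LEAST n. (1/2::real) ^ Suc n < t - s)"
  have n1: "(1/2::real) ^ Suc n < t - s"
    unfolding n_def by (rule LeastI_ex) fact
  have n2: "t - s \<le> (1/2) ^ n"
  proof (cases n)
    case 0
    then show ?thesis using st by simp
  next
    case (Suc m)
    then have "\<not> (1/2::real) ^ Suc m < t - s" unfolding n_def by (metis lessI not_less_Least)
    then show ?thesis using Suc by simp
  qed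
  have mid: "norm (w (d n t) - w (d n s)) \<le> y * q ^ n"
  proof -
    have "t * 2 ^ n - s * 2 ^ n \<le> (1/2) ^ n * 2 ^ n"
      using mult_right_mono[OF n2, of "2 ^ n"] by (simp add: algebra_simps)
    then have "t * 2 ^ n - s * 2 ^ n \<le> 1" by (simp add: power_mult_distrib[symmetric])
    moreover have "0 \<le> s * 2 ^ n" "s * 2 ^ n \<le> t * 2 ^ n" using st by auto
    ultimately consider "nat \<lfloor>t * 2 ^ n\<rfloor> = nat \<lfloor>s * 2 ^ n\<rfloor>" | "nat \<lfloor>t * 2 ^ n\<rfloor> = Suc (nat \<lfloor>s * 2 ^ n\<rfloor>)"
      by linarith
    then show ?thesis
    proof cases
      case 1
      then show ?thesis using y q by (simp add: d_def)
    next
      case 2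
      then have "nat \<lfloor>s * 2 ^ n\<rfloor> < 2 ^ n" using dyadic_approx(2)[of t n] st by linarith
      from inc[OF this] show ?thesis using 2 by (simp add: d_def q_def)
    qed
  qed
  have "norm (w t - w s) \<le> norm (w t - w (d n t)) + norm (w (d n t) - w (d n s)) + norm (w s - w (d n s))"
    using norm_triangle_ineq[of "w t - w (d n t)" "w (d n t) - w (d n s)"]
      norm_triangle_ineq4[of "w t - w (d n s)" "w s - w (d n s)"] by simp
  also have "\<dots> \<le> A * q ^ n + y * q ^ n + A * q ^ n"
    using st by (intro add_mono near mid) auto
  also have "\<dots> = (2 * q / (1 - q) + 1) * y * q ^ n" by (simp add: A_def algebra_simps add_divide_distrib)
  also have "\<dots> \<le> (2 * q / (1 - q) + 1) * y * (2 powr \<theta> * (t - s) powr \<theta>)"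
  proof (rule mult_left_mono)
    have "q ^ n = ((1/2) ^ n) powr \<theta>"
      unfolding q_def by (simp add: powr_minus powr_realpow[symmetric] powr_powr powr_divide power_one_over mult.commute field_simps)
    also have "\<dots> = (2 * (1/2) ^ Suc n) powr \<theta>" by simp
    also have "\<dots> \<le> (2 * (t - s)) powr \<theta>" using n1 \<theta> by (intro powr_mono2) auto
    also have "\<dots> = 2 powr \<theta> * (t - s) powr \<theta>" using st by (intro powr_mult)
    finally show "q ^ n \<le> 2 powr \<theta> * (t - s) powr \<theta>" .
    show "0 \<le> (2 * q / (1 - q) + 1) * y" using q y by simp
  qed
  finally show ?thesis by (simp add: q_def mult_ac)
qed simp

section \<open>Gaussian increments and exponential moments\<close>

lemma gaussian_rv_integrable:
  assumes "prob_space M" "gaussian_rv M Y"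
  shows "integrable M Y" "integrable M (\<lambda>\<omega>. (Y \<omega>)\<^sup>2)"
proof -
  interpret prob_space M by fact
  have Y: "Y \<in> borel_measurable M" using assms by (simp add: gaussian_rv_def)
  from assms(2) consider (normal) \<mu> \<sigma> where "\<sigma> > 0" "distributed M lborel Y (\<lambda>x. ennreal (normal_density \<mu> \<sigma> x))"
    | (const) c where "AE \<omega> in M. Y \<omega> = c" by (auto simp: gaussian_rv_def)
  then have "integrable M Y \<and> integrable M (\<lambda>\<omega>. (Y \<omega>)\<^sup>2)"
  proof cases
    case normal
    have iY: "integrable M Y"
      using normal by (intro distributed_integrable_var[OF normal(2)] integrable_normal_moment_nz_1) auto
    have "integrable M (\<lambda>\<omega>. (Y \<omega> - \<mu>)^2)"
      using distributed_integrable[OF normal(2), of "\<lambda>x. (x - \<mu>)^2"] integrable_normal_moment[OF normal(1), of \<mu> 2]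
      by simp
    then have "integrable M (\<lambda>\<omega>. (Y \<omega> - \<mu>)^2 + (2 * \<mu> * Y \<omega> - \<mu>^2))"
      using iY by (intro Bochner_Integration.integrable_add Bochner_Integration.integrable_diff
          integrable_mult_right) auto
    then show ?thesis using iY by (simp add: power2_diff algebra_simps)
  next
    case const
    have "integrable M Y \<longleftrightarrow> integrable M (\<lambda>\<omega>. c)" using const Y by (intro integrable_cong_AE) auto
    moreover have "integrable M (\<lambda>\<omega>. (Y \<omega>)\<^sup>2) \<longleftrightarrow> integrable M (\<lambda>\<omega>. c\<^sup>2)" using const Y
      by (intro integrable_cong_AE) auto
    ultimately show ?thesis by simp
  qed
  then show "integrable M Y" "integrable M (\<lambda>\<omega>. (Y \<omega>)\<^sup>2)" by auto
qed

text \<open>A positive second moment with mean zero excludes the constant alternative in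
  \<open>gaussian_rv\<close>; in the other one, mean and variance determine the parameters.\<close>

lemma gaussian_rv_centered:
  assumes M: "prob_space M" and Y: "gaussian_rv M Y" and mean: "(LINT \<omega>|M. Y \<omega>) = 0"
    and var: "(LINT \<omega>|M. (Y \<omega>)\<^sup>2) = v\<^sup>2" and v: "v > 0"
  shows "distributed M lborel Y (\<lambda>x. ennreal (normal_density 0 v x))"
proof -
  interpret prob_space M by fact
  have Y': "Y \<in> borel_measurable M" using Y by (simp add: gaussian_rv_def)
  from Y consider (normal) \<mu> \<sigma> where "\<sigma> > 0" "distributed M lborel Y (\<lambda>x. ennreal (normal_density \<mu> \<sigma> x))"
    | (const) c where "AE \<omega> in M. Y \<omega> = c" by (auto simp: gaussian_rv_def)
  then show ?thesis
  proof cases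
    case normal
    have "\<mu> = 0" using normal_distributed_expectation[OF normal] mean by simp
    moreover have "\<sigma>\<^sup>2 = v\<^sup>2" using normal_distributed_variance[OF normal] mean var by simp
    then have "\<sigma> = v" using v normal(1) by (simp add: power2_eq_iff_nonneg)
    ultimately show ?thesis using normal by simp
  next
    case const
    have "(LINT \<omega>|M. Y \<omega>) = (LINT \<omega>|M. c)" using const Y' by (intro integral_cong_AE) auto
    then have "c = 0" using mean by (simp add: prob_space)
    have "(LINT \<omega>|M. (Y \<omega>)\<^sup>2) = (LINT \<omega>|M. c\<^sup>2)" using const Y' by (intro integral_cong_AE) auto
    then show ?thesis using var v \<open>c = 0\<close> by simp
  qed
qed

text \<open>When the square of the increment is expanded, the powers of s and t in the covariances
  cancel and only (t - s)^(2H) remains.\<close>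

lemma fBm_increment_normal:
  fixes W :: "real \<Rightarrow> 'w \<Rightarrow> real ^ 'm::finite"
  assumes M: "prob_space M" and W: "fractional_brownian_motion M T H W" and H: "H > 0"
    and st: "s \<in> {0..T}" "t \<in> {0..T}" "s < t"
  shows "distributed M lborel (\<lambda>\<omega>. W t \<omega> $ j - W s \<omega> $ j)
           (\<lambda>x. ennreal (normal_density 0 ((t - s) powr H) x))"
proof -
  interpret prob_space M by fact
  note fbm = W[unfolded fractional_brownian_motion_def]
  have G: "gaussian_process M {0..T} W" using fbm by blast
  have lin: "gaussian_rv M (\<lambda>\<omega>. \<Sum>k<n. a k \<bullet> W (\<tau> k) \<omega>)" if "\<forall>k<n. \<tau> k \<in> {0..T}" for n :: nat and \<tau> a
    using G that unfolding gaussian_process_def by blast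
  have one: "gaussian_rv M (\<lambda>\<omega>. W u \<omega> $ j)" if "u \<in> {0..T}" for u
    using lin[of 1 "\<lambda>_. u" "\<lambda>_. axis j 1"] that by (simp add: inner_axis')
  have two: "gaussian_rv M (\<lambda>\<omega>. W t \<omega> $ j - W s \<omega> $ j)"
    using lin[of 2 "\<lambda>k. if k = 0 then t else s" "\<lambda>k. if k = 0 then axis j 1 else - axis j 1"] st
    by (simp add: inner_axis' numeral_2_eq_2)
  note i = gaussian_rv_integrable[OF M one]
  have mean: "(LINT \<omega>|M. W u \<omega> $ j) = 0" if "u \<in> {0..T}" for u using fbm that by blast
  have cov: "(LINT \<omega>|M. W u \<omega> $ j * W v \<omega> $ j) = 1/2 * (u powr (2*H) + v powr (2*H) - \<bar>u - v\<bar> powr (2*H))"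
    if "u \<in> {0..T}" "v \<in> {0..T}" for u v
  proof -
    have "(LINT \<omega>|M. W u \<omega> $ j * W v \<omega> $ j) =
          (if j = j then 1/2 * (u powr (2*H) + v powr (2*H) - \<bar>u - v\<bar> powr (2*H)) else 0)"
      using fbm that by blast
    then show ?thesis by simp
  qed
  have i2: "integrable M (\<lambda>\<omega>. (W t \<omega> $ j - W s \<omega> $ j)\<^sup>2)" by (rule gaussian_rv_integrable(2)[OF M two])
  \<comment> \<open>Polarisation: the product is half of a combination of squares of Gaussian
    variables, so joint Gaussianity of the two values gives its integrability.\<close>
  have ip: "integrable M (\<lambda>\<omega>. W t \<omega> $ j * W s \<omega> $ j)"
  proof -
    have "integrable M (\<lambda>\<omega>. ((W t \<omega> $ j)\<^sup>2 + (W s \<omega> $ j)\<^sup>2 - (W t \<omega> $ j - W s \<omega> $ j)\<^sup>2) / 2)"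
      using i(2) st i2 by (intro integrable_divide_zero Bochner_Integration.integrable_diff
        Bochner_Integration.integrable_add) auto
    then show ?thesis by (simp add: power2_diff)
  qed
  have "(LINT \<omega>|M. (W t \<omega> $ j - W s \<omega> $ j)\<^sup>2) =
      (LINT \<omega>|M. (W t \<omega> $ j)\<^sup>2 + (W s \<omega> $ j)\<^sup>2 - 2 * (W t \<omega> $ j * W s \<omega> $ j))"
    by (simp add: power2_diff mult.assoc)
  also have "\<dots> = (LINT \<omega>|M. (W t \<omega> $ j)\<^sup>2) + (LINT \<omega>|M. (W s \<omega> $ j)\<^sup>2) - 2 * (LINT \<omega>|M. W t \<omega> $ j * W s \<omega> $ j)"
    using i(2) st ip by (simp add: Bochner_Integration.integral_diff Bochner_Integration.integral_add)
  also have "\<dots> = (t - s) powr (2 * H)"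
    using cov[of t t] cov[of s s] cov[of t s] st by (simp add: power2_eq_square algebra_simps)
  also have "\<dots> = ((t - s) powr H)\<^sup>2" using st by (simp add: powr_power mult.commute)
  finally have var: "(LINT \<omega>|M. (W t \<omega> $ j - W s \<omega> $ j)\<^sup>2) = ((t - s) powr H)\<^sup>2" .
  have "(LINT \<omega>|M. W t \<omega> $ j - W s \<omega> $ j) = 0"
    using i(1) st mean by (simp add: Bochner_Integration.integral_diff)
  from gaussian_rv_centered[OF M two this var] show ?thesis using st by simp
qed

text \<open>The exponents combine to -x^2/4, which is, up to the factor sqrt 2, the density of the
  centered normal law of variance 2.\<close>

lemma std_normal_exp_square:
  "(\<integral>\<^sup>+x. ennreal (std_normal_density x) * ennreal (exp (x\<^sup>2 / 4)) \<partial>lborel) = ennreal (sqrt 2)"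
proof -
  have "ennreal (std_normal_density x) * ennreal (exp (x\<^sup>2 / 4)) =
      ennreal (sqrt 2) * ennreal (normal_density 0 (sqrt 2) x)" for x
  proof -
    have "std_normal_density x * exp (x\<^sup>2 / 4) = sqrt 2 * normal_density 0 (sqrt 2) x"
      by (simp add: normal_density_def real_sqrt_mult exp_add[symmetric] field_simps)
    then show ?thesis by (simp add: ennreal_mult[symmetric])
  qed
  then have "(\<integral>\<^sup>+x. ennreal (std_normal_density x) * ennreal (exp (x\<^sup>2 / 4)) \<partial>lborel) =
      ennreal (sqrt 2) * (\<integral>\<^sup>+x. ennreal (normal_density 0 (sqrt 2) x) \<partial>lborel)"
    by (simp add: nn_integral_cmult)
  also have "(\<integral>\<^sup>+x. ennreal (normal_density 0 (sqrt 2) x) \<partial>lborel) = 1"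
    by (subst nn_integral_eq_integral) auto
  finally show ?thesis by simp
qed

text \<open>Here the restriction to exponents below 2 enters: the power of order \<kappa> in the
  exponent is negligible against x^2/4.\<close>

lemma subgaussian_bound:
  fixes r C c \<kappa> :: real
  assumes "r > 0" "C \<ge> 0" "c > 0" "0 < \<kappa>" "\<kappa> < 2"
  obtains Q where "Q > 0" "\<And>x. x \<ge> 0 \<Longrightarrow> x powr r * exp (c * (1 + C * x) powr \<kappa>) \<le> Q * exp (x\<^sup>2 / 4)"
proof -
  let ?f = "\<lambda>C x. x powr r * exp (c * (1 + C * x) powr \<kappa>)"
  \<comment> \<open>C may vanish; the positive slope C + 1 fixes the asymptotics, and monotonicity
    leads back to C.\<close>
  have "((\<lambda>x. ?f (C + 1) x / exp (x\<^sup>2 / 4)) \<longlongrightarrow> 0) at_top"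
    using assms by real_asymp
  then have "\<forall>\<^sub>F x in at_top. ?f (C + 1) x / exp (x\<^sup>2 / 4) < 1" by (rule order_tendstoD) simp
  then obtain x0 where x0: "\<And>x. x \<ge> x0 \<Longrightarrow> ?f (C + 1) x / exp (x\<^sup>2 / 4) < 1"
    unfolding eventually_at_top_linorder by blast
  define x1 where "x1 = max x0 1"
  have mono: "?f C x \<le> ?f (C + 1) y" if "0 \<le> x" "x \<le> y" for x y
    using that assms by (intro mult_mono powr_mono2 mult_left_mono add_left_mono iffD2[OF exp_le_cancel_iff]) auto
  show ?thesis
  proof (rule that)
    show "?f (C + 1) x1 + 1 > 0" by (intro add_nonneg_pos) auto
    fix x :: real assume x: "x \<ge> 0"
    have Q: "1 \<le> ?f (C + 1) x1 + 1" by simp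
    show "?f C x \<le> (?f (C + 1) x1 + 1) * exp (x\<^sup>2 / 4)"
    proof (cases "x \<le> x1")
      case True
      have "?f C x \<le> (?f (C + 1) x1 + 1) * 1" using mono[OF x True] by simp
      also have "\<dots> \<le> (?f (C + 1) x1 + 1) * exp (x\<^sup>2 / 4)" using Q by (intro mult_left_mono) auto
      finally show ?thesis .
    next
      case False
      then have "x \<ge> x0" by (simp add: x1_def)
      then have "?f (C + 1) x \<le> 1 * exp (x\<^sup>2 / 4)" using x0[of x] by simp
      also have "\<dots> \<le> (?f (C + 1) x1 + 1) * exp (x\<^sup>2 / 4)" using Q by (intro mult_right_mono) auto
      finally show ?thesis using mono[OF x order_refl] by linarith
    qed
  qed
qed

text \<open>After standardising Y the bound is the moment in \<open>std_normal_exp_square\<close>. A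
  is kept apart from Q: in the application it carries the decay in the dyadic level, while Q is the
  same for all levels.\<close>

lemma normal_scaled_moment:
  assumes M: "prob_space M" and Y: "distributed M lborel Y (\<lambda>x. ennreal (normal_density 0 v x))"
    and v: "v > 0" and a: "a \<ge> 0" and Q: "Q > 0"
    and f: "\<And>x. f (a * \<bar>x\<bar>) \<le> A * (Q * exp (x\<^sup>2 / 4))" and A: "A \<ge> 0"
  shows "(\<integral>\<^sup>+\<omega>. ennreal (f (a * \<bar>Y \<omega>\<bar> / v)) \<partial>M) \<le> ennreal (A * Q * sqrt 2)"
proof -
  interpret prob_space M by fact
  have Y': "Y \<in> borel_measurable M" using distributed_measurable[OF Y] by simp
  let ?\<xi> = "\<lambda>\<omega>. (Y \<omega> - 0) / v"
  have \<xi>: "distributed M lborel ?\<xi> std_normal_density"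
    using Y normal_standard_normal_convert[OF v, of Y 0] by simp
  have "(\<integral>\<^sup>+\<omega>. ennreal (f (a * \<bar>Y \<omega>\<bar> / v)) \<partial>M) \<le> (\<integral>\<^sup>+\<omega>. ennreal (A * Q) * ennreal (exp ((?\<xi> \<omega>)\<^sup>2 / 4)) \<partial>M)"
  proof (rule nn_integral_mono)
    fix \<omega>
    have eq: "a * \<bar>?\<xi> \<omega>\<bar> = a * \<bar>Y \<omega>\<bar> / v" using v by (simp add: abs_divide abs_of_pos)
    have "f (a * \<bar>Y \<omega>\<bar> / v) \<le> A * (Q * exp ((?\<xi> \<omega>)\<^sup>2 / 4))"
      using f[of "?\<xi> \<omega>"] by (simp only: eq)
    then show "ennreal (f (a * \<bar>Y \<omega>\<bar> / v)) \<le> ennreal (A * Q) * ennreal (exp ((?\<xi> \<omega>)\<^sup>2 / 4))"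
      using A Q by (simp add: ennreal_mult[symmetric] mult.assoc ennreal_leI)
  qed
  also have "\<dots> = ennreal (A * Q) * (\<integral>\<^sup>+\<omega>. ennreal (exp ((?\<xi> \<omega>)\<^sup>2 / 4)) \<partial>M)"
    using Y' by (subst nn_integral_cmult) auto
  also have "(\<integral>\<^sup>+\<omega>. ennreal (exp ((?\<xi> \<omega>)\<^sup>2 / 4)) \<partial>M) = ennreal (sqrt 2)"
    using distributed_nn_integral[OF \<xi>, of "\<lambda>x. ennreal (exp (x\<^sup>2 / 4))"] std_normal_exp_square by simp
  also have "ennreal (A * Q) * ennreal (sqrt 2) = ennreal (A * Q * sqrt 2)"
    using A Q by (intro ennreal_mult[symmetric]) auto
  finally show ?thesis .
qed

text \<open>The factor \<open>y powr r\<close> makes the sum over all dyadic increments converge and is at least 1 when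
  \<open>y \<ge> 1\<close>; so the sum controls the exponential of the largest normalised increment.\<close>

lemma fBm_holder_exp_moment:
  fixes W :: "real \<Rightarrow> 'w \<Rightarrow> real ^ 'm::finite"
  assumes M: "prob_space M" and W: "fractional_brownian_motion M T H W" and T: "T > 0"
    and \<theta>: "0 < \<theta>" "\<theta> < H" and \<kappa>: "0 < \<kappa>" "\<kappa> < 2" and c: "c > 0"
  obtains Z :: "'w \<Rightarrow> ennreal" where "Z \<in> borel_measurable M" "(\<integral>\<^sup>+\<omega>. Z \<omega> \<partial>M) < \<infinity>"
    "AE \<omega> in M. \<exists>G\<ge>0.
       (\<forall>u v. 0 \<le> u \<longrightarrow> u \<le> v \<longrightarrow> v \<le> T \<longrightarrow> norm (W v \<omega> - W u \<omega>) \<le> G * (v - u) powr \<theta>) \<and>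
       ennreal (exp (c * (1 + G) powr \<kappa>)) \<le> Z \<omega>"
proof -
  interpret prob_space M by fact
  have H: "H > 0" using \<theta> by simp
  define q where "q = (2::real) powr - \<theta>"
  have q: "0 < q" "q < 1" unfolding q_def using \<theta> powr_less_mono[of "- \<theta>" 0 "2::real"] by auto
  define C0 where "C0 = 2 powr \<theta> * (2 * q / (1 - q) + 1)"
  have C0: "C0 > 0" unfolding C0_def using q by (intro mult_pos_pos add_nonneg_pos) auto
  \<comment> \<open>\<open>C0\<close> comes from chaining, the number of components from bounding
    the norm by the sum of coordinates, and the power of T from rescaling [0,T] to [0,1].\<close>
  define C where "C = C0 * real CARD('m) * T powr - \<theta>"
  have C: "C > 0" unfolding C_def using C0 T by simp
  define \<psi> where "\<psi> = (\<lambda>y. exp (c * (1 + C * y) powr \<kappa>))"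
  \<comment> \<open>Level n has 2^n increments, each with normalised size of order 2^(-(H -
    \<theta>) n). This r turns that size into 4^(-n), so that level n contributes of order
    2^(-n).\<close>
  define r where "r = 2 / (H - \<theta>)"
  have r: "r > 0" unfolding r_def using \<theta> by simp
  define \<Delta> where "\<Delta> = (\<lambda>n i j \<omega>. W (T * real (Suc i) / 2 ^ n) \<omega> $ j - W (T * real i / 2 ^ n) \<omega> $ j)"
  define Y where "Y = (\<lambda>n i j \<omega>. \<bar>\<Delta> n i j \<omega>\<bar> / q ^ n)"
  define F where "F = (\<lambda>y. y powr r * \<psi> y)"
  \<comment> \<open>The summand \<open>ennreal (\<psi> 1)\<close> gives control when all normalised
    increments are below 1, where the factor \<open>y powr r\<close> is of no help.\<close>
  define Z where "Z = (\<lambda>\<omega>. ennreal (\<psi> 1) + (\<Sum>n. \<Sum>i<2^n. \<Sum>j\<in>UNIV. ennreal (F (Y n i j \<omega>))))"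
  have \<Delta>: "distributed M lborel (\<Delta> n i j) (\<lambda>x. ennreal (normal_density 0 ((T / 2 ^ n) powr H) x))"
    if "i < 2 ^ n" for n i j
  proof -
    have "real (Suc i) \<le> real (2 ^ n)" using that by (intro of_nat_mono) simp
    then have i: "real i + 1 \<le> 2 ^ n" by simp
    have "T * real (Suc i) / 2 ^ n \<le> T" using i T by (simp add: divide_le_eq)
    moreover have lt: "T * real i / 2 ^ n < T * real (Suc i) / 2 ^ n"
      using T by (intro divide_strict_right_mono mult_strict_left_mono) auto
    ultimately have mem: "T * real i / 2 ^ n \<in> {0..T}" "T * real (Suc i) / 2 ^ n \<in> {0..T}" using T by auto
    have "T * real (Suc i) / 2 ^ n - T * real i / 2 ^ n = T / 2 ^ n" by (simp add: field_simps)
    then show ?thesis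
      unfolding \<Delta>_def using fBm_increment_normal[OF M W H mem lt, of j] by simp
  qed
  have \<Delta>_meas: "\<Delta> n i j \<in> borel_measurable M" if "i < 2 ^ n" for n i j
    using distributed_measurable[OF \<Delta>[OF that]] by simp
  have F_meas: "F \<in> borel_measurable borel" unfolding F_def \<psi>_def by measurable
  have term_meas: "(\<lambda>\<omega>. ennreal (F (Y n i j \<omega>))) \<in> borel_measurable M" if "i < 2 ^ n" for n i j
    unfolding Y_def using \<Delta>_meas[OF that] F_meas by measurable
  have sum_meas: "(\<lambda>\<omega>. \<Sum>i<2^n. \<Sum>j\<in>UNIV. ennreal (F (Y n i j \<omega>))) \<in> borel_measurable M" for n
    using term_meas by (intro borel_measurable_sum) auto
  have Z_meas: "Z \<in> borel_measurable M"
    unfolding Z_def using sum_meas by (intro borel_measurable_add borel_measurable_suminf) auto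
  obtain Q where Q: "Q > 0" and Qb:
    "\<And>x. x \<ge> 0 \<Longrightarrow> x powr r * exp (c * (1 + (C * T powr H) * x) powr \<kappa>) \<le> Q * exp (x\<^sup>2 / 4)"
    using subgaussian_bound[OF r _ c \<kappa>, of "C * T powr H"] C by auto
  define p where "p = (2::real) powr (- (H - \<theta>))"
  have p: "0 < p" "p < 1" unfolding p_def using \<theta> powr_less_mono[of "- (H - \<theta>)" 0 "2::real"] by auto
  have pr: "p powr r = 1 / 4"
  proof -
    have "- (H - \<theta>) * r = - 2" unfolding r_def using \<theta> by (simp add: field_simps)
    then have "p powr r = 2 powr (- 2)" unfolding p_def powr_powr by simp
    then show ?thesis by (simp add: powr_minus)
  qed
  define R where "R = (T powr H) powr r * Q * sqrt 2"
  have R: "R \<ge> 0" unfolding R_def using Q by simp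
  have moment: "(\<integral>\<^sup>+\<omega>. ennreal (F (Y n i j \<omega>)) \<partial>M) \<le> ennreal (R * (1 / 4) ^ n)" if "i < 2 ^ n" for n i j
  proof -
    define v where "v = (T / 2 ^ n) powr H"
    define a where "a = T powr H * p ^ n"
    have v: "v > 0" unfolding v_def using T by simp
    have a: "a \<ge> 0" unfolding a_def using p by simp
    \<comment> \<open>The standard deviation of a level-n increment is (T 2^-n)^H; normalising by
      q^n = 2^(-\<theta> n) leaves the decaying factor p^n.\<close>
    have va: "v / q ^ n = a"
    proof -
      have "v = T powr H * (2 powr - H) ^ n"
        unfolding v_def using T by (simp add: powr_divide powr_minus powr_realpow[symmetric] powr_powr mult.commute field_simps)
      moreover have "(2::real) powr - H = p * q" unfolding p_def q_def by (simp add: powr_add[symmetric])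
      ultimately show ?thesis using q by (simp add: a_def power_mult_distrib)
    qed
    have "Y n i j \<omega> = a * \<bar>\<Delta> n i j \<omega>\<bar> / v" for \<omega>
      unfolding Y_def va[symmetric] using v by simp
    moreover have "(\<integral>\<^sup>+\<omega>. ennreal (F (a * \<bar>\<Delta> n i j \<omega>\<bar> / v)) \<partial>M) \<le> ennreal (a powr r * Q * sqrt 2)"
    proof (rule normal_scaled_moment[OF M \<Delta>[OF that, of j, folded v_def] v a Q])
      fix x :: real
      have "C * a \<le> C * T powr H"
        unfolding a_def using C p by (intro mult_left_mono mult_left_le power_le_one) auto
      then have "C * a * \<bar>x\<bar> \<le> C * T powr H * \<bar>x\<bar>" by (rule mult_right_mono) simp
      then have "C * (a * \<bar>x\<bar>) \<le> C * T powr H * \<bar>x\<bar>" by (simp only: mult.assoc)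
      then have "\<psi> (a * \<bar>x\<bar>) \<le> exp (c * (1 + (C * T powr H) * \<bar>x\<bar>) powr \<kappa>)"
        unfolding \<psi>_def using c \<kappa> C a
        by (intro iffD2[OF exp_le_cancel_iff] mult_left_mono powr_mono2) auto
      then have "F (a * \<bar>x\<bar>) \<le> a powr r * (\<bar>x\<bar> powr r * exp (c * (1 + (C * T powr H) * \<bar>x\<bar>) powr \<kappa>))"
        unfolding F_def using a by (simp add: powr_mult mult.assoc mult_left_mono)
      also have "\<dots> \<le> a powr r * (Q * exp (\<bar>x\<bar>\<^sup>2 / 4))" by (intro mult_left_mono Qb) auto
      finally show "F (a * \<bar>x\<bar>) \<le> a powr r * (Q * exp (x\<^sup>2 / 4))" by simp
    qed simp
    moreover have "a powr r = (T powr H) powr r * (1 / 4) ^ n"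
    proof -
      have "(p ^ n) powr r = (p powr r) ^ n"
        using p by (simp add: powr_realpow[symmetric] powr_powr mult.commute)
      then show ?thesis unfolding a_def using p pr by (simp add: powr_mult)
    qed
    ultimately show ?thesis by (simp add: R_def mult_ac)
  qed
  have "(\<integral>\<^sup>+\<omega>. Z \<omega> \<partial>M) = ennreal (\<psi> 1) + (\<Sum>n. \<Sum>i<2^n. \<Sum>j\<in>UNIV. (\<integral>\<^sup>+\<omega>. ennreal (F (Y n i j \<omega>)) \<partial>M))"
  proof -
    have "(\<integral>\<^sup>+\<omega>. Z \<omega> \<partial>M) = (\<integral>\<^sup>+\<omega>. ennreal (\<psi> 1) \<partial>M) + (\<integral>\<^sup>+\<omega>. (\<Sum>n. \<Sum>i<2^n. \<Sum>j\<in>UNIV. ennreal (F (Y n i j \<omega>))) \<partial>M)"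
      unfolding Z_def using sum_meas by (intro nn_integral_add borel_measurable_suminf) auto
    also have "(\<integral>\<^sup>+\<omega>. ennreal (\<psi> 1) \<partial>M) = ennreal (\<psi> 1)" by (simp add: emeasure_space_1)
    also have "(\<integral>\<^sup>+\<omega>. (\<Sum>n. \<Sum>i<2^n. \<Sum>j\<in>UNIV. ennreal (F (Y n i j \<omega>))) \<partial>M) =
        (\<Sum>n. \<integral>\<^sup>+\<omega>. (\<Sum>i<2^n. \<Sum>j\<in>UNIV. ennreal (F (Y n i j \<omega>))) \<partial>M)"
      using sum_meas by (intro nn_integral_suminf)
    also have "\<dots> = (\<Sum>n. \<Sum>i<2^n. \<Sum>j\<in>UNIV. (\<integral>\<^sup>+\<omega>. ennreal (F (Y n i j \<omega>)) \<partial>M))"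
      using term_meas by (intro suminf_cong) (subst nn_integral_sum; (intro sum.cong refl nn_integral_sum borel_measurable_sum)?; auto)+
    finally show ?thesis .
  qed
  also have "\<dots> \<le> ennreal (\<psi> 1) + (\<Sum>n. ennreal (real CARD('m) * R * (1 / 2) ^ n))"
  proof (intro add_left_mono suminf_le allI)
    fix n
    have "(\<Sum>i<2^n. \<Sum>j\<in>(UNIV::'m set). (\<integral>\<^sup>+\<omega>. ennreal (F (Y n i j \<omega>)) \<partial>M)) \<le>
        (\<Sum>i<(2::nat)^n. \<Sum>j\<in>(UNIV::'m set). ennreal (R * (1 / 4) ^ n))"
      using moment by (intro sum_mono) auto
    also have "\<dots> = ennreal (real (2 ^ n) * (real CARD('m) * (R * (1 / 4) ^ n)))"
      using R by (simp add: ennreal_mult ennreal_of_nat_eq_real_of_nat[symmetric] ennreal_power[of 2 n, symmetric])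
    also have "real (2 ^ n) * (real CARD('m) * (R * (1 / 4) ^ n)) = real CARD('m) * R * (1 / 2) ^ n"
      by (simp add: power_divide field_simps flip: power_mult_distrib)
    finally show "(\<Sum>i<2^n. \<Sum>j\<in>(UNIV::'m set). (\<integral>\<^sup>+\<omega>. ennreal (F (Y n i j \<omega>)) \<partial>M)) \<le>
       ennreal (real CARD('m) * R * (1 / 2) ^ n)" .
  qed auto
  also have "\<dots> < \<infinity>"
  proof -
    have "summable (\<lambda>n. real CARD('m) * R * (1 / 2) ^ n)" by (intro summable_mult summable_geometric) auto
    then have "(\<Sum>n. ennreal (real CARD('m) * R * (1 / 2) ^ n)) = ennreal (\<Sum>n. real CARD('m) * R * (1 / 2) ^ n)"
      using R by (intro suminf_ennreal2) auto
    then show ?thesis by simp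
  qed
  finally have Z_int: "(\<integral>\<^sup>+\<omega>. Z \<omega> \<partial>M) < \<infinity>" .
  then have fin: "AE \<omega> in M. Z \<omega> \<noteq> \<infinity>" using Z_meas by (intro nn_integral_noteq_infinite) auto
  have cont: "AE \<omega> in M. continuous_on {0..T} (\<lambda>t. W t \<omega>)"
    using W unfolding fractional_brownian_motion_def by blast
  show ?thesis
  proof (rule that[OF Z_meas Z_int])
    show "AE \<omega> in M. \<exists>G\<ge>0.
       (\<forall>u v. 0 \<le> u \<longrightarrow> u \<le> v \<longrightarrow> v \<le> T \<longrightarrow> norm (W v \<omega> - W u \<omega>) \<le> G * (v - u) powr \<theta>) \<and>
       ennreal (exp (c * (1 + G) powr \<kappa>)) \<le> Z \<omega>"
      using fin cont
    proof eventually_elim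
      case (elim \<omega>)
      define z where "z = enn2real (Z \<omega>)"
      have Zz: "Z \<omega> = ennreal z" using elim(1) by (simp add: z_def less_top)
      have z0: "z \<ge> 0" by (simp add: z_def)
      have "ennreal (\<psi> 1) \<le> ennreal z" unfolding Zz[symmetric] Z_def by simp
      then have z1: "\<psi> 1 \<le> z" using z0 by simp
      have zpos: "z > 0" using z1 by (rule less_le_trans[rotated]) (simp add: \<psi>_def)
      \<comment> \<open>The Hoelder constant is read off from Z: x solves
        \<open>exp (c * x powr \<kappa>) = z\<close>, and G = x - 1, so the exponential bound holds
        with equality.\<close>
      define x where "x = (ln z / c) powr (1 / \<kappa>)"
      have \<psi>_le: "1 + C * y \<le> x" if "\<psi> y \<le> z" "y \<ge> 0" for y
      proof -
        have "c * (1 + C * y) powr \<kappa> \<le> ln z"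
          using that(1) zpos unfolding \<psi>_def by (simp add: ln_ge_iff)
        then have "(1 + C * y) powr \<kappa> \<le> ln z / c" using c by (simp add: field_simps)
        then have "((1 + C * y) powr \<kappa>) powr (1 / \<kappa>) \<le> x"
          unfolding x_def using \<kappa> by (intro powr_mono2) auto
        then show ?thesis using \<kappa> C that by (simp add: powr_powr)
      qed
      have x1: "1 + C \<le> x" using \<psi>_le[OF z1] by simp
      have exz: "exp (c * x powr \<kappa>) = z"
      proof -
        have "(1 :: real) \<le> \<psi> 1" unfolding \<psi>_def using c C by simp
        then have "ln z \<ge> 0" using z1 by simp
        then have "x powr \<kappa> = ln z / c" unfolding x_def using \<kappa> c by (simp add: powr_powr)
        then show ?thesis using c zpos by simp
      qed
      define y where "y = (x - 1) / C"
      have y1: "y \<ge> 1" unfolding y_def using x1 C by (simp add: field_simps)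
      have Cy: "C * y = x - 1" unfolding y_def using C by simp
      \<comment> \<open>An increment above 1 satisfies \<psi> \<le> F \<le> Z; inverting \<psi>
        bounds it by y. Those below 1 are covered by \<open>y \<ge> 1\<close>.\<close>
      have Y_le: "Y n i j \<omega> \<le> y" if "i < 2 ^ n" for n i j
      proof (cases "Y n i j \<omega> \<le> 1")
        case False
        then have Y1: "Y n i j \<omega> \<ge> 1" by simp
        have "ennreal (F (Y n i j \<omega>)) \<le> (\<Sum>j\<in>UNIV. ennreal (F (Y n i j \<omega>)))"
          by (rule member_le_sum) auto
        also have "\<dots> \<le> (\<Sum>i<2^n. \<Sum>j\<in>UNIV. ennreal (F (Y n i j \<omega>)))"
          using that by (intro member_le_sum[of i "{..<2^n}" "\<lambda>i. \<Sum>j\<in>UNIV. ennreal (F (Y n i j \<omega>))"]) auto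
        also have "\<dots> \<le> (\<Sum>n. \<Sum>i<2^n. \<Sum>j\<in>UNIV. ennreal (F (Y n i j \<omega>)))"
          using sum_le_suminf[of "\<lambda>n. \<Sum>i<2^n. \<Sum>j\<in>UNIV. ennreal (F (Y n i j \<omega>))" "{n}"] by simp
        also have "\<dots> \<le> Z \<omega>" unfolding Z_def by simp
        finally have "F (Y n i j \<omega>) \<le> z" unfolding Zz using z0 by simp
        moreover have "\<psi> (Y n i j \<omega>) \<le> F (Y n i j \<omega>)"
          unfolding F_def using ge_one_powr_ge_zero[OF Y1, of r] r by (simp add: \<psi>_def)
        ultimately have "1 + C * Y n i j \<omega> \<le> x" using Y1 by (intro \<psi>_le) auto
        then have "C * Y n i j \<omega> \<le> C * y" using Cy by simp
        then show ?thesis using C by simp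
      qed (use y1 in simp)
      have chain: "norm (W (T * t) \<omega> - W (T * s) \<omega>) \<le> C0 * (real CARD('m) * y) * (t - s) powr \<theta>"
        if st: "0 \<le> s" "s \<le> t" "t \<le> 1" for s t
        unfolding C0_def q_def
      proof (rule dyadic_chaining[OF _ \<theta>(1) _ _ st, of "\<lambda>u. W (T * u) \<omega>"])
        show "continuous_on {0..1} (\<lambda>u. W (T * u) \<omega>)"
          using T by (intro continuous_on_compose2[OF elim(2)] continuous_intros) (auto simp: mult_left_le)
        show "0 \<le> real CARD('m) * y" using y1 by simp
        fix n i :: nat assume i: "i < 2 ^ n"
        have "norm (W (T * (real (Suc i) / 2 ^ n)) \<omega> - W (T * (real i / 2 ^ n)) \<omega>) \<le>
            (\<Sum>j\<in>UNIV. \<bar>\<Delta> n i j \<omega>\<bar>)"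
          using norm_le_l1_cart[of "W (T * (real (Suc i) / 2 ^ n)) \<omega> - W (T * (real i / 2 ^ n)) \<omega>"]
          by (simp add: \<Delta>_def)
        also have "\<dots> \<le> (\<Sum>j\<in>(UNIV::'m set). y * q ^ n)"
        proof (rule sum_mono)
          fix j :: 'm
          show "\<bar>\<Delta> n i j \<omega>\<bar> \<le> y * q ^ n" using Y_le[OF i, of j] q by (simp add: Y_def divide_le_eq)
        qed
        finally show "norm (W (T * (real (Suc i) / 2 ^ n)) \<omega> - W (T * (real i / 2 ^ n)) \<omega>) \<le>
            real CARD('m) * y * (2 powr - \<theta>) ^ n" by (simp add: q_def mult.assoc)
      qed
      show ?case
      proof (intro exI[of _ "x - 1"] conjI allI impI)
        show "0 \<le> x - 1" using x1 C by simp
        show "ennreal (exp (c * (1 + (x - 1)) powr \<kappa>)) \<le> Z \<omega>" using exz Zz by simp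
        fix u v assume uv: "0 \<le> u" "u \<le> v" "v \<le> T"
        have "norm (W (T * (v / T)) \<omega> - W (T * (u / T)) \<omega>) \<le> C0 * (real CARD('m) * y) * (v / T - u / T) powr \<theta>"
          using uv T by (intro chain) (auto simp: divide_right_mono)
        also have "(v / T - u / T) powr \<theta> = T powr - \<theta> * (v - u) powr \<theta>"
          using uv T by (simp add: diff_divide_distrib[symmetric] powr_divide powr_minus field_simps)
        also have "C0 * (real CARD('m) * y) * (T powr - \<theta> * (v - u) powr \<theta>) = C * y * (v - u) powr \<theta>"
          by (simp add: C_def mult_ac)
        finally show "norm (W v \<omega> - W u \<omega>) \<le> (x - 1) * (v - u) powr \<theta>" using T Cy by simp
      qed
    qed
  qed
qed

section \<open>Moments of the supremum\<close>

lemma sup_path_bounds: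
  assumes T: "T > 0" and b: "\<And>t. t \<in> {0..T} \<Longrightarrow> norm (X t \<omega>) \<le> b"
  shows "0 \<le> sup_path T X \<omega>" "sup_path T X \<omega> \<le> b"
proof -
  have "bdd_above ((\<lambda>t. norm (X t \<omega>)) ` {0..T})" using b by (intro bdd_aboveI2) auto
  then have "norm (X 0 \<omega>) \<le> sup_path T X \<omega>"
    unfolding sup_path_def using T by (intro cSUP_upper) auto
  then show "0 \<le> sup_path T X \<omega>" using norm_ge_zero order_trans by blast
  show "sup_path T X \<omega> \<le> b" unfolding sup_path_def using T b by (intro cSUP_least) auto
qed

text \<open>Measurability is asked of the majorants only, because the supremum over a continuum of
  times is merely almost everywhere equal to a measurable function.\<close>

lemma expect_nn_dominated:
  assumes "u \<in> borel_measurable M" "Z \<in> borel_measurable M"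
    and "expect_nn M u < \<infinity>" "(\<integral>\<^sup>+\<omega>. Z \<omega> \<partial>M) < \<infinity>"
    and "AE \<omega> in M. ennreal (Y \<omega>) \<le> ennreal (u \<omega>) + Z \<omega>"
  shows "expect_nn M Y < \<infinity>"
proof -
  have "expect_nn M Y \<le> (\<integral>\<^sup>+\<omega>. ennreal (u \<omega>) + Z \<omega> \<partial>M)"
    unfolding expect_nn_def by (rule nn_integral_mono_AE[OF assms(5)])
  also have "\<dots> = expect_nn M u + (\<integral>\<^sup>+\<omega>. Z \<omega> \<partial>M)"
    unfolding expect_nn_def using assms by (intro nn_integral_add) auto
  also have "\<dots> < \<infinity>" using assms(3,4) by simp
  finally show ?thesis .
qed

lemma add_powr_le:
  fixes x y p :: real
  assumes "x \<ge> 0" "y \<ge> 0" "p \<ge> 0"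
  shows "(x + y) powr p \<le> 2 powr p * (x powr p + y powr p)"
proof -
  have "(x + y) powr p \<le> (2 * max x y) powr p" using assms by (intro powr_mono2) auto
  also have "\<dots> = 2 powr p * max x y powr p" using assms by (intro powr_mult)
  also have "\<dots> \<le> 2 powr p * (x powr p + y powr p)"
    by (intro mult_left_mono) (auto simp: max_def)
  finally show ?thesis .
qed

text \<open>Separates the initial value from the noise: the two may be dependent, so the expectation
  of their product cannot be factored.\<close>

lemma mult_le_add_squares:
  fixes x y :: real
  assumes "x \<ge> 0" "y \<ge> 0"
  shows "x * y \<le> x\<^sup>2 + y\<^sup>2"
  using sum_squares_bound[of x y] mult_nonneg_nonneg[OF assms] by linarith

lemma sup_moment_finite:
  fixes W :: "real \<Rightarrow> 'w \<Rightarrow> real ^ 'm::finite" and X0 :: "'w \<Rightarrow> real ^ 'd::finite"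
  assumes M: "prob_space M" and T: "T > 0" and H: "1/2 < H"
    and \<alpha>: "1 - H < \<alpha>" "\<alpha> < 1/2" "\<alpha> < \<beta>" and \<alpha>0: "0 < \<alpha>" and W: "fractional_brownian_motion M T H W"
    and X0: "X0 \<in> borel_measurable M" and sol: "pathwise_solution M T (1 - \<alpha>) b \<sigma> W X0 X"
    and S: "class_S T \<beta> 1 \<delta> \<sigma>" and B: "class_B T 1 (1 / \<alpha>) b"
    and mom: "\<And>p::real. p \<ge> 2 \<Longrightarrow> expect_nn M (\<lambda>\<omega>. norm (X0 \<omega>) powr p) < \<infinity>" and p: "p \<ge> 2"
  shows "expect_nn M (\<lambda>\<omega>. sup_path T X \<omega> powr p) < \<infinity>"
proof -
  interpret prob_space M by fact
  \<comment> \<open>Any value strictly between 1 - \<alpha> and H serves. It exceeds 1/2 because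
    \<alpha> < 1/2, hence 1 / \<theta> < 2.\<close>
  define \<theta> where "\<theta> = (1 - \<alpha> + H) / 2"
  have \<theta>: "1 - \<alpha> < \<theta>" "\<theta> < H" "1/2 < \<theta>" using \<alpha> by (auto simp: \<theta>_def)
  obtain K where \<sigma>: "volterra_kernel T \<beta> K \<sigma>" using class_S_imp_volterra_kernel[OF S] by blast
  have \<beta>: "0 < \<beta>" using \<alpha>0 \<alpha> by simp
  obtain A where A: "A > 0" "\<And>t s x. t \<in> {0..T} \<Longrightarrow> s \<in> {0..T} \<Longrightarrow> norm (\<sigma> t s x) \<le> A * (1 + norm x)"
    using volterra_kernel_linear_growth[OF \<sigma>] T \<beta> by auto
  obtain b0 L0 where reg: "drift_regular T 1 b" and b0: "L_space_square T (1 / \<alpha>) b0" and L0: "L0 > 0"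
    and bg: "\<And>t s x. t \<in> {0..T} \<Longrightarrow> s \<in> {0..T} \<Longrightarrow> norm (b t s x) \<le> L0 * norm x + b0 (t, s)"
    using B unfolding class_B_def by blast
  have bg': "norm (b t s x) \<le> L0 * (1 + 1 * norm x) + b0 (t, s)" if "t \<in> {0..T}" "s \<in> {0..T}" for t s x
    using bg[OF that, of x] L0 by (simp add: algebra_simps)
  obtain C where C: "C > 0" and growth:
    "AE \<omega> in M. \<forall>G\<ge>0.
       (\<forall>u v. 0 \<le> u \<longrightarrow> u \<le> v \<longrightarrow> v \<le> T \<longrightarrow> norm (W v \<omega> - W u \<omega>) \<le> G * (v - u) powr \<theta>) \<longrightarrow>
       (\<forall>t\<in>{0..T}.
         ((1::real) = 0 \<longrightarrow> norm (X t \<omega>) \<le> norm (X0 \<omega>) + C * (1 + G) powr (1 / \<theta>)) \<and>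
         ((1::real) = 1 \<longrightarrow> 2 + norm (X t \<omega>) \<le> exp (C * (1 + G) powr (1 / \<theta>)) * (2 + norm (X0 \<omega>))))"
    by (rule volterra_solution_growth[where a = 1 and \<theta> = \<theta>,
        OF sol \<sigma> T \<alpha>0 _ \<beta> _ _ _ _ less_imp_le[OF A(1)] less_imp_le[OF L0] _ reg b0 bg'])
       (use \<theta> \<alpha> A(2) in auto)
  obtain Z where Z: "Z \<in> borel_measurable M" "(\<integral>\<^sup>+\<omega>. Z \<omega> \<partial>M) < \<infinity>"
    "AE \<omega> in M. \<exists>G\<ge>0.
       (\<forall>u v. 0 \<le> u \<longrightarrow> u \<le> v \<longrightarrow> v \<le> T \<longrightarrow> norm (W v \<omega> - W u \<omega>) \<le> G * (v - u) powr \<theta>) \<and>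
       ennreal (exp (2 * p * C * (1 + G) powr (1 / \<theta>))) \<le> Z \<omega>"
    by (rule fBm_holder_exp_moment[OF M W T, of \<theta> "1 / \<theta>" "2 * p * C"])
       (use \<theta> p C in \<open>auto simp: field_simps\<close>)
  \<comment> \<open>A majorant of (2 + |X0|)^(2p) from \<open>add_powr_le\<close>; squaring has
    doubled the order p.\<close>
  define u where "u = (\<lambda>\<omega>. 2 powr (2 * p) * (2 powr (2 * p) + norm (X0 \<omega>) powr (2 * p)))"
  show ?thesis
  proof (rule expect_nn_dominated[OF _ Z(1) _ Z(2)])
    show "u \<in> borel_measurable M" unfolding u_def using X0 by measurable
    have "expect_nn M u = ennreal (2 powr (2 * p)) *
        (ennreal (2 powr (2 * p)) + expect_nn M (\<lambda>\<omega>. norm (X0 \<omega>) powr (2 * p)))"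
      unfolding expect_nn_def u_def using X0
      by (simp add: ennreal_mult nn_integral_cmult nn_integral_add emeasure_space_1)
    also have "\<dots> < \<infinity>" using mom[of "2 * p"] p by (simp add: ennreal_mult_less_top)
    finally show "expect_nn M u < \<infinity>" .
    show "AE \<omega> in M. ennreal (sup_path T X \<omega> powr p) \<le> ennreal (u \<omega>) + Z \<omega>"
      using growth Z(3)
    proof eventually_elim
      case (elim \<omega>)
      then obtain G where G: "G \<ge> 0"
        "\<forall>u v. 0 \<le> u \<longrightarrow> u \<le> v \<longrightarrow> v \<le> T \<longrightarrow> norm (W v \<omega> - W u \<omega>) \<le> G * (v - u) powr \<theta>"
        "ennreal (exp (2 * p * C * (1 + G) powr (1 / \<theta>))) \<le> Z \<omega>" by blast
      define g where "g = (1 + G) powr (1 / \<theta>)"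
      have bd: "norm (X t \<omega>) \<le> exp (C * g) * (2 + norm (X0 \<omega>))" if "t \<in> {0..T}" for t
        using elim(1)[rule_format, OF G(1) _ that] G(2) unfolding g_def by fastforce
      note sup = sup_path_bounds[of T X \<omega>, OF T bd]
      have "sup_path T X \<omega> powr p \<le> (exp (C * g) * (2 + norm (X0 \<omega>))) powr p"
        using sup p by (intro powr_mono2) auto
      also have "\<dots> = exp (C * g) powr p * (2 + norm (X0 \<omega>)) powr p" by (intro powr_mult)
      also have "\<dots> \<le> (exp (C * g) powr p)\<^sup>2 + ((2 + norm (X0 \<omega>)) powr p)\<^sup>2"
        by (intro mult_le_add_squares) auto
      also have "(exp (C * g) powr p)\<^sup>2 = exp (2 * p * C * g)"
        by (simp add: exp_powr_real power2_eq_square exp_add[symmetric] algebra_simps)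
      also have "((2 + norm (X0 \<omega>)) powr p)\<^sup>2 = (2 + norm (X0 \<omega>)) powr (2 * p)"
        by (simp add: power2_eq_square powr_add[symmetric])
      also have "\<dots> \<le> u \<omega>" unfolding u_def using p by (intro add_powr_le) auto
      finally have "sup_path T X \<omega> powr p \<le> u \<omega> + exp (2 * p * C * g)" by simp
      then have "ennreal (sup_path T X \<omega> powr p) \<le> ennreal (u \<omega> + exp (2 * p * C * g))" by (rule ennreal_leI)
      also have "\<dots> = ennreal (u \<omega>) + ennreal (exp (2 * p * C * g))" by (simp add: u_def)
      also have "\<dots> \<le> ennreal (u \<omega>) + Z \<omega>" using G(3) by (intro add_left_mono) (simp add: g_def)
      finally show ?case .
    qed
  qed
qed

lemma sup_exp_moment_finite:
  fixes W :: "real \<Rightarrow> 'w \<Rightarrow> real ^ 'm::finite" and X0 :: "'w \<Rightarrow> real ^ 'd::finite"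
  assumes M: "prob_space M" and T: "T > 0"
    and \<alpha>: "1 - H < \<alpha>" "\<alpha> < 1/2" "\<alpha> < \<beta>" and \<alpha>0: "0 < \<alpha>" and W: "fractional_brownian_motion M T H W"
    and X0: "X0 \<in> borel_measurable M" and sol: "pathwise_solution M T (1 - \<alpha>) b \<sigma> W X0 X"
    and bdd: "\<And>t s x. t \<in> {0..T} \<Longrightarrow> s \<in> {0..T} \<Longrightarrow> norm (\<sigma> t s x) \<le> A"
    and S: "class_S T \<beta> 1 \<delta> \<sigma>" and B: "class_B0 T 1 (1 / \<alpha>) b"
    and mom: "\<And>c \<gamma>::real. c > 0 \<Longrightarrow> 0 < \<gamma> \<Longrightarrow> \<gamma> < 2 * H \<Longrightarrow>
                expect_nn M (\<lambda>\<omega>. exp (c * norm (X0 \<omega>) powr \<gamma>)) < \<infinity>"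
    and c: "c > 0" and \<gamma>: "0 < \<gamma>" "\<gamma> < 2 * H"
  shows "expect_nn M (\<lambda>\<omega>. exp (c * sup_path T X \<omega> powr \<gamma>)) < \<infinity>"
proof -
  \<comment> \<open>The second entry makes \<gamma> / \<theta> < 2, the condition for the
    exponential moment of the noise; room below H is exactly \<gamma> < 2 H.\<close>
  have "max (1 - \<alpha>) (\<gamma> / 2) < H" using \<alpha> \<gamma> by simp
  then obtain \<theta> where "max (1 - \<alpha>) (\<gamma> / 2) < \<theta>" and \<theta>H: "\<theta> < H" using dense by blast
  then have \<theta>: "1 - \<alpha> < \<theta>" "\<gamma> / 2 < \<theta>" "\<theta> < H" "1/2 < \<theta>" using \<alpha> by auto
  obtain K where \<sigma>: "volterra_kernel T \<beta> K \<sigma>" using class_S_imp_volterra_kernel[OF S] by blast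
  have \<beta>: "0 < \<beta>" using \<alpha>0 \<alpha> by simp
  have A: "A \<ge> 0" using bdd[of 0 0 0] T order_trans[OF norm_ge_zero] by auto
  obtain b0 L0 where reg: "drift_regular T 1 b" and b0: "L_space_square T (1 / \<alpha>) b0" and L0: "L0 > 0"
    and bg: "\<And>t s x. t \<in> {0..T} \<Longrightarrow> s \<in> {0..T} \<Longrightarrow> norm (b t s x) \<le> L0 + b0 (t, s)"
    using B unfolding class_B0_def by blast
  have bg': "norm (b t s x) \<le> L0 * (1 + 0 * norm x) + b0 (t, s)" if "t \<in> {0..T}" "s \<in> {0..T}" for t s x
    using bg[OF that, of x] by simp
  obtain C where C: "C > 0" and growth:
    "AE \<omega> in M. \<forall>G\<ge>0.
       (\<forall>u v. 0 \<le> u \<longrightarrow> u \<le> v \<longrightarrow> v \<le> T \<longrightarrow> norm (W v \<omega> - W u \<omega>) \<le> G * (v - u) powr \<theta>) \<longrightarrow>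
       (\<forall>t\<in>{0..T}.
         ((0::real) = 0 \<longrightarrow> norm (X t \<omega>) \<le> norm (X0 \<omega>) + C * (1 + G) powr (1 / \<theta>)) \<and>
         ((0::real) = 1 \<longrightarrow> 2 + norm (X t \<omega>) \<le> exp (C * (1 + G) powr (1 / \<theta>)) * (2 + norm (X0 \<omega>))))"
    by (rule volterra_solution_growth[where a = 0 and \<theta> = \<theta>,
        OF sol \<sigma> T \<alpha>0 _ \<beta> _ _ _ _ A less_imp_le[OF L0] _ reg b0 bg'])
       (use \<theta> \<alpha> bdd in auto)
  \<comment> \<open>The power of 2 comes from splitting the \<gamma>-th power of a sum, the factor 2
    from squaring the exponentials.\<close>
  define k where "k = 2 * c * 2 powr \<gamma>"
  have k: "k > 0" unfolding k_def using c by simp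
  obtain Z where Z: "Z \<in> borel_measurable M" "(\<integral>\<^sup>+\<omega>. Z \<omega> \<partial>M) < \<infinity>"
    "AE \<omega> in M. \<exists>G\<ge>0.
       (\<forall>u v. 0 \<le> u \<longrightarrow> u \<le> v \<longrightarrow> v \<le> T \<longrightarrow> norm (W v \<omega> - W u \<omega>) \<le> G * (v - u) powr \<theta>) \<and>
       ennreal (exp (k * C powr \<gamma> * (1 + G) powr (\<gamma> / \<theta>))) \<le> Z \<omega>"
    by (rule fBm_holder_exp_moment[OF M W T, of \<theta> "\<gamma> / \<theta>" "k * C powr \<gamma>"])
       (use \<theta> \<gamma> C k in \<open>auto simp: field_simps\<close>)
  define u where "u = (\<lambda>\<omega>. exp (k * norm (X0 \<omega>) powr \<gamma>))"
  show ?thesis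
  proof (rule expect_nn_dominated[OF _ Z(1) _ Z(2)])
    show "u \<in> borel_measurable M" unfolding u_def using X0 by measurable
    show "expect_nn M u < \<infinity>" unfolding u_def by (rule mom[OF k \<gamma>])
    show "AE \<omega> in M. ennreal (exp (c * sup_path T X \<omega> powr \<gamma>)) \<le> ennreal (u \<omega>) + Z \<omega>"
      using growth Z(3)
    proof eventually_elim
      case (elim \<omega>)
      then obtain G where G: "G \<ge> 0"
        "\<forall>u v. 0 \<le> u \<longrightarrow> u \<le> v \<longrightarrow> v \<le> T \<longrightarrow> norm (W v \<omega> - W u \<omega>) \<le> G * (v - u) powr \<theta>"
        "ennreal (exp (k * C powr \<gamma> * (1 + G) powr (\<gamma> / \<theta>))) \<le> Z \<omega>" by blast
      define g where "g = (1 + G) powr (1 / \<theta>)"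
      have bd: "norm (X t \<omega>) \<le> norm (X0 \<omega>) + C * g" if "t \<in> {0..T}" for t
        using elim(1)[rule_format, OF G(1) _ that] G(2) unfolding g_def by fastforce
      note sup = sup_path_bounds[of T X \<omega>, OF T bd]
      have g\<gamma>: "(C * g) powr \<gamma> = C powr \<gamma> * (1 + G) powr (\<gamma> / \<theta>)"
        unfolding g_def by (simp add: powr_mult powr_powr)
      have "sup_path T X \<omega> powr \<gamma> \<le> (norm (X0 \<omega>) + C * g) powr \<gamma>"
        using sup \<gamma> by (intro powr_mono2) auto
      also have "\<dots> \<le> 2 powr \<gamma> * (norm (X0 \<omega>) powr \<gamma> + (C * g) powr \<gamma>)"
        using C \<gamma> by (intro add_powr_le) (auto simp: g_def)
      finally have "c * sup_path T X \<omega> powr \<gamma> \<le> c * (2 powr \<gamma> * (norm (X0 \<omega>) powr \<gamma> + (C * g) powr \<gamma>))"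
        using c by (intro mult_left_mono) auto
      also have "\<dots> = k / 2 * norm (X0 \<omega>) powr \<gamma> + k / 2 * (C * g) powr \<gamma>"
        by (simp add: k_def algebra_simps)
      finally have "exp (c * sup_path T X \<omega> powr \<gamma>) \<le> exp (k / 2 * norm (X0 \<omega>) powr \<gamma>) * exp (k / 2 * (C * g) powr \<gamma>)"
        by (simp add: exp_add[symmetric])
      also have "\<dots> \<le> (exp (k / 2 * norm (X0 \<omega>) powr \<gamma>))\<^sup>2 + (exp (k / 2 * (C * g) powr \<gamma>))\<^sup>2"
        by (intro mult_le_add_squares) auto
      also have "\<dots> = u \<omega> + exp (k * C powr \<gamma> * (1 + G) powr (\<gamma> / \<theta>))"
        unfolding g\<gamma> u_def by (simp add: exp_double[symmetric] algebra_simps)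
      finally have "ennreal (exp (c * sup_path T X \<omega> powr \<gamma>)) \<le>
          ennreal (u \<omega> + exp (k * C powr \<gamma> * (1 + G) powr (\<gamma> / \<theta>)))" by (rule ennreal_leI)
      also have "\<dots> = ennreal (u \<omega>) + ennreal (exp (k * C powr \<gamma> * (1 + G) powr (\<gamma> / \<theta>)))"
        by (simp add: u_def)
      also have "\<dots> \<le> ennreal (u \<omega>) + Z \<omega>" using G(3) by (intro add_left_mono)
      finally show ?case .
    qed
  qed
qed

theorem theorem4p1:
  fixes M :: "'w measure"
    and T H \<alpha> \<beta> \<delta> :: real
    and W :: "real \<Rightarrow> 'w \<Rightarrow> real ^ 'm::finite"
    and X0 :: "'w \<Rightarrow> real ^ 'd::finite"
    and X :: "real \<Rightarrow> 'w \<Rightarrow> real ^ 'd"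
    and b :: "real \<Rightarrow> real \<Rightarrow> real ^ 'd \<Rightarrow> real ^ 'd"
    and \<sigma> :: "real \<Rightarrow> real \<Rightarrow> real ^ 'd \<Rightarrow> real ^ 'm ^ 'd"
  assumes "prob_space M"
    and "T > 0"
    and "1/2 < H" and "H < 1"
    and "0 < \<beta>" and "\<beta> \<le> 1"
    and "0 < \<delta>" and "\<delta> \<le> 1"
    and "1 - H < \<alpha>" and "\<alpha> < Min {1/2, \<beta>, \<delta> / (1 + \<delta>)}"
    and "fractional_brownian_motion M T H W"
    and "X0 \<in> borel_measurable M"
    and "pathwise_solution M T (1 - \<alpha>) b \<sigma> W X0 X"
  shows
    "(class_S T \<beta> 1 \<delta> \<sigma> \<and> class_B T 1 (1 / \<alpha>) b \<and>
        (\<forall>p::real. p \<ge> 2 \<longrightarrow> expect_nn M (\<lambda>\<omega>. norm (X0 \<omega>) powr p) < \<infinity>)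
      \<longrightarrow> (\<forall>p::real. p \<ge> 2 \<longrightarrow> expect_nn M (\<lambda>\<omega>. sup_path T X \<omega> powr p) < \<infinity>))
     \<and>
     ((\<exists>C. \<forall>t\<in>{0..T}. \<forall>s\<in>{0..T}. \<forall>x. norm (\<sigma> t s x) \<le> C) \<and>
        class_S T \<beta> 1 \<delta> \<sigma> \<and> class_B0 T 1 (1 / \<alpha>) b \<and>
        (\<forall>c \<gamma>::real. c > 0 \<and> 0 < \<gamma> \<and> \<gamma> < 2 * H
           \<longrightarrow> expect_nn M (\<lambda>\<omega>. exp (c * norm (X0 \<omega>) powr \<gamma>)) < \<infinity>)
      \<longrightarrow> (\<forall>c \<gamma>::real. c > 0 \<and> 0 < \<gamma> \<and> \<gamma> < 2 * H
           \<longrightarrow> expect_nn M (\<lambda>\<omega>. exp (c * sup_path T X \<omega> powr \<gamma>)) < \<infinity>))"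
proof -
  have \<alpha>: "\<alpha> < 1/2" "\<alpha> < \<beta>" "0 < \<alpha>" using assms(4,9,10) by auto
  note i = sup_moment_finite[OF assms(1-3,9) \<alpha> assms(11-13)]
  note ii = sup_exp_moment_finite[OF assms(1,2,9) \<alpha> assms(11-13)]
  show ?thesis
  proof (intro conjI impI allI; elim conjE exE)
    fix p :: real
    assume "class_S T \<beta> 1 \<delta> \<sigma>" "class_B T 1 (1 / \<alpha>) b"
      "\<forall>p::real. p \<ge> 2 \<longrightarrow> expect_nn M (\<lambda>\<omega>. norm (X0 \<omega>) powr p) < \<infinity>" "2 \<le> p"
    then show "expect_nn M (\<lambda>\<omega>. sup_path T X \<omega> powr p) < \<infinity>" by (intro i) auto
  next
    fix c \<gamma> C :: real
    assume bdd: "\<forall>t\<in>{0..T}. \<forall>s\<in>{0..T}. \<forall>x. norm (\<sigma> t s x) \<le> C"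
      and cl: "class_S T \<beta> 1 \<delta> \<sigma>" "class_B0 T 1 (1 / \<alpha>) b"
      and mom: "\<forall>c \<gamma>::real. c > 0 \<and> 0 < \<gamma> \<and> \<gamma> < 2 * H
           \<longrightarrow> expect_nn M (\<lambda>\<omega>. exp (c * norm (X0 \<omega>) powr \<gamma>)) < \<infinity>"
      and c: "c > 0" "0 < \<gamma>" "\<gamma> < 2 * H"
    show "expect_nn M (\<lambda>\<omega>. exp (c * sup_path T X \<omega> powr \<gamma>)) < \<infinity>"
      by (rule ii[where A = C, OF _ cl _ c]) (use bdd mom in auto)
  qed
qed

end
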